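(* Let $U$ be a layer-unique $d$-dimensional multiplication-invariant potential on $\Omega=\{-1,1\}^{\mathbb N}$ with set of primes $\{p_1<\cdots<p_d\}$, let $V$ be the associated shift-invariant potential, $\mu^U_\infty$ and $\mu^V_\infty$ the corresponding unique Gibbs measures, and let $f$ be a first-layer function, $f(\sigma)=f^*(\tau^1)$. Then the limit $$\mathcal P^M(f|\mu^U_\infty)=\lim_{N\to\infty}\frac1N\log\mathbb E_{\mu^U_\infty}\Big(e^{\sum_{i=1}^NT_if}\Big)$$ exists and is given by $$\mathcal P^M(f|\mu^U_\infty)=\kappa\sum_{j=1}^\infty\big(e^{-\rho^-(j)}-e^{-\rho^+(j)}\big)\Psi_j(f^*|V).$$ As a consequence, under $\mu_\infty^U$ the random variables $X_N(f)=\frac1N\sum_{i=1}^NT_if$ satisfy the large deviation principle (with speed $N$) with rate function $$I_f(x)=\sup_{t\in\mathbb R}\big(tx-\mathcal P^M(tf|\mu^U_\infty)\big).$$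
   Context: $\mathbb N=\{1,2,\ldots\}$, $\mathbb N_0=\mathbb N\cup\{0\}$. Multiplicative shift: $(T_i\sigma)_j=\sigma_{ij}$, $T_if(\sigma)=f(T_i\sigma)$. On $\Omega_{0,d}=\{-1,1\}^{(\mathbb N_0)^d}$: $(\theta_x\tau)_y=\tau_{x+y}$, $\theta_xf^*(\tau)=f^*(\theta_x\tau)$. A potential is a function $U(A,\sigma)$ of finite subsets $A\subset\mathbb N$ and $\sigma\in\Omega$ such that $U(A,\sigma)$ depends only on $\sigma_A$ and $\sum_{A\ni i}\max_{\sigma_A}|U(A,\sigma)|<\infty$ for all $i\in\mathbb N$. It is multiplication invariant if $U(iA,\sigma)=U(A,T_i\sigma)$ for all finite $A\subset\mathbb N$, $\sigma\in\Omega$, $i\in\mathbb N$. All multiplication-invariant potentials considered are of the following form: there is a collection $\mathcal A$ of finite subsets of $\mathbb N$ and reals $J_A$, $A\in\mathcal A$, such that $U(iA,\sigma)=J_A\prod_{j\in A}(T_i\sigma)_j$ for $i\in\mathbb N$, $A\in\mathcal A$, and $U(B,\sigma)=0$ if $B$ is not of the form $iA$ (the sets $iA$ being pairwise distinct, so that this is well defined). The set $\{p_1<\cdots<p_d\}$ of primes appearing in the factorizations of the elements of $\bigcup_{A\in\mathcal A}A$ is assumed finite, and $d\ge1$ is its cardinality (the dimension of $U$). The associated shift-invariant potential $V$ on $\Omega_{0,d}$: for $A\in\mathcal A$ let $A'=\{x\in(\mathbb N_0)^d:\prod_kp_k^{x_k}\in A\}$; then $V(A'+y,\tau)=J_A\prod_{x\in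 A'}\tau_{x+y}$ for $y\in(\mathbb N_0)^d$, and $V(B,\tau)=0$ for other finite $B$. $U$ is layer unique if $V$ has exactly one Gibbs measure $\mu^V_\infty$ on $\Omega_{0,d}$. A Gibbs measure for a potential $W$ is a probability measure such that for every finite set $\Lambda$ of sites the conditional distribution of the spins in $\Lambda$ given the configuration $\eta$ outside is proportional to $\exp(-\sum_{A\cap\Lambda\neq\emptyset}W(A,\sigma_\Lambda\eta_{\Lambda^c}))$. Let $\mathcal K(p_1,\ldots,p_d)$ be the set of $r\in\mathbb N$ divisible by none of the $p_k$, and $\tau^r_{x_1,\ldots,x_d}=\sigma_{r\prod_kp_k^{x_k}}$. If $U$ is layer unique it has a unique Gibbs measure $\mu^U_\infty$ on $\Omega$, under which the $\tau^r$, $r\in\mathcal K(p_1,\ldots,p_d)$, are i.i.d. with law $\mu^V_\infty$. A first-layer function is a continuous $f:\Omega\to\mathbb R$ of the form $f(\sigma)=f^*(\tau^1)$ with $f^*:\Omega_{0,d}\to\mathbb R$ continuous. Put $D(\rho)=\{x\in(\mathbb N_0)^d:\sum_kx_k\log p_k\le\rho\}$, $\rho^-(\ell)=\inf\{\rho\ge0:|D(\rho)|=\ell\}$, $\rho^+(\ell)=\sup\{\rho\ge0:|D(\rho)|=\ell\}$, $\kappa=\prod_{k=1}^d(1-1/p_k)$. For $r\in\mathcal K(p_1,\ldots,p_d)$, $r\le N$, let $\Lambda^r_N=\{x\in(\mathbb N_0)^d:r\prod_kp_k^{x_k}\le N\}$. The quantity $$\log\mathbb E_{\mu_\infty^V}\Big(e^{\sum_{x\in\Lambda^r_N}\theta_xf^*}\Big)$$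 depends on $(r,N)$ only through $\ell=|\Lambda^r_N|$ and is denoted $\Psi_\ell(f^*|V)$. *)

theory Defs
  imports "HOL-Probability.Probability" "HOL-Computational_Algebra.Primes"
begin

section \<open>Spin configurations and Gibbs measures\<close>

text \<open>
  A configuration on a set \<open>S\<close> of sites is an extensional function from \<open>S\<close> to \<open>{-1, 1}\<close>.
  Two site sets are used: \<open>{1..}\<close> (the paper's \<open>\<nat>\<close>) and the exponent vectors \<open>nat ^ 'd\<close>.
  Continuity of functions on configurations is \<open>continuous_on\<close> for the product topology of the
  function type, which on \<open>configs S\<close> is the product of the discrete topologies.
\<close>

definition configs :: "'s set \<Rightarrow> ('s \<Rightarrow> real) set" where
  "configs S = (S \<rightarrow>\<^sub>E {-1, 1})"

definition config_space :: "'s set \<Rightarrow> ('s \<Rightarrow> real) measure" where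
  "config_space S = PiM S (\<lambda>_. count_space {-1, 1})"

text \<open>
  The maximum is over the values of \<open>\<bar>W A \<sigma>\<bar>\<close>; there are finitely many of them since \<open>W A \<sigma>\<close>
  depends only on \<open>\<sigma>\<close> restricted to the finite set \<open>A\<close>.
\<close>

definition potential :: "'s set \<Rightarrow> ('s set \<Rightarrow> ('s \<Rightarrow> real) \<Rightarrow> real) \<Rightarrow> bool" where
  "potential S W \<longleftrightarrow>
     (\<forall>A \<sigma> \<sigma>'. finite A \<and> A \<subseteq> S \<and> \<sigma> \<in> configs S \<and> \<sigma>' \<in> configs S \<and> (\<forall>i\<in>A. \<sigma> i = \<sigma>' i)
        \<longrightarrow> W A \<sigma> = W A \<sigma>') \<and>
     (\<forall>i\<in>S. (\<lambda>A. Max ((\<lambda>\<sigma>. \<bar>W A \<sigma>\<bar>) ` configs S)) summable_on {A. finite A \<and> A \<subseteq> S \<and> i \<in> A})"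

definition hamiltonian ::
    "'s set \<Rightarrow> ('s set \<Rightarrow> ('s \<Rightarrow> real) \<Rightarrow> real) \<Rightarrow> 's set \<Rightarrow> ('s \<Rightarrow> real) \<Rightarrow> real" where
  "hamiltonian S W \<Lambda> \<sigma> = (\<Sum>\<^sub>\<infinity>A\<in>{A. finite A \<and> A \<subseteq> S \<and> A \<inter> \<Lambda> \<noteq> {}}. W A \<sigma>)"

text \<open>\<open>override_on \<eta> \<xi> \<Lambda>\<close> is the configuration equal to \<open>\<xi>\<close> on \<open>\<Lambda>\<close> and to \<open>\<eta>\<close> off \<open>\<Lambda>\<close>.\<close>

definition gibbs_kernel ::
    "'s set \<Rightarrow> ('s set \<Rightarrow> ('s \<Rightarrow> real) \<Rightarrow> real) \<Rightarrow> 's set \<Rightarrow> ('s \<Rightarrow> real) \<Rightarrow> ('s \<Rightarrow> real) \<Rightarrow> real" where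
  "gibbs_kernel S W \<Lambda> \<eta> \<xi> =
     exp (- hamiltonian S W \<Lambda> (override_on \<eta> \<xi> \<Lambda>)) /
     (\<Sum>\<zeta>\<in>configs \<Lambda>. exp (- hamiltonian S W \<Lambda> (override_on \<eta> \<zeta> \<Lambda>)))"

definition outside_algebra :: "'s set \<Rightarrow> 's set \<Rightarrow> ('s \<Rightarrow> real) measure" where
  "outside_algebra S \<Lambda> =
     vimage_algebra (configs S) (\<lambda>\<sigma>. restrict \<sigma> (S - \<Lambda>)) (config_space (S - \<Lambda>))"

definition gibbs_measure ::
    "'s set \<Rightarrow> ('s set \<Rightarrow> ('s \<Rightarrow> real) \<Rightarrow> real) \<Rightarrow> ('s \<Rightarrow> real) measure \<Rightarrow> bool" where
  "gibbs_measure S W \<mu> \<longleftrightarrow>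
     prob_space \<mu> \<and> sets \<mu> = sets (config_space S) \<and>
     (\<forall>\<Lambda>. finite \<Lambda> \<and> \<Lambda> \<subseteq> S \<longrightarrow> (\<forall>\<xi>\<in>configs \<Lambda>.
        AE \<eta> in \<mu>. real_cond_exp \<mu> (outside_algebra S \<Lambda>)
            (indicat_real {\<sigma> \<in> configs S. restrict \<sigma> \<Lambda> = \<xi>}) \<eta> = gibbs_kernel S W \<Lambda> \<eta> \<xi>))"


section \<open>Multiplication-invariant potentials and their layers\<close>

text \<open>
  On \<open>configs {1..}\<close> no restriction to \<open>{1..}\<close> is needed: for \<open>i \<ge> 1\<close> the map \<open>j \<mapsto> i * j\<close> preserves
  both \<open>{1..}\<close> and \<open>0\<close>, so extensionality is kept.
\<close>

definition mult_shift :: "nat \<Rightarrow> (nat \<Rightarrow> real) \<Rightarrow> nat \<Rightarrow> real" where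
  "mult_shift i \<sigma> = (\<lambda>j. \<sigma> (i * j))"

definition mult_invariant :: "(nat set \<Rightarrow> (nat \<Rightarrow> real) \<Rightarrow> real) \<Rightarrow> bool" where
  "mult_invariant U \<longleftrightarrow>
     (\<forall>A i. \<forall>\<sigma>\<in>configs {1..}. finite A \<and> A \<subseteq> {1..} \<and> 1 \<le> i \<longrightarrow>
        U ((*) i ` A) \<sigma> = U A (mult_shift i \<sigma>))"

definition mult_form ::
    "nat set set \<Rightarrow> (nat set \<Rightarrow> real) \<Rightarrow> (nat set \<Rightarrow> (nat \<Rightarrow> real) \<Rightarrow> real) \<Rightarrow> bool" where
  "mult_form \<A> J U \<longleftrightarrow>
     (\<forall>A\<in>\<A>. finite A \<and> A \<subseteq> {1..}) \<and>
     inj_on (\<lambda>(i, A). (*) i ` A) ({1..} \<times> \<A>) \<and>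
     (\<forall>i\<ge>1. \<forall>A\<in>\<A>. \<forall>\<sigma>\<in>configs {1..}.
        U ((*) i ` A) \<sigma> = J A * (\<Prod>j\<in>A. mult_shift i \<sigma> j)) \<and>
     (\<forall>B. \<forall>\<sigma>\<in>configs {1..}. finite B \<and> B \<subseteq> {1..} \<and> \<not> (\<exists>i\<ge>1. \<exists>A\<in>\<A>. B = (*) i ` A)
        \<longrightarrow> U B \<sigma> = 0)"

definition primes_of :: "nat set set \<Rightarrow> nat set" where
  "primes_of \<A> = (\<Union>A\<in>\<A>. \<Union>n\<in>A. prime_factors n)"

definition prime_monom :: "('d::finite \<Rightarrow> nat) \<Rightarrow> nat ^ 'd \<Rightarrow> nat" where
  "prime_monom p x = (\<Prod>k\<in>UNIV. p k ^ (x $ k))"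

definition exponents :: "('d::finite \<Rightarrow> nat) \<Rightarrow> nat set \<Rightarrow> (nat ^ 'd) set" where
  "exponents p A = {x. prime_monom p x \<in> A}"

definition associated_potential ::
    "('d::finite \<Rightarrow> nat) \<Rightarrow> nat set set \<Rightarrow> (nat set \<Rightarrow> real) \<Rightarrow>
      ((nat ^ 'd) set \<Rightarrow> (nat ^ 'd \<Rightarrow> real) \<Rightarrow> real) \<Rightarrow> bool" where
  "associated_potential p \<A> J V \<longleftrightarrow>
     (\<forall>A\<in>\<A>. \<forall>y. \<forall>\<tau>\<in>configs UNIV.
        V ((\<lambda>x. x + y) ` exponents p A) \<tau> = J A * (\<Prod>x\<in>exponents p A. \<tau> (x + y))) \<and>
     (\<forall>B. \<forall>\<tau>\<in>configs UNIV. finite B \<and> \<not> (\<exists>A\<in>\<A>. \<exists>y. B = (\<lambda>x. x + y) ` exponents p A)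
        \<longrightarrow> V B \<tau> = 0)"

definition layer_roots :: "('d::finite \<Rightarrow> nat) \<Rightarrow> nat set" where
  "layer_roots p = {r. 1 \<le> r \<and> (\<forall>k. \<not> p k dvd r)}"

definition layer :: "('d::finite \<Rightarrow> nat) \<Rightarrow> nat \<Rightarrow> (nat \<Rightarrow> real) \<Rightarrow> nat ^ 'd \<Rightarrow> real" where
  "layer p r \<sigma> = (\<lambda>x. \<sigma> (r * prime_monom p x))"

definition add_shift :: "nat ^ 'd \<Rightarrow> (nat ^ 'd::finite \<Rightarrow> real) \<Rightarrow> nat ^ 'd \<Rightarrow> real" where
  "add_shift x \<tau> = (\<lambda>y. \<tau> (x + y))"

definition first_layer_function ::
    "('d::finite \<Rightarrow> nat) \<Rightarrow> ((nat \<Rightarrow> real) \<Rightarrow> real) \<Rightarrow> ((nat ^ 'd \<Rightarrow> real) \<Rightarrow> real) \<Rightarrow> bool" where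
  "first_layer_function p f fstar \<longleftrightarrow>
     continuous_on (configs {1..}) f \<and> continuous_on (configs UNIV) fstar \<and>
     (\<forall>\<sigma>\<in>configs {1..}. f \<sigma> = fstar (layer p 1 \<sigma>))"


section \<open>The pressure\<close>

definition log_mgf :: "(nat \<Rightarrow> real) measure \<Rightarrow> ((nat \<Rightarrow> real) \<Rightarrow> real) \<Rightarrow> nat \<Rightarrow> real" where
  "log_mgf \<mu> f N = ln (\<integral>\<sigma>. exp (\<Sum>i=1..N. f (mult_shift i \<sigma>)) \<partial>\<mu>)"

definition mult_pressure :: "(nat \<Rightarrow> real) measure \<Rightarrow> ((nat \<Rightarrow> real) \<Rightarrow> real) \<Rightarrow> real" where
  "mult_pressure \<mu> f = lim (\<lambda>N. 1 / real N * log_mgf \<mu> f N)"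

definition D_set :: "('d::finite \<Rightarrow> nat) \<Rightarrow> real \<Rightarrow> (nat ^ 'd) set" where
  "D_set p \<rho> = {x. (\<Sum>k\<in>UNIV. real (x $ k) * ln (real (p k))) \<le> \<rho>}"

definition rho_minus :: "('d::finite \<Rightarrow> nat) \<Rightarrow> nat \<Rightarrow> real" where
  "rho_minus p l = Inf {\<rho>. 0 \<le> \<rho> \<and> card (D_set p \<rho>) = l}"

definition rho_plus :: "('d::finite \<Rightarrow> nat) \<Rightarrow> nat \<Rightarrow> real" where
  "rho_plus p l = Sup {\<rho>. 0 \<le> \<rho> \<and> card (D_set p \<rho>) = l}"

definition kappa :: "('d::finite \<Rightarrow> nat) \<Rightarrow> real" where
  "kappa p = (\<Prod>k\<in>UNIV. 1 - 1 / real (p k))"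

definition layer_box :: "('d::finite \<Rightarrow> nat) \<Rightarrow> nat \<Rightarrow> nat \<Rightarrow> (nat ^ 'd) set" where
  "layer_box p r N = {x. r * prime_monom p x \<le> N}"

text \<open>
  The boxes \<open>layer_box p r N\<close> are initial segments of the exponent vectors ordered by
  \<open>prime_monom p\<close>, and every cardinality \<open>l \<ge> 1\<close> occurs (already with \<open>r = 1\<close>), so the
  description below determines a unique value for each \<open>l \<ge> 1\<close>.
\<close>

definition Psi ::
    "('d::finite \<Rightarrow> nat) \<Rightarrow> (nat ^ 'd \<Rightarrow> real) measure \<Rightarrow> ((nat ^ 'd \<Rightarrow> real) \<Rightarrow> real) \<Rightarrow> nat \<Rightarrow> real"
  where
  "Psi p \<nu> fstar l =
     (THE v. \<exists>r\<in>layer_roots p. \<exists>N\<ge>r. card (layer_box p r N) = l \<and>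
        v = ln (\<integral>\<tau>. exp (\<Sum>x\<in>layer_box p r N. fstar (add_shift x \<tau>)) \<partial>\<nu>))"


section \<open>Large deviations\<close>

definition ereal_ln :: "real \<Rightarrow> ereal" where
  "ereal_ln q = (if q \<le> 0 then -\<infinity> else ereal (ln q))"

definition large_deviation_principle ::
    "'a measure \<Rightarrow> (nat \<Rightarrow> 'a \<Rightarrow> real) \<Rightarrow> (nat \<Rightarrow> real) \<Rightarrow> (real \<Rightarrow> ereal) \<Rightarrow> bool" where
  "large_deviation_principle M X s I \<longleftrightarrow>
     (\<forall>N. X N \<in> borel_measurable M) \<and>
     (\<forall>x. 0 \<le> I x) \<and> (\<forall>a. closed {x. I x \<le> a}) \<and>
     (\<forall>F. closed F \<longrightarrow>
        limsup (\<lambda>N. ereal (1 / s N) * ereal_ln (measure M {\<omega> \<in> space M. X N \<omega> \<in> F}))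
          \<le> - (INF x\<in>F. I x)) \<and>
     (\<forall>G. open G \<longrightarrow>
        - (INF x\<in>G. I x) \<le>
          liminf (\<lambda>N. ereal (1 / s N) * ereal_ln (measure M {\<omega> \<in> space M. X N \<omega> \<in> G})))"

definition rate_function :: "(nat \<Rightarrow> real) measure \<Rightarrow> ((nat \<Rightarrow> real) \<Rightarrow> real) \<Rightarrow> real \<Rightarrow> ereal" where
  "rate_function \<mu> f x = (SUP t::real. ereal (t * x - mult_pressure \<mu> (\<lambda>\<sigma>. t * f \<sigma>)))"

end

theory Submission
  imports Defs
begin

text \<open>
  Fix a layer and condition a Gibbs measure for \<open>U\<close> on an event that only concerns the other
  layers. Every translate of a shape that meets the layer lies inside it, so the layer then has a Gibbs
  law for \<open>V\<close>, which by uniqueness is \<open>\<mu>V\<close> whatever the event: the layers are independent with common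
  law \<open>\<mu>V\<close>. Hence the logarithmic moment generating function is the sum of \<open>Psi\<close> over the layers
  meeting \<open>{1..N}\<close>. If \<open>s\<^sub>1 < s\<^sub>2 < \<dots>\<close> are the integers composed of the given primes, the layers with
  \<open>j\<close> sites in \<open>{1..N}\<close> are those with \<open>N / s\<^sub>j\<^sub>+\<^sub>1 < r \<le> N / s\<^sub>j\<close>, and they have density
  \<open>kappa p * (1 / s\<^sub>j - 1 / s\<^sub>j\<^sub>+\<^sub>1)\<close>; Tannery's theorem gives the limit. The same domination allows
  termwise differentiation of \<open>t \<mapsto> mult_pressure \<mu>U (\<lambda>\<sigma>. t * f \<sigma>)\<close>, and the large deviation
  principle follows by the argument of Gaertner and Ellis.
\<close>


section \<open>Large deviations from a differentiable limiting cumulant function\<close>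

text \<open>Growth rates control the infinite series. A box with j sites contributes at most C * j
  to the logarithm, where C bounds \<open>fstar\<close>, and its weight is at most 1 / s_j; integers
  built from finitely many primes are so sparse that the sum of j / s_j converges. The derivative in
  t of the j-th cumulant function is a tilted mean, hence again at most C * j, for all t at once. So
  the limit is differentiable on the whole line, whatever the mixing properties of
  \<open>\<mu>V\<close>.

  Multiplication by a product of the given primes keeps the layer, so a shape sees one layer only,
  and the kernels of \<open>U\<close> for finite sets inside a layer are kernels of
  \<open>V\<close>. This speaks of laws given everything outside; to reach independence, uniqueness
  has to be applied to the conditioned law and not just to the marginal.

  About the limiting function itself the large deviation part assumes only a derivative at every
  point. Its tangent inequality comes from concentration under exponential tilting, and the
  intermediate values of the derivative from Darboux's argument.\<close>

locale bounded_mgf_limit = prob_space +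
  fixes X :: "nat \<Rightarrow> 'a \<Rightarrow> real" and C :: real and L L' :: "real \<Rightarrow> real"
  assumes X_measurable [measurable]: "\<And>N. X N \<in> borel_measurable M"
    and X_bounded: "\<And>N \<omega>. \<omega> \<in> space M \<Longrightarrow> \<bar>X N \<omega>\<bar> \<le> C"
    and mgf_limit: "\<And>t. (\<lambda>N. 1 / real N * ln (expectation (\<lambda>\<omega>. exp (t * real N * X N \<omega>)))) \<longlonglongrightarrow> L t"
    and L_deriv: "\<And>t. (L has_real_derivative L' t) (at t)"
begin

section \<open>Exponential tilting, concentration and the tangent inequality\<close>

definition mgf :: "nat \<Rightarrow> real \<Rightarrow> real" where
  "mgf N t = expectation (\<lambda>\<omega>. exp (t * real N * X N \<omega>))"

lemma exp_integrable [simp]: "integrable M (\<lambda>\<omega>. exp (a * X N \<omega>))"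
proof (rule integrable_const_bound[where B = "exp (\<bar>a\<bar> * C)"])
  show "AE \<omega> in M. norm (exp (a * X N \<omega>)) \<le> exp (\<bar>a\<bar> * C)"
  proof (rule AE_I2)
    fix \<omega> assume "\<omega> \<in> space M"
    have "a * X N \<omega> \<le> \<bar>a\<bar> * \<bar>X N \<omega>\<bar>" by (metis abs_ge_self abs_mult)
    also have "\<dots> \<le> \<bar>a\<bar> * C" using X_bounded[OF \<open>\<omega> \<in> space M\<close>] by (intro mult_left_mono) auto
    finally show "norm (exp (a * X N \<omega>)) \<le> exp (\<bar>a\<bar> * C)" by simp
  qed
qed simp

lemma exp_indicator_integrable:
  assumes "A \<in> events" shows "integrable M (\<lambda>\<omega>. indicat_real A \<omega> * exp (a * X N \<omega>))"
  using integrable_mult_indicator[OF assms exp_integrable[of a N]] by simp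

lemma mgf_pos: "mgf N t > 0"
proof -
  have "exp (- \<bar>t * real N\<bar> * C) \<le> exp (t * real N * X N \<omega>)" if "\<omega> \<in> space M" for \<omega>
  proof -
    have "\<bar>t * real N * X N \<omega>\<bar> \<le> \<bar>t * real N\<bar> * C"
      unfolding abs_mult using X_bounded[OF that] by (intro mult_left_mono) auto
    then show ?thesis by auto
  qed
  then have "expectation (\<lambda>_. exp (- \<bar>t * real N\<bar> * C)) \<le> mgf N t"
    unfolding mgf_def by (intro integral_mono) auto
  then have "exp (- \<bar>t * real N\<bar> * C) \<le> mgf N t" by (simp add: prob_space)
  then show ?thesis by (rule less_le_trans[OF exp_gt_zero])
qed

lemma eventually_mgf_le:
  assumes "L t < a" shows "\<forall>\<^sub>F N in sequentially. mgf N t \<le> exp (real N * a)"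
proof -
  have "\<forall>\<^sub>F N in sequentially. 1 / real N * ln (mgf N t) < a"
    using order_tendstoD(2)[OF mgf_limit assms] by (simp add: mgf_def)
  then show ?thesis using eventually_gt_at_top[of 0]
  proof eventually_elim
    case (elim N)
    then have "ln (mgf N t) \<le> real N * a" by (simp add: field_simps)
    then show ?case using mgf_pos[of N t] by (metis exp_le_cancel_iff exp_ln)
  qed
qed

lemma eventually_le_mgf:
  assumes "a < L t" shows "\<forall>\<^sub>F N in sequentially. exp (real N * a) \<le> mgf N t"
proof -
  have "\<forall>\<^sub>F N in sequentially. 1 / real N * ln (mgf N t) > a"
    using order_tendstoD(1)[OF mgf_limit assms] by (simp add: mgf_def)
  then show ?thesis using eventually_gt_at_top[of 0]
  proof eventually_elim
    case (elim N)
    then have "ln (mgf N t) \<ge> real N * a" by (simp add: field_simps)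
    then show ?case using mgf_pos[of N t] by (metis exp_le_cancel_iff exp_ln)
  qed
qed

text \<open>Markov's inequality under the tilt by \<open>t\<close> instead of the bare measure. With
  \<open>h\<close> on both sides of the event, the sign of \<open>h\<close> selects the upper or the
  lower tail, so one statement serves both.\<close>

lemma chernoff:
  "expectation (\<lambda>\<omega>. indicat_real {\<omega>\<in>space M. h * y \<le> h * X N \<omega>} \<omega> * exp (t * real N * X N \<omega>))
     \<le> exp (- real N * (h * y)) * mgf N (t + h)"
proof -
  have "expectation (\<lambda>\<omega>. indicat_real {\<omega>\<in>space M. h * y \<le> h * X N \<omega>} \<omega> * exp (t * real N * X N \<omega>))
     \<le> expectation (\<lambda>\<omega>. exp (- real N * (h * y)) * exp ((t + h) * real N * X N \<omega>))"
  proof (intro integral_mono exp_indicator_integrable)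
    fix \<omega> assume "\<omega> \<in> space M"
    show "indicat_real {\<omega>\<in>space M. h * y \<le> h * X N \<omega>} \<omega> * exp (t * real N * X N \<omega>)
        \<le> exp (- real N * (h * y)) * exp ((t + h) * real N * X N \<omega>)"
    proof (cases "\<omega> \<in> {\<omega>\<in>space M. h * y \<le> h * X N \<omega>}")
      case True
      then have "h * y \<le> h * X N \<omega>" by blast
      then have "real N * (h * y) \<le> real N * (h * X N \<omega>)" by (rule mult_left_mono) simp
      then have "t * real N * X N \<omega> \<le> - real N * (h * y) + (t + h) * real N * X N \<omega>"
        by (simp add: algebra_simps)
      then have "exp (t * real N * X N \<omega>) \<le> exp (- real N * (h * y)) * exp ((t + h) * real N * X N \<omega>)"
        unfolding exp_add[symmetric] by simp
      then show ?thesis unfolding indicator_simps(1)[OF True] by simp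
    next
      case False
      show ?thesis unfolding indicator_simps(2)[OF False] by simp
    qed
  qed auto
  then show ?thesis by (simp add: mgf_def)
qed

text \<open>Differentiability of \<open>L\<close> at \<open>t\<close> makes the exponents of both Chernoff bounds negative.\<close>

lemma tilted_concentration:
  assumes "\<delta> > 0"
  shows "\<forall>\<^sub>F N in sequentially. mgf N t / 2 \<le>
    expectation (\<lambda>\<omega>. indicat_real {\<omega>\<in>space M. \<bar>X N \<omega> - L' t\<bar> < \<delta>} \<omega> * exp (t * real N * X N \<omega>))"
proof -
  have "(L has_derivative (*) (L' t)) (at t)"
    using L_deriv by (simp add: has_field_derivative_def)
  \<comment> \<open>The linearization error is held to half of the slope gap
    \<open>\<delta>\<close>; the other half survives as exponential decay.\<close>
  then obtain d where d: "d > 0"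
    "\<And>y. \<bar>y - t\<bar> < d \<Longrightarrow> \<bar>L y - L t - L' t * (y - t)\<bar> \<le> \<delta> / 2 * \<bar>y - t\<bar>"
    unfolding has_derivative_at_alt using half_gt_zero[OF assms] by (metis real_norm_def)
  \<comment> \<open>Both tails at once: \<open>h\<close> is plus or minus \<open>d / 2\<close>, and
    the assumption on \<open>y\<close> makes it \<open>L' t + \<delta>\<close> or
    \<open>L' t - \<delta>\<close> accordingly.\<close>
  have tail: "\<forall>\<^sub>F N in sequentially. expectation (\<lambda>\<omega>. indicat_real
        {\<omega>\<in>space M. h * y \<le> h * X N \<omega>} \<omega> * exp (t * real N * X N \<omega>)) \<le> mgf N t / 4"
    if h: "\<bar>h\<bar> = d / 2" and y: "h * y = h * L' t + \<bar>h\<bar> * \<delta>" for h y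
  proof -
    have "L (t + h) \<le> L t + h * L' t + \<bar>h\<bar> * \<delta> / 2"
      using d(2)[of "t + h"] h d(1) by (auto simp: abs_if field_simps split: if_splits)
    \<comment> \<open>The surplus in the exponent is 4 * e: one e buys strictness, one pays for the
      lower bound \<open>L t - e\<close>, and of the two remaining factors
      \<open>exp (- real N * e)\<close> one is bounded by 1 / 4 and the other by 1.\<close>
    moreover define e where "e = \<bar>h\<bar> * \<delta> / 8"
    moreover have e: "e > 0" using h d(1) assms by (auto simp: e_def)
    ultimately have lt: "L (t + h) < L t + h * y - 3 * e" using y by auto
    have "\<forall>\<^sub>F N in sequentially. exp (- real N * e) \<le> 1 / 4"
    proof -
      have "(\<lambda>N. exp (- real N * e)) \<longlonglongrightarrow> 0"
        using LIMSEQ_power_zero[of "exp (-e)"] e by (simp add: exp_of_nat_mult[symmetric])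
      from order_tendstoD(2)[OF this, of "1/4"] show ?thesis by (auto elim: eventually_mono)
    qed
    moreover have "L t - e < L t" using e by simp
    note eventually_le_mgf[OF this]
    ultimately show ?thesis using eventually_mgf_le[OF lt]
    proof eventually_elim
      case (elim N)
      note chernoff[of h y N t]
      also have "exp (- real N * (h * y)) * mgf N (t + h)
          \<le> exp (- real N * (h * y)) * exp (real N * (L t + h * y - 3 * e))"
        using elim(3) by (intro mult_left_mono) auto
      also have "\<dots> = exp (- real N * e) * exp (- real N * e) * exp (real N * (L t - e))"
        by (simp add: exp_add[symmetric] algebra_simps)
      also have "\<dots> \<le> 1/4 * 1 * mgf N t"
        using elim e by (intro mult_mono) auto
      finally show ?case by simp
    qed
  qed
  have "d / 2 * (L' t + \<delta>) = d / 2 * L' t + \<bar>d / 2\<bar> * \<delta>"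
    "- d / 2 * (L' t - \<delta>) = - d / 2 * L' t + \<bar>- d / 2\<bar> * \<delta>" using d(1) by (auto simp: field_simps)
  then have "\<forall>\<^sub>F N in sequentially. expectation (\<lambda>\<omega>. indicat_real
        {\<omega>\<in>space M. d / 2 * (L' t + \<delta>) \<le> d / 2 * X N \<omega>} \<omega> * exp (t * real N * X N \<omega>)) \<le> mgf N t / 4"
    "\<forall>\<^sub>F N in sequentially. expectation (\<lambda>\<omega>. indicat_real
        {\<omega>\<in>space M. - d / 2 * (L' t - \<delta>) \<le> - d / 2 * X N \<omega>} \<omega> * exp (t * real N * X N \<omega>)) \<le> mgf N t / 4"
    using d(1) tail[of "d/2"] tail[of "- d/2"] by auto
  then show ?thesis
  proof eventually_elim
    case (elim N)
    let ?A = "{\<omega>\<in>space M. d / 2 * (L' t + \<delta>) \<le> d / 2 * X N \<omega>}"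
    let ?B = "{\<omega>\<in>space M. - d / 2 * (L' t - \<delta>) \<le> - d / 2 * X N \<omega>}"
    let ?E = "{\<omega>\<in>space M. \<bar>X N \<omega> - L' t\<bar> < \<delta>}"
    let ?e = "\<lambda>\<omega>. exp (t * real N * X N \<omega>)"
    have int: "integrable M (\<lambda>\<omega>. indicat_real A \<omega> * ?e \<omega>)" if "A \<in> events" for A
      using exp_indicator_integrable[OF that] by simp
    \<comment> \<open>The window and the two tails cover the space. Each tail carries at most a
      quarter of the tilted mass, which leaves half for the window.\<close>
    have "mgf N t \<le> expectation (\<lambda>\<omega>. indicat_real ?E \<omega> * ?e \<omega> + indicat_real ?A \<omega> * ?e \<omega> + indicat_real ?B \<omega> * ?e \<omega>)"
      unfolding mgf_def
    proof (intro integral_mono Bochner_Integration.integrable_add int)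
      fix \<omega> assume "\<omega> \<in> space M"
      then have \<omega>: "\<omega> \<in> ?E \<or> \<omega> \<in> ?A \<or> \<omega> \<in> ?B"
        using mult_left_mono[of "L' t + \<delta>" "X N \<omega>" "d / 2"] mult_left_mono[of "X N \<omega>" "L' t - \<delta>" "d / 2"] d(1)
        by (cases "\<bar>X N \<omega> - L' t\<bar> < \<delta>"; cases "L' t + \<delta> \<le> X N \<omega>") (simp_all add: abs_if split: if_splits)
      have "1 \<le> indicat_real ?E \<omega> + indicat_real ?A \<omega> + indicat_real ?B \<omega>"
        using d(1) \<omega> by (auto simp: indicator_def)
      then have "1 * ?e \<omega> \<le> (indicat_real ?E \<omega> + indicat_real ?A \<omega> + indicat_real ?B \<omega>) * ?e \<omega>"
        by (intro mult_right_mono) auto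
      then show "?e \<omega> \<le> indicat_real ?E \<omega> * ?e \<omega> + indicat_real ?A \<omega> * ?e \<omega> + indicat_real ?B \<omega> * ?e \<omega>"
        by (simp add: distrib_right)
    qed auto
    also have "\<dots> = expectation (\<lambda>\<omega>. indicat_real ?E \<omega> * ?e \<omega>) + expectation (\<lambda>\<omega>. indicat_real ?A \<omega> * ?e \<omega>)
        + expectation (\<lambda>\<omega>. indicat_real ?B \<omega> * ?e \<omega>)"
    proof -
      have E: "?E \<in> events" and A: "?A \<in> events" and B: "?B \<in> events" by measurable
      show ?thesis
        by (simp only: Bochner_Integration.integral_add Bochner_Integration.integrable_add int[OF E] int[OF A] int[OF B])
    qed
    finally show ?case using elim by simp
  qed
qed

text \<open>Inside the window the density between the tilts \<open>t\<close> and \<open>s\<close> is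
  almost constant. Taking \<open>s = 0\<close> recovers a probability; a general \<open>s\<close>
  yields the tangent inequality.\<close>

lemma tilted_window_le:
  "expectation (\<lambda>\<omega>. indicat_real {\<omega>\<in>space M. \<bar>X N \<omega> - x\<bar> < \<delta>} \<omega> * exp (t * real N * X N \<omega>))
     \<le> exp (real N * ((t - s) * x + \<bar>t - s\<bar> * \<delta>)) *
       expectation (\<lambda>\<omega>. indicat_real {\<omega>\<in>space M. \<bar>X N \<omega> - x\<bar> < \<delta>} \<omega> * exp (s * real N * X N \<omega>))"
proof -
  let ?E = "{\<omega>\<in>space M. \<bar>X N \<omega> - x\<bar> < \<delta>}"
  have "expectation (\<lambda>\<omega>. indicat_real ?E \<omega> * exp (t * real N * X N \<omega>))
    \<le> expectation (\<lambda>\<omega>. exp (real N * ((t - s) * x + \<bar>t - s\<bar> * \<delta>)) * (indicat_real ?E \<omega> * exp (s * real N * X N \<omega>)))"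
  proof (intro integral_mono exp_indicator_integrable integrable_mult_right)
    fix \<omega> assume "\<omega> \<in> space M"
    show "indicat_real ?E \<omega> * exp (t * real N * X N \<omega>)
        \<le> exp (real N * ((t - s) * x + \<bar>t - s\<bar> * \<delta>)) * (indicat_real ?E \<omega> * exp (s * real N * X N \<omega>))"
    proof (cases "\<omega> \<in> ?E")
      case True
      have "(t - s) * (X N \<omega> - x) \<le> \<bar>t - s\<bar> * \<bar>X N \<omega> - x\<bar>" by (metis abs_ge_self abs_mult)
      also have "\<dots> \<le> \<bar>t - s\<bar> * \<delta>" using True by (intro mult_left_mono) auto
      finally have "real N * ((t - s) * (X N \<omega> - x)) \<le> real N * (\<bar>t - s\<bar> * \<delta>)" by (intro mult_left_mono) auto
      then show ?thesis using True by (simp add: exp_add[symmetric] algebra_simps)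
    qed auto
  qed auto
  then show ?thesis by simp
qed

text \<open>Under the tilt by \<open>t\<close> half of the mass sits near \<open>L' t\<close>.
  Passing to the tilt \<open>s\<close> there changes the exponent by about
  \<open>(t - s) * L' t\<close>, and the result is at most the whole of
  \<open>mgf N s\<close>.\<close>

lemma tangent_le: "L t + (s - t) * L' t \<le> L s"
proof (rule field_le_epsilon)
  fix e :: real assume e: "e > 0"
  \<comment> \<open>The retilting error becomes at most e / 4, and the summand 1 covers
    \<open>s = t\<close>. Two more quarters go to the estimates of \<open>mgf\<close>; the factor 1
    / 2 from concentration only costs \<open>ln 2 / real N\<close>.\<close>
  define \<delta> where "\<delta> = e / (4 * (\<bar>t - s\<bar> + 1))"
  have \<delta>: "\<delta> > 0" unfolding \<delta>_def using e by (intro divide_pos_pos mult_pos_pos add_nonneg_pos) auto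
  have \<delta>e: "\<bar>t - s\<bar> * \<delta> \<le> e / 4" using e unfolding \<delta>_def
    by (subst times_divide_eq_right, subst pos_divide_le_eq) (auto simp: field_simps intro: add_pos_nonneg)
  have lt: "L s < L s + e / 4" "L t - e / 4 < L t" using e by auto
  have "\<forall>\<^sub>F N in sequentially. L t + (s - t) * L' t \<le> L s + e * (3 / 4) + ln 2 / real N"
    using tilted_concentration[OF \<delta>, of t] eventually_mgf_le[OF lt(1)] eventually_le_mgf[OF lt(2)]
      eventually_gt_at_top[of 0]
  proof eventually_elim
    case (elim N)
    have "exp (real N * (L t - e / 4)) / 2 \<le> mgf N t / 2" using elim(3) by simp
    also note elim(1)
    also note tilted_window_le[where s = s]
    also have "expectation (\<lambda>\<omega>. indicat_real {\<omega>\<in>space M. \<bar>X N \<omega> - L' t\<bar> < \<delta>} \<omega> * exp (s * real N * X N \<omega>)) \<le> mgf N s"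
      unfolding mgf_def by (intro integral_mono exp_indicator_integrable) (auto simp: indicator_def)
    also note elim(2)
    also have "exp (real N * ((t - s) * L' t + \<bar>t - s\<bar> * \<delta>)) * exp (real N * (L s + e / 4))
      \<le> exp (real N * ((t - s) * L' t + e / 4)) * exp (real N * (L s + e / 4))"
      using \<delta>e by (intro mult_right_mono) (auto intro!: mult_left_mono)
    finally have "exp (real N * (L t - e / 4)) \<le> 2 * (exp (real N * ((t - s) * L' t + e / 4)) * exp (real N * (L s + e / 4)))"
      by simp
    also have "\<dots> = exp (ln 2 + real N * ((t - s) * L' t + e / 4) + real N * (L s + e / 4))"
      by (simp add: exp_add)
    finally have "real N * (L t - e / 4) \<le> ln 2 + real N * ((t - s) * L' t + e / 4) + real N * (L s + e / 4)"
      by simp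
    then show ?case using elim(4) by (simp add: field_simps)
  qed
  moreover have "(\<lambda>N. L s + e * (3 / 4) + ln 2 / real N) \<longlonglongrightarrow> L s + e * (3 / 4) + 0"
    by (intro tendsto_intros lim_const_over_n)
  ultimately have "L t + (s - t) * L' t \<le> L s + e * (3 / 4)"
    by (intro tendsto_lowerbound[where F = sequentially]) auto
  then show "L t + (s - t) * L' t \<le> L s + e" using e by simp
qed

lemma window_lower_bound:
  assumes "\<delta> > 0"
  shows "\<forall>\<^sub>F N in sequentially. mgf N t / 2 * exp (- real N * (t * L' t + \<bar>t\<bar> * \<delta>))
    \<le> prob {\<omega>\<in>space M. \<bar>X N \<omega> - L' t\<bar> < \<delta>}"
  using tilted_concentration[OF assms, of t]
proof eventually_elim
  case (elim N)
  note elim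
  also note tilted_window_le[where s = 0]
  also have "expectation (\<lambda>\<omega>. indicat_real {\<omega>\<in>space M. \<bar>X N \<omega> - L' t\<bar> < \<delta>} \<omega> * exp (0 * real N * X N \<omega>))
     = prob {\<omega>\<in>space M. \<bar>X N \<omega> - L' t\<bar> < \<delta>}" by simp
  finally have "mgf N t / 2 * exp (- real N * (t * L' t + \<bar>t\<bar> * \<delta>)) \<le>
      exp (real N * (t * L' t + \<bar>t\<bar> * \<delta>)) * prob {\<omega>\<in>space M. \<bar>X N \<omega> - L' t\<bar> < \<delta>} * exp (- real N * (t * L' t + \<bar>t\<bar> * \<delta>))"
    by (intro mult_right_mono) auto
  also have "\<dots> = prob {\<omega>\<in>space M. \<bar>X N \<omega> - L' t\<bar> < \<delta>} * (exp (real N * (t * L' t + \<bar>t\<bar> * \<delta>)) * exp (- real N * (t * L' t + \<bar>t\<bar> * \<delta>)))"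
    by simp
  also have "exp (real N * (t * L' t + \<bar>t\<bar> * \<delta>)) * exp (- real N * (t * L' t + \<bar>t\<bar> * \<delta>)) = 1"
    unfolding exp_add[symmetric] by simp
  finally show ?case by simp
qed

section \<open>The rate function and the two large deviation bounds\<close>

lemma L_zero: "L 0 = 0"
  using mgf_limit[of 0] by (simp add: prob_space LIMSEQ_const_iff)

lemma rate_nonneg: "0 \<le> (SUP t. ereal (t * x - L t))"
  by (rule SUP_upper2[of 0]) (auto simp: L_zero zero_ereal_def)

text \<open>Add the tangent inequalities at \<open>s\<close> and at \<open>t\<close>.\<close>

lemma deriv_mono:
  assumes "s \<le> t" shows "L' s \<le> L' t"
proof (cases "s = t")
  case False
  have "(t - s) * L' s \<le> (t - s) * L' t" using tangent_le[of s t] tangent_le[of t s] by (simp add: algebra_simps)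
  then show ?thesis using assms False by simp
qed simp

text \<open>
  A point of finite rate is either in the range of \<open>L'\<close> or one of its endpoints, which is
  approximated along \<open>t \<longrightarrow> \<plusminus>\<infinity>\<close>.
\<close>

lemma exposed_approximation:
  assumes fin: "(SUP t. ereal (t * x - L t)) \<le> ereal r" and "\<delta> > 0"
  shows "\<exists>t. \<bar>L' t - x\<bar> < \<delta> \<and> t * L' t - L t \<le> r"
proof -
  have le: "t * x - L t \<le> r" for t
    using order_trans[OF SUP_upper fin, of t] by simp
  show ?thesis
  proof (cases "\<exists>t. L' t = x")
    case True
    then show ?thesis using le \<open>\<delta> > 0\<close> by (metis abs_zero diff_self)
  next
    case False
    have "(\<forall>t. L' t < x) \<or> (\<forall>t. x < L' t)"
    proof (rule ccontr)
      assume "\<not> ?thesis"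
      then obtain a b where ab: "L' a < x" "x < L' b" using False by (meson linorder_neqE)
      then have "a < b" using deriv_mono[of b a] by (meson leI less_le_trans less_asym)
      \<comment> \<open>Continuity of \<open>L'\<close> is not at hand, so an intermediate value is
        found by Darboux's argument: \<open>g\<close> has negative slope at \<open>a\<close> and
        positive slope at \<open>b\<close>, hence an interior minimum, where
        \<open>L' z = x\<close>.\<close>
      define g where "g s = L s - s * x" for s
      have g: "(g has_real_derivative L' s - x) (at s)" for s
        unfolding g_def by (auto intro!: derivative_eq_intros L_deriv)
      have "continuous_on {a..b} g"
        by (intro continuous_at_imp_continuous_on ballI DERIV_isCont[OF g])
      then obtain z where z: "z \<in> {a..b}" "\<And>s. s \<in> {a..b} \<Longrightarrow> g z \<le> g s"
        using continuous_attains_inf[of "{a..b}" g] \<open>a < b\<close> by auto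
      have "z \<noteq> a"
      proof
        assume "z = a"
        obtain d where "d > 0" "\<And>h. 0 < h \<Longrightarrow> h < d \<Longrightarrow> g (a + h) < g a"
          using DERIV_neg_dec_right[OF g, of a] ab by auto
        then show False using z(2)[of "a + min (d / 2) (b - a)"] \<open>a < b\<close> \<open>z = a\<close>
          by (auto simp: min_def not_le split: if_splits)
            (smt (verit, best) field_sum_of_halves)+
      qed
      moreover have "z \<noteq> b"
      proof
        assume "z = b"
        obtain d where "d > 0" "\<And>h. 0 < h \<Longrightarrow> h < d \<Longrightarrow> g (b - h) < g b"
          using DERIV_pos_inc_left[OF g, of b] ab by auto
        then show False using z(2)[of "b - min (d / 2) (b - a)"] \<open>a < b\<close> \<open>z = b\<close>
          by (auto simp: min_def not_le split: if_splits)
            (smt (verit, best) field_sum_of_halves)+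
      qed
      ultimately have "a < z" "z < b" using z(1) by auto
      then have "L' z - x = 0"
        using z(2) by (intro DERIV_local_min[OF g, of "min (z - a) (b - z)"]) (auto simp: abs_if split: if_splits)
      then show False using False by auto
    qed
    then show ?thesis
    proof
      assume lt: "\<forall>t. L' t < x"
      \<comment> \<open>If \<open>x - L' t\<close> were at least \<open>\<delta>\<close>, then
        \<open>t * (x - L' t)\<close> would be at least |r| + 1; but it is at most \<open>r\<close>,
        by \<open>L t \<le> t * L' t\<close> and the bound on the rate at \<open>x\<close>.\<close>
      define t where "t = (\<bar>r\<bar> + 1) / \<delta>"
      have t: "t > 0" using \<open>\<delta> > 0\<close> by (auto simp: t_def)
      have "L' t > x - \<delta>"
      proof (rule ccontr)
        assume "\<not> ?thesis"
        then have "t * \<delta> \<le> t * (x - L' t)" using t by (intro mult_left_mono) auto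
        also have "t * L' t \<ge> L t" using tangent_le[of t 0] L_zero by simp
        then have "t * (x - L' t) \<le> r" using le[of t] by (simp add: algebra_simps)
        finally show False using \<open>\<delta> > 0\<close> by (simp add: t_def)
      qed
      moreover have "t * L' t \<le> t * x" using t lt by (intro mult_left_mono) (auto intro: less_imp_le)
      ultimately show ?thesis using lt le[of t] by (intro exI[of _ t]) (auto simp: abs_if)
    next
      assume gt: "\<forall>t. x < L' t"
      define t where "t = - (\<bar>r\<bar> + 1) / \<delta>"
      have t: "t < 0" using \<open>\<delta> > 0\<close> by (auto simp: t_def divide_neg_pos)
      have "L' t < x + \<delta>"
      proof (rule ccontr)
        assume "\<not> ?thesis"
        then have "(-t) * \<delta> \<le> (-t) * (L' t - x)" using t by (intro mult_left_mono) auto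
        also have "t * L' t \<ge> L t" using tangent_le[of t 0] L_zero by simp
        then have "(-t) * (L' t - x) \<le> r" using le[of t] by (simp add: algebra_simps)
        finally show False using \<open>\<delta> > 0\<close> by (simp add: t_def)
      qed
      moreover have "t * L' t \<le> t * x" using t gt by (intro mult_left_mono_neg) (auto intro: less_imp_le)
      moreover have "x < L' t" using gt by blast
      ultimately show ?thesis using le[of t] by (intro exI[of _ t]) auto
    qed
  qed
qed

text \<open>The bound for windows around \<open>L' t\<close>, read on the logarithmic scale. It also
  makes the probability positive, so that \<open>ereal_ln\<close> is finite for large
  \<open>N\<close>.\<close>

lemma liminf_window:
  assumes "G \<in> sets borel" "\<delta> > 0" "{L' t - \<delta><..<L' t + \<delta>} \<subseteq> G"
  shows "- ereal (t * L' t - L t)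
    \<le> liminf (\<lambda>N. ereal (1 / real N) * ereal_ln (prob {\<omega> \<in> space M. X N \<omega> \<in> G}))"
proof (rule ereal_le_epsilon2)
  fix e :: real assume e: "e > 0"
  \<comment> \<open>Narrowing the window keeps it inside \<open>G\<close> and brings the cost
    \<open>\<bar>t\<bar> * d\<close> of undoing the tilt below e / 4.\<close>
  define d where "d = min \<delta> (e / (4 * (\<bar>t\<bar> + 1)))"
  have d: "d > 0" "d \<le> \<delta>" unfolding d_def using divide_pos_pos[OF e, of "4 * (\<bar>t\<bar> + 1)"] assms(2) by auto
  have "\<bar>t\<bar> * d \<le> \<bar>t\<bar> * (e / (4 * (\<bar>t\<bar> + 1)))" by (intro mult_left_mono) (auto simp: d_def)
  also have "\<dots> \<le> e / 4" using e by (simp add: field_simps)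
  finally have td: "\<bar>t\<bar> * d \<le> e / 4" .
  have lt: "L t - e / 4 < L t" using e by simp
  obtain N0 where N0: "ln 2 / real N < e / 4" if "N \<ge> N0" for N
    using order_tendstoD(2)[OF lim_const_over_n[of "ln 2 :: real"], of "e / 4"] e
    unfolding eventually_sequentially by auto
  have "\<forall>\<^sub>F N in sequentially. - ereal (t * L' t - L t) - ereal e
    \<le> ereal (1 / real N) * ereal_ln (prob {\<omega> \<in> space M. X N \<omega> \<in> G})"
    using window_lower_bound[OF d(1), of t] eventually_le_mgf[OF lt]
      eventually_gt_at_top[of 0] eventually_ge_at_top[of N0]
  proof eventually_elim
    case (elim N)
    let ?P = "prob {\<omega> \<in> space M. X N \<omega> \<in> G}"
    have "exp (real N * (L t - e / 4)) / 2 * exp (- real N * (t * L' t + e / 4))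
      \<le> mgf N t / 2 * exp (- real N * (t * L' t + \<bar>t\<bar> * d))"
      using elim(2) td mgf_pos[of N t] by (intro mult_mono) (auto intro!: mult_left_mono)
    also note elim(1)
    also have "prob {\<omega>\<in>space M. \<bar>X N \<omega> - L' t\<bar> < d} \<le> ?P"
    proof (rule finite_measure_mono)
      show "{\<omega>\<in>space M. \<bar>X N \<omega> - L' t\<bar> < d} \<subseteq> {\<omega> \<in> space M. X N \<omega> \<in> G}"
        using d(2) assms(3) by (auto simp: abs_if split: if_splits)
    qed (use assms(1) in measurable)
    finally have "exp (real N * (L t - e / 4)) * exp (- real N * (t * L' t + e / 4)) * exp (- ln 2) \<le> ?P"
      by (simp add: exp_minus)
    then have le: "exp (real N * (L t - e / 4) + - real N * (t * L' t + e / 4) + - ln 2) \<le> ?P"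
      unfolding exp_add .
    then have P: "?P > 0" by (rule less_le_trans[OF exp_gt_zero])
    then have "real N * (L t - e / 4) + - real N * (t * L' t + e / 4) + - ln 2 \<le> ln ?P"
      using le by (simp add: ln_ge_iff)
    then have "real N * (L t - t * L' t - e / 2) - ln 2 \<le> ln ?P" by (simp add: algebra_simps)
    then have "L t - t * L' t - e / 2 - ln 2 / real N \<le> 1 / real N * ln ?P"
      using elim(3) divide_right_mono[of "real N * (L t - t * L' t - e / 2) - ln 2" "ln ?P" "real N"]
      by (simp add: diff_divide_distrib)
    then have "L t - t * L' t - e \<le> 1 / real N * ln ?P" using N0[OF elim(4)] e by linarith
    then show ?case using P by (simp add: ereal_ln_def)
  qed
  then have "- ereal (t * L' t - L t) - ereal e
    \<le> liminf (\<lambda>N. ereal (1 / real N) * ereal_ln (prob {\<omega> \<in> space M. X N \<omega> \<in> G}))"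
    by (rule Liminf_bounded)
  then show "- ereal (t * L' t - L t)
    \<le> liminf (\<lambda>N. ereal (1 / real N) * ereal_ln (prob {\<omega> \<in> space M. X N \<omega> \<in> G})) + ereal e"
    by (cases "liminf (\<lambda>N. ereal (1 / real N) * ereal_ln (prob {\<omega> \<in> space M. X N \<omega> \<in> G}))") auto
qed

text \<open>On one side of the mean \<open>L' 0\<close> a closed set has a point \<open>b\<close>
  nearest to the mean, and a single Chernoff bound at \<open>b\<close> covers the whole set. For
  negative \<open>a\<close> the bound is trivial, as a probability is at most 1.\<close>

lemma closed_half_upper_bound:
  assumes "closed F" and half: "(\<forall>x\<in>F. L' 0 \<le> x) \<or> (\<forall>x\<in>F. x \<le> L' 0)"
    and a: "\<And>x. x \<in> F \<Longrightarrow> ereal a < (SUP t. ereal (t * x - L t))"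
  shows "\<forall>\<^sub>F N in sequentially. prob {\<omega> \<in> space M. X N \<omega> \<in> F} \<le> exp (- real N * a)"
proof (cases "F = {} \<or> a < 0")
  case True
  have "prob {\<omega> \<in> space M. X N \<omega> \<in> F} \<le> exp (- real N * a)" for N
  proof (cases "F = {}")
    case False
    then have "1 \<le> exp (- real N * a)" using True by (auto simp: mult_nonneg_nonpos)
    then show ?thesis using prob_le_1 order_trans by blast
  qed simp
  then show ?thesis by simp
next
  case False
  obtain b where b: "b \<in> F" and extreme: "(\<forall>x\<in>F. L' 0 \<le> b \<and> b \<le> x) \<or> (\<forall>x\<in>F. x \<le> b \<and> b \<le> L' 0)"
    using half
  proof
    assume "\<forall>x\<in>F. L' 0 \<le> x"
    then have "bdd_below F" by auto
    then have "Inf F \<in> F" "\<forall>x\<in>F. Inf F \<le> x"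
      using closed_contains_Inf[OF _ _ \<open>closed F\<close>] False by (auto intro: cInf_lower)
    then show ?thesis using that[of "Inf F"] \<open>\<forall>x\<in>F. L' 0 \<le> x\<close> by auto
  next
    assume "\<forall>x\<in>F. x \<le> L' 0"
    then have "bdd_above F" by auto
    then have "Sup F \<in> F" "\<forall>x\<in>F. x \<le> Sup F"
      using closed_contains_Sup[OF _ _ \<open>closed F\<close>] False by (auto intro: cSup_upper)
    then show ?thesis using that[of "Sup F"] \<open>\<forall>x\<in>F. x \<le> L' 0\<close> by auto
  qed
  obtain t where t: "a < t * b - L t" using a[OF b] by (auto simp: less_SUP_iff)
  \<comment> \<open>The sign of \<open>t\<close> is forced: \<open>0 \<le> a < t * b - L t\<close>,
    while the tangent at 0 gives \<open>t * L' 0 \<le> L t\<close>. Hence \<open>t\<close> points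
    away from the mean on the side of \<open>F\<close>.\<close>
  have "0 < t * (b - L' 0)"
    using t False tangent_le[of 0 t] L_zero by (simp add: algebra_simps)
  then have "0 < t \<and> L' 0 < b \<or> t < 0 \<and> b < L' 0" by (simp add: zero_less_mult_iff)
  then have "0 \<le> t \<and> (\<forall>x\<in>F. b \<le> x) \<or> t \<le> 0 \<and> (\<forall>x\<in>F. x \<le> b)"
    using extreme b by force
  then have sgn: "t * b \<le> t * x" if "x \<in> F" for x
    using that by (auto intro: mult_left_mono mult_left_mono_neg)
  have "L t < t * b - a" using t by simp
  from eventually_mgf_le[OF this] show ?thesis
  proof eventually_elim
    case (elim N)
    have "prob {\<omega> \<in> space M. X N \<omega> \<in> F} \<le> prob {\<omega>\<in>space M. t * b \<le> t * X N \<omega>}"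
    proof (rule finite_measure_mono)
      show "{\<omega> \<in> space M. X N \<omega> \<in> F} \<subseteq> {\<omega>\<in>space M. t * b \<le> t * X N \<omega>}" using sgn by blast
    qed measurable
    also have "\<dots> \<le> exp (- real N * (t * b)) * mgf N (0 + t)" using chernoff[of t b N 0] by simp
    also have "\<dots> \<le> exp (- real N * (t * b)) * exp (real N * (t * b - a))" using elim by simp
    also have "\<dots> = exp (- real N * a)" by (simp add: exp_add[symmetric] algebra_simps)
    finally show ?case .
  qed
qed

text \<open>Cutting \<open>F\<close> at the mean leaves two one-sided closed sets. The union bound
  costs a factor 2, which is \<open>ln 2 / real N\<close> after normalization and vanishes.\<close>

lemma limsup_closed:
  assumes "closed F"
  shows "limsup (\<lambda>N. ereal (1 / real N) * ereal_ln (prob {\<omega> \<in> space M. X N \<omega> \<in> F}))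
    \<le> - (INF x\<in>F. SUP t. ereal (t * x - L t))" (is "?l \<le> - ?r")
proof -
  have "?l \<le> - ereal a" if "ereal a < ?r" for a
  proof (rule ereal_le_epsilon2)
    fix e :: real assume e: "e > 0"
    have lt: "ereal a < (SUP t. ereal (t * x - L t))" if "x \<in> F" for x
      using \<open>ereal a < ?r\<close> that by (meson INF_lower less_le_trans)
    have "\<forall>\<^sub>F N in sequentially. prob {\<omega> \<in> space M. X N \<omega> \<in> F \<inter> {L' 0..}} \<le> exp (- real N * a)"
      "\<forall>\<^sub>F N in sequentially. prob {\<omega> \<in> space M. X N \<omega> \<in> F \<inter> {..L' 0}} \<le> exp (- real N * a)"
      using assms lt by (intro closed_half_upper_bound; auto)+
    note half_bounds = this
    obtain N0 where N0: "ln 2 / real N < e" if "N \<ge> N0" for N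
      using order_tendstoD(2)[OF lim_const_over_n[of "ln 2 :: real"], of e] e
      unfolding eventually_sequentially by auto
    have "\<forall>\<^sub>F N in sequentially.
        ereal (1 / real N) * ereal_ln (prob {\<omega> \<in> space M. X N \<omega> \<in> F}) \<le> - ereal a + ereal e"
      using half_bounds eventually_gt_at_top[of 0] eventually_ge_at_top[of N0]
    proof eventually_elim
      case (elim N)
      let ?P = "prob {\<omega> \<in> space M. X N \<omega> \<in> F}"
      have [measurable]: "F \<in> sets borel" using assms by simp
      have "?P \<le> prob ({\<omega> \<in> space M. X N \<omega> \<in> F \<inter> {L' 0..}} \<union> {\<omega> \<in> space M. X N \<omega> \<in> F \<inter> {..L' 0}})"
        by (intro finite_measure_mono) auto
      also have "\<dots> \<le> prob {\<omega> \<in> space M. X N \<omega> \<in> F \<inter> {L' 0..}} + prob {\<omega> \<in> space M. X N \<omega> \<in> F \<inter> {..L' 0}}"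
        by (intro measure_Un_le) measurable
      also have "\<dots> \<le> 2 * exp (- real N * a)" using elim by simp
      also have "\<dots> = exp (ln 2 - real N * a)" by (simp add: exp_diff exp_minus field_simps)
      finally have le: "?P \<le> exp (ln 2 - real N * a)" .
      show ?case
      proof (cases "?P \<le> 0")
        case True
        then show ?thesis using elim(3) by (simp add: ereal_ln_def)
      next
        case False
        then have "ln ?P \<le> ln 2 - real N * a" using le by (metis ln_exp ln_le_cancel_iff exp_gt_zero not_le)
        then have "1 / real N * ln ?P \<le> ln 2 / real N - a" using elim(3) by (simp add: field_simps)
        then have "1 / real N * ln ?P \<le> - a + e" using N0[OF elim(4)] by simp
        then show ?thesis using False by (simp add: ereal_ln_def)
      qed
    qed
    then show "?l \<le> - ereal a + ereal e" by (rule Limsup_bounded)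
  qed
  then have "x \<le> - ?l" if "x < ?r" for x
  proof (cases x)
    case (real a)
    have "- (- ereal a) \<le> - ?l"
      using \<open>\<And>a. ereal a < ?r \<Longrightarrow> ?l \<le> - ereal a\<close>[of a] that real by (simp only: ereal_minus_le_minus)
    then show ?thesis using real by simp
  qed (use that in auto)
  then have "?r \<le> - ?l" by (rule dense_le)
  then have "- (- ?l) \<le> - ?r" by (simp only: ereal_minus_le_minus)
  then show ?thesis by simp
qed

text \<open>Sublevel sets of the rate are intersections over \<open>t\<close> of closed sets. In the
  lower bound a point of infinite rate is trivial, and a point of finite rate has values
  \<open>L' t\<close> nearby in the open set whose cost \<open>t * L' t - L t\<close> is at most
  that rate.\<close>

theorem large_deviations: "large_deviation_principle M X real (\<lambda>x. SUP t. ereal (t * x - L t))"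
  unfolding large_deviation_principle_def
proof (intro conjI allI impI)
  show "closed {x. (SUP t. ereal (t * x - L t)) \<le> a}" for a
  proof -
    have "{x. (SUP t. ereal (t * x - L t)) \<le> a} = (\<Inter>t. {x. ereal (t * x - L t) \<le> a})"
      by (auto simp: SUP_le_iff)
    also have "closed \<dots>"
      by (cases a) (auto intro!: closed_INT closed_Collect_le continuous_intros)
    finally show ?thesis .
  qed
next
  fix G :: "real set" assume "open G"
  let ?l = "liminf (\<lambda>N. ereal (1 / real N) * ereal_ln (prob {\<omega> \<in> space M. X N \<omega> \<in> G}))"
  have "- ?l \<le> (SUP t. ereal (t * x - L t))" if "x \<in> G" for x
  proof (cases "SUP t. ereal (t * x - L t)")
    case (real r)
    obtain e where e: "e > 0" "ball x e \<subseteq> G" using \<open>open G\<close> \<open>x \<in> G\<close> openE by blast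
    obtain t where t: "\<bar>L' t - x\<bar> < e / 2" "t * L' t - L t \<le> r"
      using exposed_approximation[of x r "e / 2"] real e by auto
    have "{L' t - e / 2<..<L' t + e / 2} \<subseteq> ball x e"
      using t(1) by (auto simp: dist_real_def abs_if split: if_splits)
    then have "- ereal (t * L' t - L t) \<le> ?l" using e \<open>open G\<close> by (intro liminf_window[where \<delta> = "e / 2"]) auto
    moreover have "- ereal r \<le> - ereal (t * L' t - L t)" using t by simp
    ultimately have "- ereal r \<le> ?l" by (rule order_trans[rotated])
    then show ?thesis using real by (simp add: ereal_uminus_le_reorder)
  qed (use rate_nonneg[of x] in auto)
  then have "- ?l \<le> (INF x\<in>G. SUP t. ereal (t * x - L t))" by (rule INF_greatest)
  then show "- (INF x\<in>G. SUP t. ereal (t * x - L t)) \<le> ?l" by (simp add: ereal_uminus_le_reorder)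
qed (auto simp: rate_nonneg limsup_closed)

end

section \<open>Layers of the integers and their densities\<close>

text \<open>
  Induction on the set of primes: among the integers free of the primes in \<open>S\<close>, the multiples
  of a further prime \<open>q\<close> are \<open>q\<close> times such integers.
\<close>

lemma density_prime_free:
  fixes S :: "nat set"
  assumes "finite S" "\<And>q. q \<in> S \<Longrightarrow> prime q"
  shows "((\<lambda>y. real (card {r. 1 \<le> r \<and> real r \<le> y \<and> (\<forall>q\<in>S. \<not> q dvd r)}) / y)
    \<longlongrightarrow> (\<Prod>q\<in>S. 1 - 1 / real q)) at_top"
  using assms
proof (induction S rule: finite_induct)
  case empty
  have card: "real (card {r::nat. 1 \<le> r \<and> real r \<le> y}) = real_of_int \<lfloor>y\<rfloor>" if "y \<ge> 0" for y
  proof -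
    have "{r. 1 \<le> r \<and> real r \<le> y} = {1..nat \<lfloor>y\<rfloor>}" using that by (auto simp: le_nat_floor) (simp add: le_floor_iff le_nat_iff)
    then show ?thesis using that by simp
  qed
  have "((\<lambda>y::real. real_of_int \<lfloor>y\<rfloor> / y) \<longlongrightarrow> 1) at_top"
  proof (rule tendsto_sandwich)
    show "\<forall>\<^sub>F y in at_top. (y - 1) / y \<le> real_of_int \<lfloor>y\<rfloor> / y"
      using eventually_gt_at_top[of 0]
    proof eventually_elim
      case (elim y)
      show ?case using elim by (intro divide_right_mono) linarith+
    qed
    show "\<forall>\<^sub>F y in at_top. real_of_int \<lfloor>y\<rfloor> / y \<le> 1"
      using eventually_gt_at_top[of 0] by eventually_elim simp
    have "((\<lambda>y::real. 1 - inverse y) \<longlongrightarrow> 1 - 0) at_top"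
      by (intro tendsto_diff tendsto_const tendsto_inverse_0_at_top filterlim_ident)
    moreover have "\<forall>\<^sub>F y in at_top. 1 - inverse y = (y - 1) / (y::real)"
      using eventually_gt_at_top[of 0] by eventually_elim (simp add: field_simps)
    ultimately have "((\<lambda>y::real. (y - 1) / y) \<longlongrightarrow> 1 - 0) at_top" by (rule Lim_transform_eventually)
    then show "((\<lambda>y::real. (y - 1) / y) \<longlongrightarrow> 1) at_top" by simp
  qed simp
  moreover have "\<forall>\<^sub>F y in at_top. real_of_int \<lfloor>y\<rfloor> / y = real (card {r::nat. 1 \<le> r \<and> real r \<le> y}) / y"
    using eventually_ge_at_top[of 0] by eventually_elim (simp only: card)
  ultimately have "((\<lambda>y. real (card {r::nat. 1 \<le> r \<and> real r \<le> y}) / y) \<longlongrightarrow> 1) at_top"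
    by (rule Lim_transform_eventually)
  then show ?case by simp
next
  case (insert q S)
  define c where "c y = real (card {r. 1 \<le> r \<and> real r \<le> y \<and> (\<forall>q\<in>S. \<not> q dvd r)})" for y
  have IH: "((\<lambda>y. c y / y) \<longlongrightarrow> (\<Prod>q\<in>S. 1 - 1 / real q)) at_top"
    unfolding c_def using insert by auto
  have q: "prime q" "q > 0" using insert prime_gt_0_nat by auto
  have card: "real (card {r. 1 \<le> r \<and> real r \<le> y \<and> (\<forall>q'\<in>insert q S. \<not> q' dvd r)}) = c y - c (y / q)" for y
  proof -
    let ?A = "{r. 1 \<le> r \<and> real r \<le> y \<and> (\<forall>q'\<in>insert q S. \<not> q' dvd r)}"
    let ?B = "{r. 1 \<le> r \<and> real r \<le> y / q \<and> (\<forall>q'\<in>S. \<not> q' dvd r)}"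
    let ?C = "{r. 1 \<le> r \<and> real r \<le> y \<and> (\<forall>q'\<in>S. \<not> q' dvd r)}"
    have fin: "finite ?C" by (rule finite_subset[of _ "{..nat \<lfloor>y\<rfloor>}"]) (auto simp: le_nat_floor)
    \<comment> \<open>\<open>q\<close> lies outside \<open>S\<close>, so \<open>q\<close> and
      \<open>q'\<close> are distinct primes.\<close>
    have "\<not> q' dvd q * r \<longleftrightarrow> \<not> q' dvd r" if "q' \<in> S" for q' r
      using that insert q by (metis primes_dvd_imp_eq prime_dvd_mult_iff dvd_mult insertI2)
    then have C: "?C = ?A \<union> (*) q ` ?B"
      using q by (auto simp: image_iff field_simps dvd_def)
    have "card ?C = card ?A + card ((*) q ` ?B)"
      using fin unfolding C by (intro card_Un_disjoint) auto
    also have "card ((*) q ` ?B) = card ?B" using q by (intro card_image) (auto simp: inj_on_def)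
    finally show ?thesis by (simp add: c_def)
  qed
  have "filterlim (\<lambda>y. inverse (real q) * y) at_top at_top"
    using q by (intro filterlim_tendsto_pos_mult_at_top[OF tendsto_const _ filterlim_ident]) auto
  then have "filterlim (\<lambda>y. y / real q) at_top at_top" by (simp add: divide_inverse mult.commute)
  \<comment> \<open>\<open>c (y / q) / y\<close> is 1 / q times the ratio of the induction
    hypothesis at \<open>y / q\<close>; the difference produces the factor 1 - 1 / q.\<close>
  from filterlim_compose[OF IH this]
  have "((\<lambda>y. c y / y - 1 / real q * (c (y / q) / (y / q))) \<longlongrightarrow>
      (\<Prod>q\<in>S. 1 - 1 / real q) - 1 / real q * (\<Prod>q\<in>S. 1 - 1 / real q)) at_top"
    by (intro tendsto_intros IH)
  moreover have "(\<lambda>y. c y / y - 1 / real q * (c (y / q) / (y / q))) = (\<lambda>y. (c y - c (y / q)) / y)"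
    using q by (auto simp: fun_eq_iff diff_divide_distrib)
  moreover have "(\<Prod>q\<in>S. 1 - 1 / real q) - 1 / real q * (\<Prod>q\<in>S. 1 - 1 / real q) = (\<Prod>q\<in>insert q S. 1 - 1 / real q)"
    using insert by (simp add: algebra_simps)
  ultimately have "((\<lambda>y. (c y - c (y / q)) / y) \<longlongrightarrow> (\<Prod>q\<in>insert q S. 1 - 1 / real q)) at_top"
    by metis
  then show ?case by (simp only: card)
qed

section \<open>Factorization of an integer into a layer root and a product of the given
  primes\<close>

locale prime_family =
  fixes p :: "'d::finite \<Rightarrow> nat"
  assumes inj_p: "inj p" and prime_p: "\<And>k. prime (p k)"
begin

abbreviation pm :: "nat ^ 'd \<Rightarrow> nat" where "pm \<equiv> prime_monom p"

lemma pm_pos [simp]: "0 < pm x"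
  unfolding prime_monom_def using prime_p by (auto intro!: prod_pos simp: prime_gt_0_nat)

lemma pm_neq_0 [simp]: "pm x \<noteq> 0"
  using pm_pos[of x] by linarith

lemma pm_ge_1 [simp]: "Suc 0 \<le> pm x"
  using pm_pos[of x] by linarith

lemma p_neq_0 [simp]: "p k \<noteq> 0"
  using prime_gt_0_nat[OF prime_p[of k]] by simp

lemma pm_zero [simp]: "pm 0 = 1"
  by (simp add: prime_monom_def)

lemma pm_add: "pm (x + y) = pm x * pm y"
  by (simp add: prime_monom_def power_add prod.distrib)

lemma pm_axis: "pm (axis k 1) = p k"
proof -
  have "pm (axis k 1) = (\<Prod>l\<in>UNIV. if l = k then p k else 1)"
    unfolding prime_monom_def by (intro prod.cong refl) (auto simp: axis_def)
  then show ?thesis by simp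
qed

lemma multiplicity_pm: "multiplicity (p k) (pm x) = x $ k"
proof -
  have "multiplicity (p k) (pm x) = (\<Sum>l\<in>UNIV. multiplicity (p k) (p l ^ (x $ l)))"
    unfolding prime_monom_def using prime_p p_neq_0
    by (intro prime_elem_multiplicity_prod_distrib) auto
  also have "\<dots> = (\<Sum>l\<in>UNIV. if l = k then x $ k else 0)"
  proof (intro sum.cong refl)
    fix l
    have "p k \<noteq> p l" if "l \<noteq> k" using that injD[OF inj_p] by blast
    moreover have "\<not> is_unit (p k)" using prime_p not_prime_unit by blast
    ultimately show "multiplicity (p k) (p l ^ (x $ l)) = (if l = k then x $ k else 0)"
      by (simp add: multiplicity_distinct_prime_power[OF prime_p prime_p] multiplicity_same_power)
  qed
  finally show ?thesis by simp
qed

lemma inj_pm: "inj pm"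
  by (rule injI, rule vec_eq_iff[THEN iffD2]) (metis multiplicity_pm)

lemma roots_pos: "r \<in> layer_roots p \<Longrightarrow> 0 < r"
  by (auto simp: layer_roots_def)

text \<open>A root is divisible by no \<open>p k\<close>, so the exponent vector is read off as the
  multiplicities of the \<open>p k\<close> in the product.\<close>

lemma site_unique:
  assumes "r \<in> layer_roots p" "r' \<in> layer_roots p" and eq: "r * pm x = r' * pm x'"
  shows "r = r' \<and> x = x'"
proof -
  have "multiplicity (p k) (r * pm x) = x $ k" if "r \<in> layer_roots p" for r x k
    using that prime_p
    by (subst multiplicity_prime_elem_times_other) (auto simp: layer_roots_def multiplicity_pm)
  then have "x = x'" using assms by (metis vec_eq_iff)
  then show ?thesis using eq by simp
qed

lemma site_exists:
  assumes "0 < n"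
  shows "\<exists>r\<in>layer_roots p. \<exists>x. n = r * pm x"
  using assms
proof (induction n rule: less_induct)
  case (less n)
  show ?case
  proof (cases "n \<in> layer_roots p")
    case True
    then show ?thesis by (intro bexI[of _ n] exI[of _ 0]) auto
  next
    case False
    then obtain k where "p k dvd n" using less.prems by (auto simp: layer_roots_def)
    then obtain m where m: "n = p k * m" by (auto simp: dvd_def)
    then have "0 < m" "m < n" using less.prems prime_gt_1_nat[OF prime_p[of k]] by auto
    then obtain r x where "r \<in> layer_roots p" "m = r * pm x" using less.IH by blast
    then have "n = r * pm (x + axis k 1)" using m by (simp only: pm_add pm_axis mult_ac)
    then show ?thesis using \<open>r \<in> layer_roots p\<close> by blast
  qed
qed

text \<open>Multiplying by a product of the given primes does not change the root, so a multiplier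
  that reaches a layer already lies in it. This is why no interaction couples two layers.\<close>

lemma site_in_layer:
  assumes "r \<in> layer_roots p" "0 < i" "i * pm x = r * pm y"
  obtains z where "i = r * pm z" "y = z + x"
proof -
  obtain r' z where "r' \<in> layer_roots p" "i = r' * pm z" using site_exists[OF assms(2)] by blast
  moreover from this have "r' * pm (z + x) = r * pm y" using assms(3) by (simp add: pm_add)
  ultimately show ?thesis using site_unique assms(1) that by metis
qed

lemma finite_pm_le: "finite {x. real (pm x) \<le> y}"
proof (rule finite_imageD)
  show "finite (pm ` {x. real (pm x) \<le> y})"
    by (rule finite_subset[of _ "{..nat \<lfloor>y\<rfloor>}"]) (auto simp: le_nat_floor)
qed (rule inj_on_subset[OF inj_pm], auto)

text \<open>Boxes, like the sets \<open>D_set p \<rho>\<close> below, are sublevel sets of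
  \<open>pm\<close> with a real threshold; counting and nesting are then settled once for all
  thresholds.\<close>

lemma layer_box_eq: "0 < r \<Longrightarrow> layer_box p r N = {x. real (pm x) \<le> real N / real r}"
  by (auto simp: layer_box_def pos_le_divide_eq mult.commute simp flip: of_nat_mult)

lemma D_set_eq: "D_set p \<rho> = {x. real (pm x) \<le> exp \<rho>}"
proof -
  have "(\<Sum>k\<in>UNIV. real (x $ k) * ln (real (p k))) = ln (real (pm x))" for x
    using prime_p by (simp add: prime_monom_def ln_prod ln_realpow prime_gt_0_nat)
  moreover have "ln (real (pm x)) \<le> \<rho> \<longleftrightarrow> real (pm x) \<le> exp \<rho>" for x
    by (metis exp_le_cancel_iff exp_ln of_nat_0_less_iff pm_pos)
  ultimately show ?thesis by (simp add: D_set_def)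
qed

text \<open>The increasing enumeration starts at index 0 with the value 1, so
  \<open>smooth j\<close> is the integer s with index j + 1 of the overview. Hence
  \<open>Suc j\<close> wherever a number of sites occurs.\<close>

definition smooth :: "nat \<Rightarrow> nat" where "smooth = enumerate (range pm)"

lemma infinite_range_pm: "infinite (range pm)"
proof -
  have "infinite (UNIV :: (nat ^ 'd) set)"
  proof
    assume "finite (UNIV :: (nat ^ 'd) set)"
    then have "finite (range (\<lambda>n. axis (SOME k. True) n :: nat ^ 'd))" by (rule finite_subset[rotated]) auto
    moreover have "inj (\<lambda>n. axis (SOME k. True) n :: nat ^ 'd)" by (intro injI) (auto simp: axis_eq_axis)
    ultimately show False using finite_imageD infinite_UNIV_nat by blast
  qed
  then show ?thesis using inj_pm finite_imageD by blast
qed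

lemma smooth_strict_mono: "strict_mono smooth"
  using enumerate_mono[OF _ infinite_range_pm] by (simp add: smooth_def strict_mono_def)

lemma range_smooth: "range smooth = range pm"
  using bij_enumerate[OF infinite_range_pm] by (simp add: smooth_def bij_betw_def)

lemma smooth_pos [simp]: "0 < smooth j"
  using range_smooth pm_pos by (metis rangeE rangeI)

text \<open>The indices \<open>i\<close> with \<open>smooth i \<le> y\<close> form an initial
  segment, and such a segment has j + 1 elements exactly when it contains \<open>j\<close> but not
  \<open>Suc j\<close>.\<close>

lemma card_pm_le_eq_Suc_iff:
  "card {x. real (pm x) \<le> y} = Suc j \<longleftrightarrow> real (smooth j) \<le> y \<and> y < real (smooth (Suc j))"
proof -
  define I where "I = {i. real (smooth i) \<le> y}"
  have inj: "inj smooth" using smooth_strict_mono by (rule strict_mono_imp_inj_on)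
  have im: "pm ` {x. real (pm x) \<le> y} = smooth ` I"
  proof -
    have "pm ` {x. real (pm x) \<le> y} = {n \<in> range pm. real n \<le> y}" by auto
    also have "\<dots> = smooth ` I" unfolding range_smooth[symmetric] I_def by auto
    finally show ?thesis .
  qed
  have fin: "finite I"
    using finite_imageD[OF _ inj_on_subset[OF inj]] im finite_pm_le by (metis finite_imageI subset_UNIV)
  have card: "card {x. real (pm x) \<le> y} = card I"
    using card_image[OF inj_on_subset[OF inj_pm]] card_image[OF inj_on_subset[OF inj]] im by (metis subset_UNIV)
  have down: "i \<in> I" if "i' \<in> I" "i \<le> i'" for i i'
    using that strict_mono_less_eq[OF smooth_strict_mono] by (auto simp: I_def intro: order_trans[rotated])
  have "card I = Suc j \<longleftrightarrow> j \<in> I \<and> Suc j \<notin> I"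
  proof
    assume c: "card I = Suc j"
    have "j \<in> I"
    proof (rule ccontr)
      assume "j \<notin> I"
      then have "I \<subseteq> {..<j}" using down by (meson lessThan_iff not_le subsetI)
      then show False using card_mono[of "{..<j}" I] c by simp
    qed
    moreover have "Suc j \<notin> I"
    proof
      assume "Suc j \<in> I"
      then have "{..Suc j} \<subseteq> I" using down by auto
      then show False using card_mono[OF fin, of "{..Suc j}"] c by simp
    qed
    ultimately show "j \<in> I \<and> Suc j \<notin> I" by simp
  next
    assume "j \<in> I \<and> Suc j \<notin> I"
    then have "I = {..j}" using down by (meson atMost_iff not_less_eq_eq subset_antisym subsetI)
    then show "card I = Suc j" by simp
  qed
  then show ?thesis by (auto simp: card I_def)
qed

text \<open>The thresholds giving j + 1 points form a half-open interval between consecutive values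
  of \<open>ln (smooth j)\<close>; its endpoints are the infimum and the supremum. Nonnegativity is
  automatic since \<open>smooth j\<close> is at least 1.\<close>

lemma rho_Suc:
  shows "rho_minus p (Suc j) = ln (smooth j)" "rho_plus p (Suc j) = ln (smooth (Suc j))"
proof -
  have "{\<rho>. 0 \<le> \<rho> \<and> card (D_set p \<rho>) = Suc j} = {ln (smooth j)..<ln (smooth (Suc j))}"
    unfolding D_set_eq card_pm_le_eq_Suc_iff
  proof (intro set_eqI)
    fix \<rho>
    have "0 \<le> ln (real (smooth j))" using smooth_pos[of j] by (simp add: Suc_le_eq)
    then show "\<rho> \<in> {\<rho>. 0 \<le> \<rho> \<and> real (smooth j) \<le> exp \<rho> \<and> exp \<rho> < real (smooth (Suc j))} \<longleftrightarrow>
        \<rho> \<in> {ln (smooth j)..<ln (smooth (Suc j))}"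
      using \<open>0 \<le> ln (real (smooth j))\<close> exp_le_cancel_iff[of "ln (real (smooth j))" \<rho>] exp_less_cancel_iff[of \<rho> "ln (real (smooth (Suc j)))"]
      by (auto intro: order_trans[of 0 "ln (real (smooth j))" \<rho>])
  qed
  moreover have "ln (real (smooth j)) < ln (smooth (Suc j))"
    using smooth_strict_mono smooth_pos by (simp add: strict_mono_def)
  ultimately show "rho_minus p (Suc j) = ln (smooth j)" "rho_plus p (Suc j) = ln (smooth (Suc j))"
    by (simp_all add: rho_minus_def rho_plus_def)
qed

lemma exp_rho:
  shows "exp (- rho_minus p (Suc j)) = 1 / real (smooth j)"
    "exp (- rho_plus p (Suc j)) = 1 / real (smooth (Suc j))"
  by (simp_all add: rho_Suc exp_minus inverse_eq_divide)

text \<open>Rankin's trick: each term of the count is at most \<open>(y / n) powr (1 / 3)\<close>.\<close>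

lemma card_pm_le_bound: "\<exists>K>0. \<forall>y\<ge>1. real (card {x. real (pm x) \<le> y}) \<le> K * y powr (1 / 3)"
proof -
  \<comment> \<open>The constant in the bound is the Euler product for the sum of
    \<open>n powr (- 1 / 3)\<close> over all products n of the given primes; it is finite because
    the primes are finitely many.\<close>
  define a where "a k = real (p k) powr (- 1 / 3)" for k
  have a: "0 < a k" "a k < 1" for k
    using prime_gt_1_nat[OF prime_p[of k]] by (auto simp: a_def powr_less_one)
  have "real (card {x. real (pm x) \<le> y}) \<le> (\<Prod>k\<in>UNIV. 1 / (1 - a k)) * y powr (1 / 3)" if y: "y \<ge> 1" for y
  proof -
    define m where "m = nat \<lfloor>y\<rfloor>"
    \<comment> \<open>Enlarging the sublevel set to a cube lets the sum factor into truncated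
      geometric series. It fits, since each exponent is smaller than its prime power, which divides
      \<open>pm x\<close>.\<close>
    have sub: "($) ` {x. real (pm x) \<le> y} \<subseteq> (UNIV \<rightarrow>\<^sub>E {..m})"
    proof (intro image_subsetI PiE_I)
      fix x k assume "x \<in> {x. real (pm x) \<le> y}"
      then have "pm x \<le> m" by (simp add: m_def le_nat_floor)
      moreover have "p k ^ (x $ k) dvd pm x"
        unfolding prime_monom_def by (rule dvd_prodI) auto
      then have "p k ^ (x $ k) \<le> pm x" by (rule dvd_imp_le) simp
      moreover have "x $ k < p k ^ (x $ k)"
        using prime_gt_1_nat[OF prime_p[of k]] by (intro power_gt_expt) simp
      ultimately show "x $ k \<in> {..m}" by simp
    qed simp
    have one_le: "1 \<le> y powr (1 / 3) * (\<Prod>k\<in>UNIV. a k ^ (x $ k))" if "real (pm x) \<le> y" for x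
    proof -
      have "(\<Prod>k\<in>UNIV. a k ^ (x $ k)) = real (pm x) powr (- 1 / 3)"
        unfolding prime_monom_def a_def of_nat_prod
        by (subst prod_powr_distrib)
          (auto intro!: prod.cong simp: powr_powr mult.commute prime_gt_0_nat[OF prime_p] simp flip: powr_realpow)
      moreover have "y powr (- 1 / 3) \<le> real (pm x) powr (- 1 / 3)"
        using that by (intro powr_mono2') auto
      then have "y powr (1 / 3) * y powr (- 1 / 3) \<le> y powr (1 / 3) * real (pm x) powr (- 1 / 3)"
        by (intro mult_left_mono) auto
      ultimately show ?thesis using y by (simp add: powr_add[symmetric])
    qed
    have "real (card {x. real (pm x) \<le> y}) = (\<Sum>x | real (pm x) \<le> y. 1)" by simp
    also have "\<dots> \<le> (\<Sum>x | real (pm x) \<le> y. y powr (1 / 3) * (\<Prod>k\<in>UNIV. a k ^ (x $ k)))"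
      by (intro sum_mono one_le) simp
    also have "\<dots> = y powr (1 / 3) * (\<Sum>g\<in>($) ` {x. real (pm x) \<le> y}. \<Prod>k\<in>UNIV. a k ^ g k)"
      by (subst sum.reindex) (auto simp: sum_distrib_left inj_on_def vec_nth_inject)
    also have "\<dots> \<le> y powr (1 / 3) * (\<Sum>g\<in>UNIV \<rightarrow>\<^sub>E {..m}. \<Prod>k\<in>UNIV. a k ^ g k)"
      using a by (intro mult_left_mono sum_mono2[OF _ sub] finite_PiE prod_nonneg) (auto intro: less_imp_le)
    also have "(\<Sum>g\<in>UNIV \<rightarrow>\<^sub>E {..m}. \<Prod>k\<in>UNIV. a k ^ g k) = (\<Prod>k\<in>UNIV. \<Sum>i\<le>m. a k ^ i)"
      by (rule prod_sum_PiE[symmetric]) auto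
    also have "\<dots> \<le> (\<Prod>k\<in>UNIV. 1 / (1 - a k))"
    proof (intro prod_mono conjI)
      fix k
      show "0 \<le> (\<Sum>i\<le>m. a k ^ i)" using a by (intro sum_nonneg) (auto intro: less_imp_le)
      have "(\<Sum>i<Suc m. a k ^ i) = (1 - a k ^ Suc m) / (1 - a k)"
        using a[of k] by (subst sum_gp_strict) auto
      also have "\<dots> \<le> 1 / (1 - a k)" using a[of k] by (intro divide_right_mono) auto
      finally show "(\<Sum>i\<le>m. a k ^ i) \<le> 1 / (1 - a k)" by (simp add: lessThan_Suc_atMost)
    qed
    finally show ?thesis using y by (simp add: mult.commute mult_left_mono)
  qed
  moreover have "(\<Prod>k\<in>UNIV. 1 / (1 - a k)) > 0" using a by (intro prod_pos) auto
  ultimately show ?thesis by blast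
qed

text \<open>Counting at \<open>y = smooth j\<close> gives
  \<open>j + 1 \<le> K * smooth j powr (1 / 3)\<close>; cubing bounds the term by
  \<open>K ^ 3 / (j + 1) ^ 2\<close>. An exponent below 1 / 2 in the count is what makes this
  converge, and 1 / 3 gives an integral power.\<close>

lemma summable_smooth: "summable (\<lambda>j. real (Suc j) / real (smooth j))"
proof -
  obtain K where K: "K > 0" "\<And>y. y \<ge> 1 \<Longrightarrow> real (card {x. real (pm x) \<le> y}) \<le> K * y powr (1 / 3)"
    using card_pm_le_bound by blast
  have "norm (real (Suc j) / real (smooth j)) \<le> K ^ 3 * (1 / real (Suc j) ^ 2)" for j
  proof -
    have "card {x. real (pm x) \<le> real (smooth j)} = Suc j"
      using smooth_strict_mono by (simp only: card_pm_le_eq_Suc_iff strict_mono_def) auto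
    then have "real (Suc j) \<le> K * real (smooth j) powr (1 / 3)"
      using K(2)[of "real (smooth j)"] smooth_pos[of j] by (simp add: Suc_le_eq)
    then have "real (Suc j) ^ 3 \<le> (K * real (smooth j) powr (1 / 3)) ^ 3"
      by (intro power_mono) auto
    also have "\<dots> = K ^ 3 * real (smooth j)"
      by (simp add: power_mult_distrib powr_power)
    finally have "real (Suc j) * real (Suc j) ^ 2 \<le> K ^ 3 * real (smooth j)"
      by (simp add: power3_eq_cube power2_eq_square mult.assoc)
    then show ?thesis
      by (simp add: divide_le_eq le_divide_eq del: of_nat_Suc)
  qed
  note bound = this
  have "summable (\<lambda>j. 1 / real (Suc j) ^ 2)"
    using inverse_power_summable[of 2, where 'a = real]
    by (subst summable_Suc_iff) (simp add: inverse_eq_divide)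
  then have "summable (\<lambda>j. K ^ 3 * (1 / real (Suc j) ^ 2))" by (rule summable_mult)
  then show ?thesis by (rule summable_comparison_test'[where N = 0]) (rule bound)
qed

section \<open>Counting the layers by their number of sites, and averages over layers\<close>

lemma layer_count:
  defines "c \<equiv> \<lambda>y. real (card {r. 1 \<le> r \<and> real r \<le> y \<and> (\<forall>q\<in>range p. \<not> q dvd r)})"
  shows "real (card {r \<in> layer_roots p. r \<le> N \<and> card (layer_box p r N) = Suc j})
    = c (real N / smooth j) - c (real N / smooth (Suc j))"
proof -
  let ?C = "\<lambda>y. {r. 1 \<le> r \<and> real r \<le> y \<and> (\<forall>q\<in>range p. \<not> q dvd r)}"
  let ?A = "{r \<in> layer_roots p. r \<le> N \<and> card (layer_box p r N) = Suc j}"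
  have fin: "finite (?C y)" for y by (rule finite_subset[of _ "{..nat \<lfloor>y\<rfloor>}"]) (auto simp: le_nat_floor)
  have lt: "real (smooth j) < real (smooth (Suc j))"
    using smooth_strict_mono by (simp add: strict_mono_def)
  have "r \<in> ?A \<longleftrightarrow> r \<in> ?C (real N / smooth j) - ?C (real N / smooth (Suc j))" for r
  proof (cases "r \<in> layer_roots p")
    case True
    then have r: "r \<ge> 1" "\<forall>q\<in>range p. \<not> q dvd r" by (auto simp: layer_roots_def)
    have "r \<in> ?A \<longleftrightarrow> r \<le> N \<and> real (smooth j) \<le> real N / r \<and> real N / r < real (smooth (Suc j))"
      using True r by (simp add: layer_box_eq card_pm_le_eq_Suc_iff)
    also have "\<dots> \<longleftrightarrow> r \<le> N \<and> real r \<le> real N / smooth j \<and> \<not> real r \<le> real N / smooth (Suc j)"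
      using r by (simp add: le_divide_eq divide_less_eq mult.commute not_le)
    \<comment> \<open>\<open>r \<le> N\<close> follows from \<open>r \<le> N / smooth j\<close>, as
      \<open>smooth j\<close> is at least 1.\<close>
    also have "\<dots> \<longleftrightarrow> real r \<le> real N / smooth j \<and> \<not> real r \<le> real N / smooth (Suc j)"
    proof -
      have "r \<le> N" if "real r \<le> real N / smooth j"
      proof -
        have "real N / smooth j \<le> real N" using smooth_pos[of j] by (simp add: divide_le_eq mult_le_cancel_left1 Suc_le_eq del: smooth_pos)
        then show ?thesis using that by linarith
      qed
      then show ?thesis by blast
    qed
    finally show ?thesis using r by auto
  qed (auto simp: layer_roots_def)
  then have "?A = ?C (real N / smooth j) - ?C (real N / smooth (Suc j))" by blast
  moreover have "?C (real N / smooth (Suc j)) \<subseteq> ?C (real N / smooth j)"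
  proof -
    have "real N / smooth (Suc j) \<le> real N / smooth j" using lt by (intro divide_left_mono) auto
    then show ?thesis by force
  qed
  ultimately show ?thesis
    unfolding c_def using fin by (simp add: card_Diff_subset card_mono of_nat_diff del: of_nat_le_iff)
qed

lemma layer_density:
  "(\<lambda>N. real (card {r \<in> layer_roots p. r \<le> N \<and> card (layer_box p r N) = Suc j}) / real N)
    \<longlonglongrightarrow> kappa p * (exp (- rho_minus p (Suc j)) - exp (- rho_plus p (Suc j)))"
proof -
  define c where "c y = real (card {r. 1 \<le> r \<and> real r \<le> y \<and> (\<forall>q\<in>range p. \<not> q dvd r)})" for y
  have kappa: "kappa p = (\<Prod>q\<in>range p. 1 - 1 / real q)"
    unfolding kappa_def by (subst prod.reindex[OF inj_p]) simp
  have dens: "((\<lambda>y. c y / y) \<longlongrightarrow> kappa p) at_top"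
    unfolding kappa c_def by (rule density_prime_free) (auto simp: prime_p)
  have *: "(\<lambda>N. c (real N / s) / real N) \<longlonglongrightarrow> 1 / real s * kappa p" if "s > 0" for s :: nat
  proof -
    have "filterlim (\<lambda>N. inverse (real s) * real N) at_top sequentially"
      using that by (intro filterlim_tendsto_pos_mult_at_top[OF tendsto_const _ filterlim_real_sequentially]) auto
    then have "filterlim (\<lambda>N. real N / real s) at_top sequentially" by (simp add: divide_inverse mult.commute)
    from tendsto_mult[OF tendsto_const filterlim_compose[OF dens this], of "1 / real s"]
    show ?thesis using that by simp
  qed
  have "(\<lambda>N. c (real N / smooth j) / real N - c (real N / smooth (Suc j)) / real N)
      \<longlonglongrightarrow> 1 / real (smooth j) * kappa p - 1 / real (smooth (Suc j)) * kappa p"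
    by (intro tendsto_diff * smooth_pos)
  then show ?thesis
    unfolding layer_count exp_rho by (simp add: c_def diff_divide_distrib algebra_simps)
qed

text \<open>Forgetting the divisibility condition leaves an interval of integers. Divided by
  \<open>N\<close>, the bound no longer depends on \<open>N\<close>, as a majorant for Tannery's
  theorem must not.\<close>

lemma layer_count_le:
  "real (card {r \<in> layer_roots p. r \<le> N \<and> card (layer_box p r N) = Suc j}) \<le> real N / smooth j"
proof -
  let ?A = "{r \<in> layer_roots p. r \<le> N \<and> card (layer_box p r N) = Suc j}"
  have "?A \<subseteq> {1..nat \<lfloor>real N / smooth j\<rfloor>}"
  proof
    fix r assume r: "r \<in> ?A"
    then have "0 < r" "real (smooth j) \<le> real N / r"
      using roots_pos by (auto simp: layer_box_eq card_pm_le_eq_Suc_iff)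
    then show "r \<in> {1..nat \<lfloor>real N / smooth j\<rfloor>}"
      by (simp add: le_nat_floor le_divide_eq mult.commute)
  qed
  then have "card ?A \<le> nat \<lfloor>real N / smooth j\<rfloor>" using card_mono[of "{1..nat \<lfloor>real N / smooth j\<rfloor>}"] by fastforce
  then have "real (card ?A) \<le> real (nat \<lfloor>real N / smooth j\<rfloor>)" by (rule of_nat_mono)
  also have "\<dots> \<le> real N / smooth j" by simp
  finally show ?thesis .
qed

lemma layer_box_card:
  assumes "r \<in> layer_roots p" "r \<le> N"
  shows "finite (layer_box p r N)" "0 < card (layer_box p r N)" "card (layer_box p r N) \<le> N"
proof -
  have r: "0 < r" using assms roots_pos by blast
  show fin: "finite (layer_box p r N)" unfolding layer_box_eq[OF r] by (rule finite_pm_le)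
  moreover have "0 \<in> layer_box p r N" using assms by (simp add: layer_box_def)
  ultimately show "0 < card (layer_box p r N)" by (auto simp: card_gt_0_iff)
  have "card (layer_box p r N) \<le> card {1..N}"
  proof (rule card_inj_on_le[OF inj_on_subset[OF inj_pm]])
    show "pm ` layer_box p r N \<subseteq> {1..N}"
    proof clarsimp
      fix x assume "x \<in> layer_box p r N"
      then have "r * pm x \<le> N" by (simp add: layer_box_def)
      then show "pm x \<le> N" using r by (metis le_trans mult_le_mono1 One_nat_def Suc_leI nat_mult_1)
    qed
  qed auto
  then show "card (layer_box p r N) \<le> N" by simp
qed

lemma weight_bounds:
  defines "w \<equiv> \<lambda>j. exp (- rho_minus p (Suc j)) - exp (- rho_plus p (Suc j))"
  shows "0 \<le> w j" "w j \<le> 1 / real (smooth j)"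
proof -
  have "real (smooth j) < real (smooth (Suc j))"
    using smooth_strict_mono by (simp add: strict_mono_def)
  then show "0 \<le> w j" "w j \<le> 1 / real (smooth j)"
    by (auto simp: w_def exp_rho intro!: divide_left_mono)
qed

text \<open>Stated for any sequence of linear growth: grouping the layers by box size turns the
  average into a series in \<open>j\<close> whose terms converge by \<open>layer_density\<close> and
  are dominated by \<open>C * (j + 1) / smooth j\<close>.\<close>

lemma layer_average_limit:
  fixes \<Phi> :: "nat \<Rightarrow> real"
  defines "w \<equiv> \<lambda>j. exp (- rho_minus p (Suc j)) - exp (- rho_plus p (Suc j))"
  assumes bound: "\<And>l. \<bar>\<Phi> (Suc l)\<bar> \<le> C * real (Suc l)"
  shows "summable (\<lambda>j. w j * \<Phi> (Suc j))"
    and "(\<lambda>N. 1 / real N * (\<Sum>r | r \<in> layer_roots p \<and> r \<le> N. \<Phi> (card (layer_box p r N))))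
      \<longlonglongrightarrow> kappa p * (\<Sum>j. w j * \<Phi> (Suc j))"
proof -
  have summ: "summable (\<lambda>j. C * (real (Suc j) / real (smooth j)))"
    by (intro summable_mult summable_smooth)
  show "summable (\<lambda>j. w j * \<Phi> (Suc j))"
  proof (rule summable_comparison_test[OF _ summ], intro exI allI impI)
    fix j
    have "norm (w j * \<Phi> (Suc j)) \<le> 1 / real (smooth j) * (C * real (Suc j))"
      unfolding real_norm_def abs_mult w_def using weight_bounds[of j] bound[of j] by (intro mult_mono) auto
    then show "norm (w j * \<Phi> (Suc j)) \<le> C * (real (Suc j) / real (smooth j))" by simp
  qed
  define n where "n N j = real (card {r \<in> layer_roots p. r \<le> N \<and> card (layer_box p r N) = Suc j})" for N j
  have eq: "(\<Sum>r | r \<in> layer_roots p \<and> r \<le> N. \<Phi> (card (layer_box p r N))) / real N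
      = (\<Sum>j. n N j / real N * \<Phi> (Suc j))" for N
  proof -
    let ?R = "{r. r \<in> layer_roots p \<and> r \<le> N}"
    \<comment> \<open>Every box in question contains 0, so the subtraction never truncates.\<close>
    let ?g = "\<lambda>r. card (layer_box p r N) - 1"
    have "finite ?R" by (rule finite_subset[of _ "{..N}"]) auto
    have pos: "0 < card (layer_box p r N)" "card (layer_box p r N) \<le> N" if "r \<in> ?R" for r
      using that layer_box_card by auto
    have "(\<Sum>r\<in>?R. \<Phi> (card (layer_box p r N))) = (\<Sum>j<N. \<Sum>r | r \<in> ?R \<and> ?g r = j. \<Phi> (card (layer_box p r N)))"
    proof (rule sum.group[symmetric, OF \<open>finite ?R\<close>])
      show "?g ` ?R \<subseteq> {..<N}" using pos by fastforce
    qed simp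
    also have "\<dots> = (\<Sum>j<N. n N j * \<Phi> (Suc j))"
    proof (intro sum.cong refl)
      fix j
      have "{r. r \<in> ?R \<and> ?g r = j} = {r \<in> layer_roots p. r \<le> N \<and> card (layer_box p r N) = Suc j}"
        using pos by fastforce
      then show "(\<Sum>r | r \<in> ?R \<and> ?g r = j. \<Phi> (card (layer_box p r N))) = n N j * \<Phi> (Suc j)"
        by (simp add: n_def)
    qed
    finally have "(\<Sum>r\<in>?R. \<Phi> (card (layer_box p r N))) / real N = (\<Sum>j<N. n N j / real N * \<Phi> (Suc j))"
      by (simp add: sum_divide_distrib)
    \<comment> \<open>A box has at most \<open>N\<close> sites, so the finite sum may be written as
      a series, the form that allows \<open>N\<close> to tend to infinity term by term.\<close>
    moreover have "n N j = 0" if "j \<notin> {..<N}" for j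
    proof -
      have "{r \<in> layer_roots p. r \<le> N \<and> card (layer_box p r N) = Suc j} = {}"
        using that pos by fastforce
      then show ?thesis unfolding n_def by (simp only: card.empty of_nat_0)
    qed
    ultimately show ?thesis by (subst suminf_finite[of "{..<N}"]) auto
  qed
  have "(\<lambda>N. \<Sum>j. n N j / real N * \<Phi> (Suc j)) \<longlonglongrightarrow> (\<Sum>j. kappa p * w j * \<Phi> (Suc j))"
  proof (rule tannerys_theorem[THEN conjunct2, THEN conjunct2])
    show "(\<lambda>N. n N j / real N * \<Phi> (Suc j)) \<longlonglongrightarrow> kappa p * w j * \<Phi> (Suc j)" for j
      unfolding n_def w_def by (intro tendsto_mult layer_density tendsto_const)
    have "norm (n N j / real N * \<Phi> (Suc j)) \<le> C * (real (Suc j) / real (smooth j))" for N j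
    proof -
      have "n N j / real N \<le> 1 / real (smooth j)"
        using layer_count_le[of N j] by (cases "N = 0") (auto simp: n_def divide_le_eq)
      then have "norm (n N j / real N * \<Phi> (Suc j)) \<le> 1 / real (smooth j) * (C * real (Suc j))"
        unfolding real_norm_def abs_mult using bound[of j] by (intro mult_mono) (auto simp: n_def)
      then show ?thesis by simp
    qed
    then show "\<forall>\<^sub>F (j, N) in sequentially \<times>\<^sub>F sequentially.
        norm (n N j / real N * \<Phi> (Suc j)) \<le> C * (real (Suc j) / real (smooth j))"
      by (intro always_eventually) auto
  qed (rule summ, simp)
  also have "(\<Sum>j. kappa p * w j * \<Phi> (Suc j)) = kappa p * (\<Sum>j. w j * \<Phi> (Suc j))"
    using suminf_mult[OF \<open>summable (\<lambda>j. w j * \<Phi> (Suc j))\<close>, of "kappa p"] by (simp add: mult.assoc)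
  finally show "(\<lambda>N. 1 / real N * (\<Sum>r | r \<in> layer_roots p \<and> r \<le> N. \<Phi> (card (layer_box p r N))))
      \<longlonglongrightarrow> kappa p * (\<Sum>j. w j * \<Phi> (Suc j))"
    by (simp add: eq)
qed

end

section \<open>Gibbs kernels on a layer\<close>

lemma space_config_space [simp]: "space (config_space S) = configs S"
  by (simp add: config_space_def configs_def space_PiM)

lemma config_coord_measurable: "i \<in> S \<Longrightarrow> (\<lambda>\<sigma>. \<sigma> i) \<in> measurable (config_space S) (count_space {-1, 1})"
  unfolding config_space_def by (rule measurable_component_singleton)

lemma config_coord_borel: "i \<in> S \<Longrightarrow> (\<lambda>\<sigma>. \<sigma> i) \<in> borel_measurable (config_space S)"
  by (rule measurable_compose[OF config_coord_measurable, where g = "\<lambda>x. x"]) auto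

lemma measurable_into_config_space:
  assumes "\<And>i. i \<in> I \<Longrightarrow> (\<lambda>\<omega>. f \<omega> i) \<in> measurable N (count_space {-1, 1})"
    and "f \<in> space N \<rightarrow> configs I"
  shows "f \<in> measurable N (config_space I)"
  using measurable_PiM_single'[of I "\<lambda>i \<omega>. f \<omega> i" N "\<lambda>_. count_space {-1, 1}"] assms
  by (simp add: config_space_def configs_def)

lemma config_restrict_measurable:
  "J \<subseteq> S \<Longrightarrow> (\<lambda>\<sigma>. restrict \<sigma> J) \<in> measurable (config_space S) (config_space J)"
  unfolding config_space_def by (rule measurable_restrict_subset)

lemma configs_restrict: "\<sigma> \<in> configs S \<Longrightarrow> J \<subseteq> S \<Longrightarrow> restrict \<sigma> J \<in> configs J"
  by (auto simp: configs_def)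

lemma space_outside_algebra [simp]: "space (outside_algebra S \<Lambda>) = configs S"
  by (simp add: outside_algebra_def)

lemma outside_restrict_measurable:
  assumes "J \<subseteq> S - \<Lambda>"
  shows "(\<lambda>\<sigma>. restrict \<sigma> J) \<in> measurable (outside_algebra S \<Lambda>) (config_space J)"
proof -
  have "(\<lambda>\<sigma>. restrict \<sigma> (S - \<Lambda>)) \<in> measurable (outside_algebra S \<Lambda>) (config_space (S - \<Lambda>))"
    unfolding outside_algebra_def by (rule measurable_vimage_algebra1) (auto intro: configs_restrict)
  from measurable_compose[OF this config_restrict_measurable[OF assms]] show ?thesis
    using assms by (simp add: Int_absorb1)
qed

lemma outside_coord_measurable:
  assumes "i \<in> S - \<Lambda>"
  shows "(\<lambda>\<sigma>. \<sigma> i) \<in> measurable (outside_algebra S \<Lambda>) (count_space {-1, 1})"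
  using measurable_compose[OF outside_restrict_measurable[of "{i}" S \<Lambda>] config_coord_measurable[of i "{i}"]] assms
  by simp

lemma subalgebra_outside:
  assumes "sets \<mu> = sets (config_space S)"
  shows "subalgebra \<mu> (outside_algebra S \<Lambda>)"
  unfolding subalgebra_def
proof
  have sp: "space \<mu> = configs S" using sets_eq_imp_space_eq[OF assms] by simp
  then show "space (outside_algebra S \<Lambda>) = space \<mu>" by simp
  show "sets (outside_algebra S \<Lambda>) \<subseteq> sets \<mu>"
    unfolding outside_algebra_def assms
    by (rule sets_image_in_sets) (auto intro: config_restrict_measurable)
qed

lemma override_on_configs:
  "\<sigma> \<in> configs S \<Longrightarrow> \<xi> \<in> configs \<Lambda> \<Longrightarrow> \<Lambda> \<subseteq> S \<Longrightarrow> override_on \<sigma> \<xi> \<Lambda> \<in> configs S"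
  by (auto simp: configs_def override_on_def PiE_iff extensional_def)

text \<open>The coordinates in \<open>\<Lambda>\<close> are constants after overriding, so only
  coordinates outside \<open>\<Lambda>\<close> are read.\<close>

lemma override_measurable:
  assumes "\<xi> \<in> configs \<Lambda>" "\<Lambda> \<subseteq> S"
  shows "(\<lambda>\<eta>. override_on \<eta> \<xi> \<Lambda>) \<in> measurable (outside_algebra S \<Lambda>) (config_space S)"
proof (rule measurable_into_config_space)
  fix i assume i: "i \<in> S"
  show "(\<lambda>\<eta>. override_on \<eta> \<xi> \<Lambda> i) \<in> measurable (outside_algebra S \<Lambda>) (count_space {-1, 1})"
  proof (cases "i \<in> \<Lambda>")
    case True
    then have "\<xi> i \<in> {-1, 1}" using assms by (auto simp: configs_def)
    then show ?thesis using True by (simp add: override_on_def)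
  next
    case False
    then show ?thesis using outside_coord_measurable[of i S \<Lambda>] i by (simp add: override_on_def)
  qed
qed (use assms override_on_configs in auto)

lemma finite_configs: "finite \<Lambda> \<Longrightarrow> finite (configs \<Lambda>)"
  by (simp add: configs_def finite_PiE)

lemma gibbs_kernel_bounds:
  assumes "finite \<Lambda>" "\<xi> \<in> configs \<Lambda>"
  shows "0 \<le> gibbs_kernel S W \<Lambda> \<eta> \<xi>" "gibbs_kernel S W \<Lambda> \<eta> \<xi> \<le> 1"
proof -
  let ?e = "\<lambda>\<zeta>. exp (- hamiltonian S W \<Lambda> (override_on \<eta> \<zeta> \<Lambda>))"
  have "?e \<xi> \<le> sum ?e (configs \<Lambda>)"
    using assms by (intro member_le_sum finite_configs) auto
  moreover have "0 < ?e \<xi>" by simp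
  ultimately have "0 < sum ?e (configs \<Lambda>)" by linarith
  then show "0 \<le> gibbs_kernel S W \<Lambda> \<eta> \<xi>" "gibbs_kernel S W \<Lambda> \<eta> \<xi> \<le> 1"
    unfolding gibbs_kernel_def using \<open>?e \<xi> \<le> sum ?e (configs \<Lambda>)\<close> by auto
qed

text \<open>An unordered sum is an integral for the counting measure, and integrals depending on a
  parameter are measurable. Where the family is not summable both sides take the default value 0, so
  the identity holds at every point.\<close>

lemma borel_measurable_infsum:
  fixes f :: "'a \<Rightarrow> 'b \<Rightarrow> real"
  assumes "countable A" "\<And>a. a \<in> A \<Longrightarrow> f a \<in> borel_measurable M"
  shows "(\<lambda>x. \<Sum>\<^sub>\<infinity>a\<in>A. f a x) \<in> borel_measurable M"
proof -
  have "(\<Sum>\<^sub>\<infinity>a\<in>A. f a x) = integral\<^sup>L (count_space A) (\<lambda>a. f a x)" for x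
  proof (cases "Infinite_Set_Sum.abs_summable_on (\<lambda>a. f a x) A")
    case True
    show ?thesis using infsetsum_infsum[OF True] unfolding infsetsum_def by (rule sym)
  next
    case False
    have "\<not> (\<lambda>a. f a x) summable_on A"
      using False summable_on_iff_abs_summable_on_real[THEN iffD1, THEN abs_summable_equivalent[THEN iffD1]]
      by (rule contrapos_nn)
    then have "(\<Sum>\<^sub>\<infinity>a\<in>A. f a x) = 0" by (rule infsum_not_exists)
    also have "0 = integral\<^sup>L (count_space A) (\<lambda>a. f a x)"
      using not_summable_infsetsum_eq[OF False] unfolding infsetsum_def by (rule sym)
    finally show ?thesis .
  qed
  moreover have "(\<lambda>x. integral\<^sup>L (count_space A) (\<lambda>a. f a x)) \<in> borel_measurable M"
  proof (rule sigma_finite_measure.borel_measurable_lebesgue_integral)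
    show "sigma_finite_measure (count_space A)" using assms(1) by (rule sigma_finite_measure_count_space_countable)
    have "(\<lambda>y. f (fst y) (snd y)) \<in> borel_measurable (count_space A \<Otimes>\<^sub>M M)"
      using assms by (intro measurable_pair_measure_countable1) auto
    from measurable_compose[OF measurable_pair_swap' this]
    show "(\<lambda>(x, a). f a x) \<in> borel_measurable (M \<Otimes>\<^sub>M count_space A)"
      by (simp add: split_beta')
  qed
  ultimately show ?thesis by (simp only:)
qed

text \<open>A countable set of sites has only countably many finite subsets, so the Hamiltonian is a
  countable sum of measurable terms.\<close>

lemma gibbs_kernel_measurable:
  fixes W :: "('s::countable) set \<Rightarrow> ('s \<Rightarrow> real) \<Rightarrow> real"
  assumes W: "\<And>A. finite A \<Longrightarrow> A \<subseteq> S \<Longrightarrow> W A \<in> borel_measurable (config_space S)"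
    and "\<Lambda> \<subseteq> S" "\<xi> \<in> configs \<Lambda>"
  shows "(\<lambda>\<eta>. gibbs_kernel S W \<Lambda> \<eta> \<xi>) \<in> borel_measurable (outside_algebra S \<Lambda>)"
proof -
  have "countable {A. finite A \<and> A \<subseteq> S \<and> A \<inter> \<Lambda> \<noteq> {}}"
    by (rule countable_subset[OF _ countable_Collect_finite]) auto
  then have "(\<lambda>\<eta>. hamiltonian S W \<Lambda> (override_on \<eta> \<zeta> \<Lambda>)) \<in> borel_measurable (outside_algebra S \<Lambda>)"
    if "\<zeta> \<in> configs \<Lambda>" for \<zeta>
    unfolding hamiltonian_def using W measurable_compose[OF override_measurable[OF that \<open>\<Lambda> \<subseteq> S\<close>]]
    by (intro borel_measurable_infsum) auto
  then show ?thesis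
    unfolding gibbs_kernel_def using \<open>\<xi> \<in> configs \<Lambda>\<close>
    by (intro borel_measurable_divide borel_measurable_sum measurable_compose[OF _ borel_measurable_exp] borel_measurable_uminus)
qed

section \<open>The potential \<open>U\<close> seen from one layer\<close>

locale layered_potential = prime_family p for p :: "'d::finite \<Rightarrow> nat" +
  fixes \<A> :: "nat set set" and J :: "nat set \<Rightarrow> real"
    and U :: "nat set \<Rightarrow> (nat \<Rightarrow> real) \<Rightarrow> real"
    and V :: "(nat ^ 'd) set \<Rightarrow> (nat ^ 'd \<Rightarrow> real) \<Rightarrow> real"
  assumes form: "mult_form \<A> J U" and primes: "range p = primes_of \<A>"
    and assoc: "associated_potential p \<A> J V"
begin

definition site :: "nat \<Rightarrow> nat ^ 'd \<Rightarrow> nat" where "site r x = r * pm x"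

lemma layer_apply: "layer p r \<sigma> x = \<sigma> (site r x)"
  by (simp add: layer_def site_def)

lemma site_ge_1: "0 < r \<Longrightarrow> 1 \<le> site r x"
  by (simp add: site_def Suc_le_eq)

lemma inj_site: "r \<in> layer_roots p \<Longrightarrow> inj (site r)"
  unfolding site_def using site_unique by (intro injI) blast

lemma form_shape: "A \<in> \<A> \<Longrightarrow> finite A \<and> A \<subseteq> {1..}"
  using form[unfolded mult_form_def, THEN conjunct1] by (rule bspec)

lemma form_inj: "inj_on (\<lambda>(i, A). (*) i ` A) ({1..} \<times> \<A>)"
  using form[unfolded mult_form_def, THEN conjunct2, THEN conjunct1] .

lemma form_on:
  "1 \<le> i \<Longrightarrow> A \<in> \<A> \<Longrightarrow> \<sigma> \<in> configs {1..} \<Longrightarrow> U ((*) i ` A) \<sigma> = J A * (\<Prod>j\<in>A. mult_shift i \<sigma> j)"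
  using form[unfolded mult_form_def, THEN conjunct2, THEN conjunct2, THEN conjunct1] by metis

lemma form_off:
  assumes "finite B" "B \<subseteq> {1..}" "\<sigma> \<in> configs {1..}" "\<not> (\<exists>i\<ge>1. \<exists>A\<in>\<A>. B = (*) i ` A)"
  shows "U B \<sigma> = 0"
  using form[unfolded mult_form_def, THEN conjunct2, THEN conjunct2, THEN conjunct2, rule_format, OF assms(3), of B] assms
  by metis

lemma assoc_on:
  "A \<in> \<A> \<Longrightarrow> \<tau> \<in> configs UNIV \<Longrightarrow>
    V ((\<lambda>x. x + y) ` exponents p A) \<tau> = J A * (\<Prod>x\<in>exponents p A. \<tau> (x + y))"
  using assoc[unfolded associated_potential_def, THEN conjunct1] by metis

lemma assoc_off:
  assumes "finite B" "\<tau> \<in> configs UNIV" "\<not> (\<exists>A\<in>\<A>. \<exists>y. B = (\<lambda>x. x + y) ` exponents p A)"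
  shows "V B \<tau> = 0"
  using assoc[unfolded associated_potential_def, THEN conjunct2, rule_format, OF assms(2), of B] assms by metis

text \<open>A root other than 1 would have a prime factor outside \<open>range p\<close>, although
  all prime factors of elements of shapes belong to it. So passing to exponents loses no point of
  \<open>A\<close>.\<close>

lemma shape_eq: assumes "A \<in> \<A>" shows "A = pm ` exponents p A"
proof -
  have "a \<in> range pm" if a: "a \<in> A" for a
  proof -
    have "A \<subseteq> {1..}" using form_shape[OF assms] by simp
    then have "1 \<le> a" using a by (auto dest: subsetD)
    then have "0 < a" by simp
    then obtain r x where rx: "r \<in> layer_roots p" "a = r * pm x" using site_exists[OF \<open>0 < a\<close>] by metis
    have "r = 1"
    proof (rule ccontr)
      assume "r \<noteq> 1"
      then obtain q where q: "prime q" "q dvd r" using prime_factor_nat by blast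
      then have "q dvd a" using rx by simp
      then have "q \<in> prime_factors a" using q \<open>0 < a\<close> by (simp add: in_prime_factors_iff)
      then have "q \<in> primes_of \<A>" using assms a unfolding primes_of_def by (intro UN_I)
      then obtain k where "q = p k" unfolding primes[symmetric] by (rule rangeE)
      then show False using rx(1) q(2) by (simp add: layer_roots_def)
    qed
    then show ?thesis using rx by simp
  qed
  then have "A \<subseteq> range pm" by (rule subsetI)
  moreover have "exponents p A = pm -` A" by (auto simp: exponents_def)
  ultimately show ?thesis by (simp add: image_vimage_eq Int_absorb2)
qed

text \<open>The empty shape would coincide with its own multiple by 2, against the pairwise
  distinctness of the scaled shapes.\<close>

lemma shape_nonempty: assumes "A \<in> \<A>" shows "A \<noteq> {}"
proof
  assume "A = {}"
  note form_inj
  moreover have "(\<lambda>(i, A). (*) i ` A) (1, A) = (\<lambda>(i, A). (*) i ` A) (2 :: nat, A)" using \<open>A = {}\<close> by simp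
  ultimately have "(1 :: nat, A) = (2, A)" by (rule inj_onD) (use assms in simp_all)
  then show False by simp
qed

lemma layer_configs: "0 < r \<Longrightarrow> \<sigma> \<in> configs {1..} \<Longrightarrow> layer p r \<sigma> \<in> configs UNIV"
  using site_ge_1 by (force simp: configs_def layer_apply PiE_iff)

lemma scaled_shape: "(*) (site r y) ` A = site r ` (\<lambda>x. x + y) ` exponents p A" if "A \<in> \<A>"
  by (subst shape_eq[OF that]) (simp add: image_image pm_add mult_ac site_def)

text \<open>One common site is enough: it places the multiplier \<open>i\<close> itself in the
  layer, at some \<open>site r y\<close>, and multiplication by \<open>pm y\<close> is translation
  of exponents by \<open>y\<close>.\<close>

lemma shape_in_layer:
  assumes "r \<in> layer_roots p" "A \<in> \<A>" "1 \<le> i" "site r z \<in> (*) i ` A"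
  obtains y where "(*) i ` A = site r ` (\<lambda>x. x + y) ` exponents p A"
proof -
  obtain a where a: "site r z = i * a" "a \<in> A" using assms(4) by (rule imageE)
  have "a \<in> pm ` exponents p A" using a(2) shape_eq[OF assms(2)] by (rule subst[rotated])
  then obtain x where x: "a = pm x" by (rule imageE)
  have "0 < i" "i * pm x = r * pm z" using assms(3) a(1) x by (simp_all add: site_def)
  then obtain y where "i = r * pm y" by (rule site_in_layer[OF assms(1)])
  then have "i = site r y" by (simp only: site_def)
  then have "(*) i ` A = site r ` (\<lambda>x. x + y) ` exponents p A"
    using scaled_shape[OF assms(2)] by (simp only:)
  then show ?thesis by (rule that)
qed

text \<open>For a translated shape the two products agree after reindexing by \<open>pm\<close>.
  Otherwise both sides vanish: a scaled shape equal to the image of \<open>B\<close> would be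
  nonempty and inside the layer, which would make \<open>B\<close> a translated shape.\<close>

lemma potential_layer:
  assumes r: "r \<in> layer_roots p" and "finite B" and \<sigma>: "\<sigma> \<in> configs {1..}"
  shows "U (site r ` B) \<sigma> = V B (layer p r \<sigma>)"
proof (cases "\<exists>A\<in>\<A>. \<exists>y. B = (\<lambda>x. x + y) ` exponents p A")
  case True
  then obtain A y where A: "A \<in> \<A>" and B: "B = (\<lambda>x. x + y) ` exponents p A" by blast
  have "U (site r ` B) \<sigma> = U ((*) (site r y) ` A) \<sigma>" unfolding B scaled_shape[OF A] ..
  also have "\<dots> = J A * (\<Prod>j\<in>A. mult_shift (site r y) \<sigma> j)"
    by (rule form_on[OF site_ge_1[OF roots_pos[OF r]] A \<sigma>])
  also have "(\<Prod>j\<in>A. mult_shift (site r y) \<sigma> j) = (\<Prod>x\<in>exponents p A. layer p r \<sigma> (x + y))"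
  proof -
    have "inj_on pm (exponents p A)" using inj_pm by (rule inj_on_subset) simp
    then have "(\<Prod>j\<in>pm ` exponents p A. mult_shift (site r y) \<sigma> j) = (\<Prod>x\<in>exponents p A. mult_shift (site r y) \<sigma> (pm x))"
      by (rule prod.reindex_cong) simp_all
    also have "\<dots> = (\<Prod>x\<in>exponents p A. layer p r \<sigma> (x + y))"
      by (simp add: mult_shift_def layer_apply site_def pm_add mult_ac)
    finally show ?thesis by (simp only: shape_eq[OF A, symmetric])
  qed
  also have "J A * \<dots> = V B (layer p r \<sigma>)"
    unfolding B by (rule assoc_on[OF A layer_configs[OF roots_pos[OF r] \<sigma>], symmetric])
  finally show ?thesis .
next
  case False
  have "\<not> (\<exists>i\<ge>1. \<exists>A\<in>\<A>. site r ` B = (*) i ` A)"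
  proof clarify
    fix i A assume i: "1 \<le> i" and A: "A \<in> \<A>" and eq: "site r ` B = (*) i ` A"
    have "B \<noteq> {}" using eq shape_nonempty[OF A] by (metis image_is_empty)
    then obtain z where "z \<in> B" by (auto simp only: ex_in_conv[symmetric])
    then have "site r z \<in> (*) i ` A" unfolding eq[symmetric] by (rule imageI)
    then obtain y where "(*) i ` A = site r ` (\<lambda>x. x + y) ` exponents p A"
      by (rule shape_in_layer[OF r A i])
    then have "B = (\<lambda>x. x + y) ` exponents p A"
      unfolding eq[symmetric] by (simp only: inj_image_eq_iff[OF inj_site[OF r]])
    then show False using False A by auto
  qed
  moreover have "site r ` B \<subseteq> {1..}" using site_ge_1[OF roots_pos[OF r]] by auto
  ultimately have "U (site r ` B) \<sigma> = 0"
    using form_off[OF _ _ \<sigma>] \<open>finite B\<close> by simp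
  moreover have "V B (layer p r \<sigma>) = 0"
    by (rule assoc_off[OF \<open>finite B\<close> layer_configs[OF roots_pos[OF r] \<sigma>] False])
  ultimately show ?thesis by simp
qed

text \<open>Sets that meet the layer without lying in it are not scaled shapes and carry no energy;
  the rest are images of finite sets of exponents. Dropping zero terms and reindexing are valid for
  \<open>infsum\<close> without a summability check.\<close>

lemma hamiltonian_layer:
  assumes r: "r \<in> layer_roots p" and \<sigma>: "\<sigma> \<in> configs {1..}"
  shows "hamiltonian {1..} U (site r ` \<Lambda>) \<sigma> = hamiltonian UNIV V \<Lambda> (layer p r \<sigma>)"
proof -
  let ?S = "{B. finite B \<and> B \<subseteq> UNIV \<and> B \<inter> \<Lambda> \<noteq> {}}"
  let ?T = "{B. finite B \<and> B \<subseteq> {1..} \<and> B \<inter> site r ` \<Lambda> \<noteq> {}}"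
  have inj: "inj_on ((`) (site r)) ?S"
    using inj_image_eq_iff[OF inj_site[OF r]] by (auto intro!: inj_onI)
  have "(\<Sum>\<^sub>\<infinity>B\<in>?T. U B \<sigma>) = (\<Sum>\<^sub>\<infinity>B\<in>(`) (site r) ` ?S. U B \<sigma>)"
  proof (rule infsum_cong_neutral)
    fix B assume "B \<in> (`) (site r) ` ?S - ?T"
    then show "U B \<sigma> = 0" using site_ge_1[OF roots_pos[OF r]] by blast
  next
    fix B assume B: "B \<in> ?T - (`) (site r) ` ?S"
    have "\<not> (\<exists>i\<ge>1. \<exists>A\<in>\<A>. B = (*) i ` A)"
    proof clarify
      fix i A assume i: "1 \<le> i" and A: "A \<in> \<A>" and eq: "B = (*) i ` A"
      obtain z where z: "site r z \<in> B" "z \<in> \<Lambda>" using B by blast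
      obtain y where "(*) i ` A = site r ` (\<lambda>x. x + y) ` exponents p A"
        using z(1) unfolding eq by (rule shape_in_layer[OF r A i])
      then have y: "B = site r ` (\<lambda>x. x + y) ` exponents p A" by (simp only: eq)
      have "(\<lambda>x. x + y) ` exponents p A \<in> ?S"
      proof -
        have "finite ((\<lambda>x. x + y) ` exponents p A)"
        proof (rule finite_imageD)
          show "finite (site r ` (\<lambda>x. x + y) ` exponents p A)" using B unfolding y by simp
          show "inj_on (site r) ((\<lambda>x. x + y) ` exponents p A)" using inj_site[OF r] by (rule inj_on_subset) simp
        qed
        moreover have "z \<in> (\<lambda>x. x + y) ` exponents p A"
          using z(1) unfolding y by (simp only: inj_image_mem_iff[OF inj_site[OF r]])
        ultimately show ?thesis using z by blast
      qed
      then show False using B y by blast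
    qed
    then show "U B \<sigma> = 0" using B by (intro form_off[OF _ _ \<sigma>]) auto
  qed simp
  also have "\<dots> = (\<Sum>\<^sub>\<infinity>B\<in>?S. V B (layer p r \<sigma>))"
    unfolding infsum_reindex[OF inj] by (intro infsum_cong) (simp add: potential_layer[OF r _ \<sigma>])
  finally show ?thesis by (simp add: hamiltonian_def)
qed

text \<open>Transports a configuration on exponents to the sites of the layer. It is restricted to
  the image of \<open>\<Lambda>\<close> so that the result is extensional there, as
  \<open>configs\<close> demands.\<close>

definition push :: "nat \<Rightarrow> (nat ^ 'd) set \<Rightarrow> (nat ^ 'd \<Rightarrow> real) \<Rightarrow> nat \<Rightarrow> real" where
  "push r \<Lambda> \<zeta> = (\<lambda>n\<in>site r ` \<Lambda>. \<zeta> (the_inv (site r) n))"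

lemma push_site: "r \<in> layer_roots p \<Longrightarrow> x \<in> \<Lambda> \<Longrightarrow> push r \<Lambda> \<zeta> (site r x) = \<zeta> x"
  using the_inv_f_f[OF inj_site] by (simp add: push_def)

lemma push_bij:
  assumes r: "r \<in> layer_roots p"
  shows "bij_betw (push r \<Lambda>) (configs \<Lambda>) (configs (site r ` \<Lambda>))"
proof (rule bij_betw_byWitness[where f' = "\<lambda>\<xi>. \<lambda>x\<in>\<Lambda>. \<xi> (site r x)"])
  note inv = the_inv_f_f[OF inj_site[OF r]]
  show "\<forall>\<zeta>\<in>configs \<Lambda>. (\<lambda>x\<in>\<Lambda>. push r \<Lambda> \<zeta> (site r x)) = \<zeta>"
  proof
    fix \<zeta> assume "\<zeta> \<in> configs \<Lambda>"
    then have "\<zeta> \<in> extensional \<Lambda>" by (simp add: configs_def PiE_iff)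
    then show "(\<lambda>x\<in>\<Lambda>. push r \<Lambda> \<zeta> (site r x)) = \<zeta>"
      by (intro extensionalityI[of _ \<Lambda>]) (simp_all add: push_site[OF r])
  qed
  show "\<forall>\<xi>\<in>configs (site r ` \<Lambda>). push r \<Lambda> (\<lambda>x\<in>\<Lambda>. \<xi> (site r x)) = \<xi>"
  proof
    fix \<xi> assume "\<xi> \<in> configs (site r ` \<Lambda>)"
    then have "\<xi> \<in> extensional (site r ` \<Lambda>)" by (simp add: configs_def PiE_iff)
    then show "push r \<Lambda> (\<lambda>x\<in>\<Lambda>. \<xi> (site r x)) = \<xi>"
      by (intro extensionalityI[of _ "site r ` \<Lambda>"]) (auto simp only: push_def restrict_extensional inv restrict_apply')
  qed
  show "push r \<Lambda> ` configs \<Lambda> \<subseteq> configs (site r ` \<Lambda>)"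
  proof clarify
    fix \<zeta> assume "\<zeta> \<in> configs \<Lambda>"
    then show "push r \<Lambda> \<zeta> \<in> configs (site r ` \<Lambda>)"
      unfolding configs_def push_def by (intro restrict_PiE_iff[THEN iffD2] ballI) (auto simp only: inv PiE_iff imageE)
  qed
  show "(\<lambda>\<xi>. \<lambda>x\<in>\<Lambda>. \<xi> (site r x)) ` configs (site r ` \<Lambda>) \<subseteq> configs \<Lambda>"
    unfolding configs_def by (intro image_subsetI restrict_PiE_iff[THEN iffD2] ballI) (force simp only: PiE_iff)
qed

lemma layer_override:
  assumes "r \<in> layer_roots p"
  shows "layer p r (override_on \<sigma> (push r \<Lambda> \<zeta>) (site r ` \<Lambda>)) = override_on (layer p r \<sigma>) \<zeta> \<Lambda>"
  using inj_image_mem_iff[OF inj_site[OF assms]] push_site[OF assms]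
  by (auto simp: layer_apply override_on_def fun_eq_iff)

text \<open>The Hamiltonians agree term by term, and \<open>push_bij\<close> matches the normalizing
  sums. The right side reads \<open>\<sigma>\<close> only through its layer, so the other layers can
  be conditioned upon without changing the kernel.\<close>

lemma gibbs_kernel_layer:
  assumes r: "r \<in> layer_roots p" and \<sigma>: "\<sigma> \<in> configs {1..}" and \<xi>: "\<xi> \<in> configs \<Lambda>"
  shows "gibbs_kernel {1..} U (site r ` \<Lambda>) \<sigma> (push r \<Lambda> \<xi>) = gibbs_kernel UNIV V \<Lambda> (layer p r \<sigma>) \<xi>"
proof -
  have H: "hamiltonian {1..} U (site r ` \<Lambda>) (override_on \<sigma> (push r \<Lambda> \<zeta>) (site r ` \<Lambda>))
      = hamiltonian UNIV V \<Lambda> (override_on (layer p r \<sigma>) \<zeta> \<Lambda>)" if "\<zeta> \<in> configs \<Lambda>" for \<zeta>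
  proof -
    have "push r \<Lambda> \<zeta> \<in> configs (site r ` \<Lambda>)" using push_bij[OF r] that by (rule bij_betwE[rule_format])
    then have "override_on \<sigma> (push r \<Lambda> \<zeta>) (site r ` \<Lambda>) \<in> configs {1..}"
      using site_ge_1[OF roots_pos[OF r]] by (intro override_on_configs[OF \<sigma>]) auto
    then show ?thesis by (simp only: hamiltonian_layer[OF r] layer_override[OF r])
  qed
  show ?thesis
    unfolding gibbs_kernel_def sum.reindex_bij_betw[OF push_bij[OF r], symmetric]
    using H \<xi> by (intro arg_cong2[where f = "(/)"] sum.cong) auto
qed

lemma V_measurable: "finite B \<Longrightarrow> V B \<in> borel_measurable (config_space UNIV)"
proof (cases "\<exists>A\<in>\<A>. \<exists>y. B = (\<lambda>x. x + y) ` exponents p A")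
  case True
  then obtain A y where A: "A \<in> \<A>" "B = (\<lambda>x. x + y) ` exponents p A" by blast
  have "V B \<tau> = J A * (\<Prod>x\<in>exponents p A. \<tau> (x + y))" if "\<tau> \<in> configs UNIV" for \<tau>
    unfolding A(2) using A(1) that by (rule assoc_on)
  note V = this
  have "(\<lambda>\<tau>. J A * (\<Prod>x\<in>exponents p A. \<tau> (x + y))) \<in> borel_measurable (config_space UNIV)"
    by (intro borel_measurable_times borel_measurable_prod borel_measurable_const config_coord_borel) simp
  then show ?thesis by (rule measurable_cong[THEN iffD2, rotated]) (simp add: V)
next
  case False
  assume "finite B"
  have "V B \<tau> = 0" if "\<tau> \<in> configs UNIV" for \<tau>
    by (rule assoc_off[OF \<open>finite B\<close> that False])
  note V = this
  show ?thesis by (rule measurable_cong[THEN iffD2, OF _ measurable_const[of 0]]) (simp_all add: V)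
qed

lemma layer_measurable:
  assumes "0 < r" shows "layer p r \<in> measurable (config_space {1..}) (config_space UNIV)"
  using layer_configs[OF assms] site_ge_1[OF assms]
  by (intro measurable_into_config_space) (auto simp: layer_apply intro!: config_coord_measurable)

end

section \<open>Independence of the layers\<close>

lemma (in prob_space) integral_uniform_measure:
  fixes g :: "'a \<Rightarrow> real"
  assumes A: "A \<in> events" "0 < prob A" and g: "g \<in> borel_measurable M"
  shows "(\<integral>x. g x \<partial>uniform_measure M A) = (\<integral>x. indicat_real A x * g x \<partial>M) / prob A"
proof -
  have "uniform_measure M A = density M (\<lambda>x. ennreal (indicat_real A x / prob A))"
    unfolding uniform_measure_def
  proof (intro arg_cong[where f = "density M"] ext)
    fix x
    show "indicator A x / emeasure M A = ennreal (indicat_real A x / prob A)"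
      using A by (cases "x \<in> A") (simp_all add: emeasure_eq_measure ennreal_1[symmetric] divide_ennreal del: ennreal_1)
  qed
  moreover have "(\<integral>x. g x \<partial>density M (\<lambda>x. ennreal (indicat_real A x / prob A)))
      = (\<integral>x. (indicat_real A x / prob A) *\<^sub>R g x \<partial>M)"
    using A g by (intro integral_density) auto
  ultimately show ?thesis by simp
qed

locale gibbs_layers = layered_potential p \<A> J U V
  for p :: "'d::finite \<Rightarrow> nat" and \<A> J U V +
  fixes \<mu>U :: "(nat \<Rightarrow> real) measure" and \<mu>V :: "(nat ^ 'd \<Rightarrow> real) measure"
  assumes gibbs_U: "gibbs_measure {1..} U \<mu>U" and gibbs_V: "gibbs_measure UNIV V \<mu>V"
    and gibbs_V_unique: "\<And>\<nu>. gibbs_measure UNIV V \<nu> \<Longrightarrow> \<nu> = \<mu>V"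
begin

sublocale U: prob_space \<mu>U using gibbs_U by (simp add: gibbs_measure_def)
sublocale V: prob_space \<mu>V using gibbs_V by (simp add: gibbs_measure_def)

lemma sets_U [measurable_cong]: "sets \<mu>U = sets (config_space {1..})"
  using gibbs_U by (simp add: gibbs_measure_def)

lemma sets_V [measurable_cong]: "sets \<mu>V = sets (config_space UNIV)"
  using gibbs_V by (simp add: gibbs_measure_def)

lemma space_U [simp]: "space \<mu>U = configs {1..}"
  using sets_eq_imp_space_eq[OF sets_U] by simp

lemma space_V [simp]: "space \<mu>V = configs UNIV"
  using sets_eq_imp_space_eq[OF sets_V] by simp

lemma layer_measurable_U: "0 < r \<Longrightarrow> layer p r \<in> measurable \<mu>U (config_space UNIV)"
  using layer_measurable by (simp add: measurable_cong_sets[OF sets_U refl])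

definition rest :: "nat \<Rightarrow> nat set" where "rest r = {1..} - range (site r)"

lemma rest_measurable_U: "(\<lambda>\<sigma>. restrict \<sigma> (rest r)) \<in> measurable \<mu>U (config_space (rest r))"
  unfolding measurable_cong_sets[OF sets_U refl] by (rule config_restrict_measurable) (auto simp: rest_def)

text \<open>Exponents off \<open>\<Lambda>\<close> go to sites off the image of
  \<open>\<Lambda>\<close>, because \<open>site r\<close> is injective.\<close>

lemma layer_outside_measurable:
  assumes r: "r \<in> layer_roots p"
  shows "layer p r \<in> measurable (outside_algebra {1..} (site r ` \<Lambda>)) (outside_algebra UNIV \<Lambda>)"
  unfolding outside_algebra_def[of UNIV \<Lambda>]
proof (rule measurable_vimage_algebra2)
  show "layer p r \<in> space (outside_algebra {1..} (site r ` \<Lambda>)) \<rightarrow> configs UNIV"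
    using layer_configs[OF roots_pos[OF r]] by simp
  show "(\<lambda>\<sigma>. restrict (layer p r \<sigma>) (UNIV - \<Lambda>)) \<in> measurable (outside_algebra {1..} (site r ` \<Lambda>)) (config_space (UNIV - \<Lambda>))"
  proof (rule measurable_into_config_space)
    fix x assume x: "x \<in> UNIV - \<Lambda>"
    then have "site r x \<in> {1..} - site r ` \<Lambda>"
      using inj_image_mem_iff[OF inj_site[OF r]] site_ge_1[OF roots_pos[OF r]] by simp
    from outside_coord_measurable[OF this] x
    show "(\<lambda>\<sigma>. restrict (layer p r \<sigma>) (UNIV - \<Lambda>) x) \<in> measurable (outside_algebra {1..} (site r ` \<Lambda>)) (count_space {-1, 1})"
      by (simp add: layer_apply)
  next
    show "(\<lambda>\<sigma>. restrict (layer p r \<sigma>) (UNIV - \<Lambda>)) \<in> space (outside_algebra {1..} (site r ` \<Lambda>)) \<rightarrow> configs (UNIV - \<Lambda>)"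
      using configs_restrict[OF layer_configs[OF roots_pos[OF r]]] by simp
  qed
qed

lemma restrict_layer_iff:
  assumes r: "r \<in> layer_roots p" and \<xi>: "\<xi> \<in> configs \<Lambda>"
  shows "restrict (layer p r \<sigma>) \<Lambda> = \<xi> \<longleftrightarrow> restrict \<sigma> (site r ` \<Lambda>) = push r \<Lambda> \<xi>"
proof -
  have "\<xi> \<in> extensional \<Lambda>" using \<xi> by (simp add: configs_def PiE_iff)
  then have "restrict (layer p r \<sigma>) \<Lambda> = \<xi> \<longleftrightarrow> (\<forall>x\<in>\<Lambda>. \<sigma> (site r x) = \<xi> x)"
    using extensionalityI[of "restrict (layer p r \<sigma>) \<Lambda>" \<Lambda> \<xi>] by (auto simp: layer_apply)
  also have "\<dots> \<longleftrightarrow> (\<forall>n\<in>site r ` \<Lambda>. \<sigma> n = push r \<Lambda> \<xi> n)"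
    by (simp add: push_site[OF r])
  also have "\<dots> \<longleftrightarrow> restrict \<sigma> (site r ` \<Lambda>) = push r \<Lambda> \<xi>"
  proof
    assume "\<forall>n\<in>site r ` \<Lambda>. \<sigma> n = push r \<Lambda> \<xi> n"
    then show "restrict \<sigma> (site r ` \<Lambda>) = push r \<Lambda> \<xi>"
      by (intro extensionalityI[of _ "site r ` \<Lambda>"]) (auto simp: push_def)
  next
    assume "restrict \<sigma> (site r ` \<Lambda>) = push r \<Lambda> \<xi>"
    then show "\<forall>n\<in>site r ` \<Lambda>. \<sigma> n = push r \<Lambda> \<xi> n" by (metis restrict_apply')
  qed
  finally show ?thesis .
qed

text \<open>The conditional expectation is tested on an event \<open>C\<close> outside
  \<open>\<Lambda>\<close>. Pulled back and intersected with \<open>B0\<close>, it is still an event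
  outside the image of \<open>\<Lambda>\<close>, so the Gibbs property of \<open>\<mu>U\<close>
  applies to it and replaces the indicator by the kernel, which is that of \<open>V\<close>. Both
  sides carry the same factor 1 / \<open>measure \<mu>U B0\<close>.\<close>

lemma conditional_layer_gibbs:
  assumes r: "r \<in> layer_roots p" and B: "B \<in> sets (config_space (rest r))"
  defines "B0 \<equiv> {\<sigma> \<in> configs {1..}. restrict \<sigma> (rest r) \<in> B}"
  assumes pos: "0 < measure \<mu>U B0"
  shows "gibbs_measure UNIV V (distr (uniform_measure \<mu>U B0) (config_space UNIV) (layer p r))"
    (is "gibbs_measure UNIV V ?\<nu>")
proof -
  have B0: "B0 \<in> sets \<mu>U"
    using measurable_sets[OF rest_measurable_U B] by (simp add: B0_def vimage_def Int_def conj_commute)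
  have layer: "layer p r \<in> measurable (uniform_measure \<mu>U B0) (config_space UNIV)"
    using layer_measurable_U[OF roots_pos[OF r]] by (simp add: measurable_cong_sets[OF sets_uniform_measure refl])
  have "emeasure \<mu>U B0 \<noteq> 0" using pos by (auto simp: measure_def)
  then have "prob_space (uniform_measure \<mu>U B0)"
    by (rule prob_space_uniform_measure) simp
  then have prob: "prob_space ?\<nu>" by (rule prob_space.prob_space_distr[OF _ layer])
  have sets: "sets ?\<nu> = sets (config_space UNIV)" by simp
  have space: "space ?\<nu> = configs UNIV" by simp
  have integral: "(\<integral>\<tau>. h \<tau> \<partial>?\<nu>) = (\<integral>\<sigma>. indicat_real B0 \<sigma> * h (layer p r \<sigma>) \<partial>\<mu>U) / measure \<mu>U B0"
    if h: "h \<in> borel_measurable (config_space UNIV)" for h :: "_ \<Rightarrow> real"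
  proof -
    have "(\<integral>\<tau>. h \<tau> \<partial>?\<nu>) = (\<integral>\<sigma>. h (layer p r \<sigma>) \<partial>uniform_measure \<mu>U B0)"
      by (rule integral_distr[OF layer h])
    also have "\<dots> = (\<integral>\<sigma>. indicat_real B0 \<sigma> * h (layer p r \<sigma>) \<partial>\<mu>U) / measure \<mu>U B0"
      by (rule U.integral_uniform_measure[OF B0 pos measurable_compose[OF layer_measurable_U[OF roots_pos[OF r]] h]])
    finally show ?thesis .
  qed
  have "AE \<eta> in ?\<nu>. real_cond_exp ?\<nu> (outside_algebra UNIV \<Lambda>)
            (indicat_real {\<tau> \<in> configs UNIV. restrict \<tau> \<Lambda> = \<xi>}) \<eta> = gibbs_kernel UNIV V \<Lambda> \<eta> \<xi>"
    if \<Lambda>: "finite \<Lambda>" and \<xi>: "\<xi> \<in> configs \<Lambda>" for \<Lambda> \<xi>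
  proof -
    interpret \<nu>: prob_space ?\<nu> by (rule prob)
    have sub: "subalgebra ?\<nu> (outside_algebra UNIV \<Lambda>)" by (rule subalgebra_outside[OF sets])
    interpret \<nu>F: finite_measure_subalgebra ?\<nu> "outside_algebra UNIV \<Lambda>"
      by unfold_locales (rule sub)
    let ?\<Lambda> = "site r ` \<Lambda>" and ?I = "{\<tau> \<in> configs UNIV. restrict \<tau> \<Lambda> = \<xi>}"
    let ?K = "\<lambda>\<tau>. gibbs_kernel UNIV V \<Lambda> \<tau> \<xi>"
    have subU: "subalgebra \<mu>U (outside_algebra {1..} ?\<Lambda>)" by (rule subalgebra_outside[OF sets_U])
    interpret UF: finite_measure_subalgebra \<mu>U "outside_algebra {1..} ?\<Lambda>"
      by unfold_locales (rule subU)
    let ?IU = "{\<sigma> \<in> configs {1..}. restrict \<sigma> ?\<Lambda> = push r \<Lambda> \<xi>}"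
    have \<Lambda>1: "?\<Lambda> \<subseteq> {1..}" using site_ge_1[OF roots_pos[OF r]] by auto
    have push: "push r \<Lambda> \<xi> \<in> configs ?\<Lambda>" using bij_betwE[OF push_bij[OF r]] \<xi> by blast
    have sing: "{\<zeta>} \<in> sets (config_space \<Delta>)" if "finite \<Delta>" "\<zeta> \<in> configs \<Delta>" for \<zeta> :: "'s \<Rightarrow> real" and \<Delta>
    proof -
      have "\<zeta> \<in> extensional \<Delta>" using that by (simp add: configs_def PiE_iff)
      then have "{\<zeta>} = (\<Pi>\<^sub>E i\<in>\<Delta>. {\<zeta> i})" by (rule PiE_singleton[symmetric])
      also have "\<dots> \<in> sets (config_space \<Delta>)"
        unfolding config_space_def using that by (intro sets_PiM_I_finite) (auto simp: configs_def)
      finally show ?thesis .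
    qed
    have I: "?I \<in> sets (config_space UNIV)"
      using measurable_sets[OF config_restrict_measurable[of \<Lambda> UNIV] sing[OF \<Lambda> \<xi>]]
      by (simp add: vimage_def Int_def conj_commute)
    have IU: "?IU \<in> sets \<mu>U"
      using measurable_sets[OF config_restrict_measurable[OF \<Lambda>1] sing[OF finite_imageI[OF \<Lambda>] push]]
      by (simp add: sets_U vimage_def Int_def conj_commute)
    have K_meas: "?K \<in> borel_measurable (outside_algebra UNIV \<Lambda>)"
      by (rule gibbs_kernel_measurable[OF V_measurable _ \<xi>]) simp_all
    then have K_meas': "?K \<in> borel_measurable (config_space UNIV)"
      using measurable_from_subalg[OF sub] by (simp add: measurable_cong_sets[OF sets refl])
    show ?thesis
    proof (rule \<nu>F.real_cond_exp_charact[OF _ _ _ K_meas])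
      show "integrable ?\<nu> (indicat_real ?I)"
        using I by (intro \<nu>.integrable_const_bound[where B = 1]) (auto simp: measurable_cong_sets[OF sets refl])
      show "integrable ?\<nu> ?K"
        using K_meas' gibbs_kernel_bounds[OF \<Lambda> \<xi>]
        by (intro \<nu>.integrable_const_bound[where B = 1]) (auto simp: measurable_cong_sets[OF sets refl])
      fix C assume C: "C \<in> sets (outside_algebra UNIV \<Lambda>)"
      then have C': "C \<in> sets (config_space UNIV)" using sub sets by (auto simp: subalgebra_def)
      \<comment> \<open>The conditioning event is absorbed into the test event; both of its parts
        avoid the sites that are being resampled.\<close>
      define E where "E = {\<sigma> \<in> configs {1..}. restrict \<sigma> (rest r) \<in> B \<and> layer p r \<sigma> \<in> C}"
      have E: "E \<in> sets (outside_algebra {1..} ?\<Lambda>)"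
      proof -
        have "(\<lambda>\<sigma>. restrict \<sigma> (rest r)) \<in> measurable (outside_algebra {1..} ?\<Lambda>) (config_space (rest r))"
          by (rule outside_restrict_measurable) (auto simp: rest_def)
        from sets.Int[OF measurable_sets[OF this B] measurable_sets[OF layer_outside_measurable[OF r] C]]
        show ?thesis unfolding E_def by (rule back_subst[where P = "\<lambda>X. X \<in> _"]) auto
      qed
      have ind: "indicat_real B0 \<sigma> * indicat_real C (layer p r \<sigma>) = indicat_real E \<sigma>" if "\<sigma> \<in> configs {1..}" for \<sigma>
        using that by (auto simp: B0_def E_def indicator_def)
      have "(\<integral>\<sigma>. indicat_real B0 \<sigma> * (indicat_real C (layer p r \<sigma>) * indicat_real ?I (layer p r \<sigma>)) \<partial>\<mu>U)
          = (\<integral>\<sigma>. indicat_real E \<sigma> * indicat_real ?IU \<sigma> \<partial>\<mu>U)"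
      proof (rule Bochner_Integration.integral_cong[OF refl])
        fix \<sigma> assume "\<sigma> \<in> space \<mu>U"
        then have \<sigma>: "\<sigma> \<in> configs {1..}" by simp
        then have "indicat_real ?I (layer p r \<sigma>) = indicat_real ?IU \<sigma>"
          using layer_configs[OF roots_pos[OF r] \<sigma>] restrict_layer_iff[OF r \<xi>, of \<sigma>] by (simp add: indicator_def)
        then show "indicat_real B0 \<sigma> * (indicat_real C (layer p r \<sigma>) * indicat_real ?I (layer p r \<sigma>))
            = indicat_real E \<sigma> * indicat_real ?IU \<sigma>"
          unfolding mult.assoc[symmetric] by (simp only: ind[OF \<sigma>])
      qed
      also have "\<dots> = (\<integral>\<sigma>. indicat_real E \<sigma> * real_cond_exp \<mu>U (outside_algebra {1..} ?\<Lambda>) (indicat_real ?IU) \<sigma> \<partial>\<mu>U)"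
      proof -
        have "integrable \<mu>U (indicat_real ?IU)" using IU by (intro U.integrable_const_bound[where B = 1]) auto
        from UF.real_cond_exp_intA[OF this E] show ?thesis by (simp add: set_lebesgue_integral_def)
      qed
      also have "\<dots> = (\<integral>\<sigma>. indicat_real E \<sigma> * gibbs_kernel {1..} U ?\<Lambda> \<sigma> (push r \<Lambda> \<xi>) \<partial>\<mu>U)"
      proof -
        have AE: "AE \<sigma> in \<mu>U. real_cond_exp \<mu>U (outside_algebra {1..} ?\<Lambda>) (indicat_real ?IU) \<sigma>
            = gibbs_kernel {1..} U ?\<Lambda> \<sigma> (push r \<Lambda> \<xi>)"
          using gibbs_U \<Lambda> \<Lambda>1 push unfolding gibbs_measure_def by blast
        have EU: "E \<in> sets \<mu>U" using E subU by (auto simp: subalgebra_def)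
        \<comment> \<open>Measurability is borrowed from the kernel of \<open>V\<close>, composed
          with the layer map.\<close>
        have KU: "(\<lambda>\<sigma>. gibbs_kernel {1..} U ?\<Lambda> \<sigma> (push r \<Lambda> \<xi>)) \<in> borel_measurable \<mu>U"
        proof (rule measurable_cong[THEN iffD2, rotated])
          show "(\<lambda>\<sigma>. ?K (layer p r \<sigma>)) \<in> borel_measurable \<mu>U"
            by (rule measurable_compose[OF layer_measurable_U[OF roots_pos[OF r]] K_meas'])
        qed (simp only: space_U gibbs_kernel_layer[OF r _ \<xi>])
        show ?thesis
        proof (rule integral_cong_AE)
          show "(\<lambda>\<sigma>. indicat_real E \<sigma> * real_cond_exp \<mu>U (outside_algebra {1..} ?\<Lambda>) (indicat_real ?IU) \<sigma>) \<in> borel_measurable \<mu>U"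
            using EU by (intro borel_measurable_times borel_measurable_indicator borel_measurable_cond_exp2)
          show "(\<lambda>\<sigma>. indicat_real E \<sigma> * gibbs_kernel {1..} U ?\<Lambda> \<sigma> (push r \<Lambda> \<xi>)) \<in> borel_measurable \<mu>U"
            using EU KU by (intro borel_measurable_times borel_measurable_indicator)
          show "AE \<sigma> in \<mu>U. indicat_real E \<sigma> * real_cond_exp \<mu>U (outside_algebra {1..} ?\<Lambda>) (indicat_real ?IU) \<sigma>
            = indicat_real E \<sigma> * gibbs_kernel {1..} U ?\<Lambda> \<sigma> (push r \<Lambda> \<xi>)"
            using AE by (rule AE_mp) simp
        qed
      qed
      also have "\<dots> = (\<integral>\<sigma>. indicat_real B0 \<sigma> * (indicat_real C (layer p r \<sigma>) * ?K (layer p r \<sigma>)) \<partial>\<mu>U)"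
      proof (rule Bochner_Integration.integral_cong[OF refl])
        fix \<sigma> assume "\<sigma> \<in> space \<mu>U"
        then have \<sigma>: "\<sigma> \<in> configs {1..}" by simp
        show "indicat_real E \<sigma> * gibbs_kernel {1..} U ?\<Lambda> \<sigma> (push r \<Lambda> \<xi>)
            = indicat_real B0 \<sigma> * (indicat_real C (layer p r \<sigma>) * ?K (layer p r \<sigma>))"
          unfolding gibbs_kernel_layer[OF r \<sigma> \<xi>] mult.assoc[symmetric] by (simp only: ind[OF \<sigma>])
      qed
      finally have eq: "(\<integral>\<sigma>. indicat_real B0 \<sigma> * (indicat_real C (layer p r \<sigma>) * indicat_real ?I (layer p r \<sigma>)) \<partial>\<mu>U)
        = (\<integral>\<sigma>. indicat_real B0 \<sigma> * (indicat_real C (layer p r \<sigma>) * ?K (layer p r \<sigma>)) \<partial>\<mu>U)" .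
      have m: "(\<lambda>\<tau>. indicat_real C \<tau> * indicat_real ?I \<tau>) \<in> borel_measurable (config_space UNIV)"
        "(\<lambda>\<tau>. indicat_real C \<tau> * ?K \<tau>) \<in> borel_measurable (config_space UNIV)"
        by (rule borel_measurable_times[OF borel_measurable_indicator[OF C'] borel_measurable_indicator[OF I]],
            rule borel_measurable_times[OF borel_measurable_indicator[OF C'] K_meas'])
      show "(\<integral>\<tau>\<in>C. indicat_real ?I \<tau> \<partial>?\<nu>) = (\<integral>\<tau>\<in>C. ?K \<tau> \<partial>?\<nu>)"
        unfolding set_lebesgue_integral_def real_scaleR_def using integral[OF m(1)] integral[OF m(2)] eq by (simp only:)
    qed
  qed
  then show ?thesis unfolding gibbs_measure_def using prob sets by auto
qed

text \<open>A null event for the other layers makes both sides 0; for any other event the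
  conditional law is a Gibbs measure for \<open>V\<close>, and there is only one.\<close>

lemma layer_independent:
  assumes r: "r \<in> layer_roots p" and A: "A \<in> sets (config_space UNIV)" and B: "B \<in> sets (config_space (rest r))"
  shows "measure \<mu>U {\<sigma> \<in> configs {1..}. layer p r \<sigma> \<in> A \<and> restrict \<sigma> (rest r) \<in> B}
    = measure \<mu>V A * measure \<mu>U {\<sigma> \<in> configs {1..}. restrict \<sigma> (rest r) \<in> B}"
proof -
  let ?B = "{\<sigma> \<in> configs {1..}. restrict \<sigma> (rest r) \<in> B}"
  let ?A = "{\<sigma> \<in> configs {1..}. layer p r \<sigma> \<in> A}"
  have B0: "?B \<in> sets \<mu>U"
    using measurable_sets[OF rest_measurable_U B] by (simp add: vimage_def Int_def conj_commute)
  have A0: "?A \<in> sets \<mu>U"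
    using measurable_sets[OF layer_measurable_U[OF roots_pos[OF r]] A] by (simp add: vimage_def Int_def conj_commute)
  have eq: "{\<sigma> \<in> configs {1..}. layer p r \<sigma> \<in> A \<and> restrict \<sigma> (rest r) \<in> B} = ?B \<inter> ?A" by auto
  show ?thesis
  proof (cases "measure \<mu>U ?B = 0")
    case True
    then have "measure \<mu>U (?B \<inter> ?A) = 0"
      using U.finite_measure_mono[of "?B \<inter> ?A" ?B] B0 by (intro antisym measure_nonneg) simp
    then show ?thesis using True eq by simp
  next
    case False
    then have pos: "0 < measure \<mu>U ?B" using measure_nonneg[of \<mu>U ?B] by linarith
    have layer: "layer p r \<in> measurable (uniform_measure \<mu>U ?B) (config_space UNIV)"
      using layer_measurable_U[OF roots_pos[OF r]] by (simp add: measurable_cong_sets[OF sets_uniform_measure refl])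
    have "measure \<mu>V A = measure (distr (uniform_measure \<mu>U ?B) (config_space UNIV) (layer p r)) A"
      using gibbs_V_unique[OF conditional_layer_gibbs[OF r B pos]] by simp
    also have "\<dots> = measure (uniform_measure \<mu>U ?B) ?A"
      by (subst measure_distr[OF layer A]) (simp add: vimage_def Int_def conj_commute)
    also have "\<dots> = measure \<mu>U (?B \<inter> ?A) / measure \<mu>U ?B"
      using pos A0 by (intro measure_uniform_measure) (auto simp: measure_def)
    finally show ?thesis using pos eq by simp
  qed
qed

end

section \<open>Cumulant functions of bounded variables\<close>

text \<open>Tychonoff's theorem; it provides the bound on \<open>fstar\<close>.\<close>

lemma compact_configs: "compact (configs (UNIV :: 's set))"
proof -
  have "compactin (product_topology (\<lambda>_. euclidean) UNIV) (UNIV \<rightarrow>\<^sub>E {-1, 1 :: real})"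
    by (subst compactin_PiE) simp
  then show ?thesis by (simp add: euclidean_product_topology configs_def)
qed

text \<open>Continuity refers to the topology of the function type, measurability to a product of
  discrete sigma-algebras. Over countably many sites the product sigma-algebra of real lines is the
  Borel one, which links the two.\<close>

lemma continuous_configs_measurable:
  fixes g :: "('s::countable \<Rightarrow> real) \<Rightarrow> real"
  assumes "continuous_on (configs UNIV) g"
  shows "g \<in> borel_measurable (config_space UNIV)"
proof -
  have "(\<lambda>\<tau>. \<tau>) \<in> measurable (config_space (UNIV :: 's set)) (Pi\<^sub>M UNIV (\<lambda>_. borel :: real measure))"
    by (intro measurable_PiM_single' config_coord_borel) auto
  then have "(\<lambda>\<tau>. \<tau>) \<in> measurable (config_space (UNIV :: 's set)) borel"
    by (simp only: measurable_cong_sets[OF refl sets_PiM_equal_borel])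
  then have "(\<lambda>\<tau>. \<tau>) \<in> measurable (config_space (UNIV :: 's set)) (restrict_space borel (configs UNIV))"
    by (rule measurable_restrict_space2[rotated]) simp
  from measurable_compose[OF this borel_measurable_continuous_on_restrict[OF assms]] show ?thesis .
qed

lemma exp_taylor_bounds:
  fixes u :: real
  assumes "\<bar>u\<bar> \<le> 1"
  shows "0 \<le> exp u - 1 - u" "exp u - 1 - u \<le> u\<^sup>2"
proof -
  show "0 \<le> exp u - 1 - u" using exp_ge_add_one_self[of u] by linarith
  show "exp u - 1 - u \<le> u\<^sup>2"
  proof (cases "0 \<le> u")
    case True
    then show ?thesis using exp_bound[of u] assms by simp
  next
    case False
    define v where "v = - u"
    have v: "v > 0" using False by (simp add: v_def)
    \<comment> \<open>The product is 1 + v ^ 3. Since 1 + v is at most \<open>exp v\<close>, this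
      bounds \<open>exp (- v)\<close> by 1 - v + v ^ 2.\<close>
    have "1 \<le> (1 + v) * (1 - v + v\<^sup>2)" using v by (simp add: algebra_simps power2_eq_square)
    also have "\<dots> \<le> exp v * (1 - v + v\<^sup>2)"
    proof (rule mult_right_mono)
      have "0 \<le> (1 - v)\<^sup>2 + v" using v by (simp add: add_nonneg_nonneg)
      then show "0 \<le> 1 - v + v\<^sup>2" by (simp add: power2_diff)
    qed (use exp_ge_add_one_self[of v] in simp)
    finally have "exp (- v) * 1 \<le> exp (- v) * (exp v * (1 - v + v\<^sup>2))" by (intro mult_left_mono) auto
    also have "\<dots> = 1 - v + v\<^sup>2" by (simp add: mult.assoc[symmetric] exp_add[symmetric])
    finally show ?thesis by (simp add: v_def)
  qed
qed

section \<open>The cumulant function of a single bounded variable\<close>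

context prob_space
begin

context
  fixes Y :: "'a \<Rightarrow> real" and B :: real
  assumes Y [measurable]: "Y \<in> borel_measurable M" and bound: "\<And>\<omega>. \<omega> \<in> space M \<Longrightarrow> \<bar>Y \<omega>\<bar> \<le> B"
begin

lemma exp_bounds:
  assumes "\<omega> \<in> space M"
  shows "exp (- \<bar>t\<bar> * B) \<le> exp (t * Y \<omega>)" "exp (t * Y \<omega>) \<le> exp (\<bar>t\<bar> * B)"
proof -
  have "\<bar>t * Y \<omega>\<bar> \<le> \<bar>t\<bar> * B" unfolding abs_mult using bound[OF assms] by (intro mult_left_mono) auto
  then show "exp (- \<bar>t\<bar> * B) \<le> exp (t * Y \<omega>)" "exp (t * Y \<omega>) \<le> exp (\<bar>t\<bar> * B)" by auto
qed

lemma integrable_exp_bounded: "integrable M (\<lambda>\<omega>. exp (t * Y \<omega>))"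
  using exp_bounds by (intro integrable_const_bound[where B = "exp (\<bar>t\<bar> * B)"]) auto

lemma integrable_times_exp_bounded: "integrable M (\<lambda>\<omega>. Y \<omega> * exp (t * Y \<omega>))"
proof (rule integrable_const_bound[where B = "B * exp (\<bar>t\<bar> * B)"])
  show "AE \<omega> in M. norm (Y \<omega> * exp (t * Y \<omega>)) \<le> B * exp (\<bar>t\<bar> * B)"
    unfolding norm_mult using bound exp_bounds by (intro AE_I2 mult_mono) (auto intro: order_trans[OF abs_ge_zero])
qed simp

lemma expectation_exp_pos: "0 < expectation (\<lambda>\<omega>. exp (t * Y \<omega>))"
proof -
  have "expectation (\<lambda>_. exp (- \<bar>t\<bar> * B)) \<le> expectation (\<lambda>\<omega>. exp (t * Y \<omega>))"
    using exp_bounds integrable_exp_bounded by (intro integral_mono) auto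
  then have "exp (- \<bar>t\<bar> * B) \<le> expectation (\<lambda>\<omega>. exp (t * Y \<omega>))" by (simp add: prob_space)
  then show ?thesis by (rule less_le_trans[OF exp_gt_zero])
qed

lemma abs_ln_expectation_exp_le: "\<bar>ln (expectation (\<lambda>\<omega>. exp (t * Y \<omega>)))\<bar> \<le> \<bar>t\<bar> * B"
proof -
  have "expectation (\<lambda>_. exp (- \<bar>t\<bar> * B)) \<le> expectation (\<lambda>\<omega>. exp (t * Y \<omega>))"
    "expectation (\<lambda>\<omega>. exp (t * Y \<omega>)) \<le> expectation (\<lambda>_. exp (\<bar>t\<bar> * B))"
    using exp_bounds integrable_exp_bounded by (intro integral_mono; auto)+
  then have "exp (- \<bar>t\<bar> * B) \<le> expectation (\<lambda>\<omega>. exp (t * Y \<omega>))" "expectation (\<lambda>\<omega>. exp (t * Y \<omega>)) \<le> exp (\<bar>t\<bar> * B)"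
    by (simp_all add: prob_space)
  then have "exp (- \<bar>t\<bar> * B) \<le> exp (ln (expectation (\<lambda>\<omega>. exp (t * Y \<omega>))))"
    "exp (ln (expectation (\<lambda>\<omega>. exp (t * Y \<omega>)))) \<le> exp (\<bar>t\<bar> * B)"
    by (simp_all only: exp_ln[OF expectation_exp_pos])
  then have "- \<bar>t\<bar> * B \<le> ln (expectation (\<lambda>\<omega>. exp (t * Y \<omega>)))" "ln (expectation (\<lambda>\<omega>. exp (t * Y \<omega>))) \<le> \<bar>t\<bar> * B"
    by (simp_all only: exp_le_cancel_iff)
  then show ?thesis by (intro abs_leI) linarith+
qed

text \<open>The Taylor remainder of the exponential is quadratic in the increment with a constant
  uniform in \<open>\<omega>\<close>, so it survives integration.\<close>

lemma expectation_exp_has_derivative: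
  "((\<lambda>t. expectation (\<lambda>\<omega>. exp (t * Y \<omega>))) has_real_derivative expectation (\<lambda>\<omega>. Y \<omega> * exp (t * Y \<omega>))) (at t)"
proof -
  let ?G = "\<lambda>t. expectation (\<lambda>\<omega>. exp (t * Y \<omega>))" and ?D = "expectation (\<lambda>\<omega>. Y \<omega> * exp (t * Y \<omega>))"
  define K where "K = exp (\<bar>t\<bar> * B) * B\<^sup>2"
  have B: "B \<ge> 0"
  proof -
    obtain \<omega> where "\<omega> \<in> space M" using not_empty by (auto simp only: ex_in_conv[symmetric])
    from order_trans[OF abs_ge_zero bound[OF this]] show ?thesis .
  qed
  \<comment> \<open>The restriction forces \<open>\<bar>h * Y \<omega>\<bar> \<le> 1\<close>, the
    range of the Taylor bound; \<open>B + 1\<close> stays positive even for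
    \<open>B = 0\<close>.\<close>
  have rem: "\<bar>?G (t + h) - ?G t - h * ?D\<bar> \<le> K * h\<^sup>2" if h: "\<bar>h\<bar> * (B + 1) \<le> 1" for h
  proof -
    have eq: "?G (t + h) - ?G t - h * ?D
        = expectation (\<lambda>\<omega>. exp ((t + h) * Y \<omega>) - exp (t * Y \<omega>) - h * (Y \<omega> * exp (t * Y \<omega>)))"
    proof -
      define F1 F2 F3 where "F1 = (\<lambda>\<omega>. exp ((t + h) * Y \<omega>))" and "F2 = (\<lambda>\<omega>. exp (t * Y \<omega>))"
        and "F3 = (\<lambda>\<omega>. Y \<omega> * exp (t * Y \<omega>))"
      have "integrable M F1" "integrable M F2" "integrable M F3"
        unfolding F1_def F2_def F3_def by (rule integrable_exp_bounded integrable_times_exp_bounded)+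
      then have "expectation F1 - expectation F2 - h * expectation F3 = expectation (\<lambda>\<omega>. F1 \<omega> - F2 \<omega> - h * F3 \<omega>)"
        by simp
      then show ?thesis unfolding F1_def F2_def F3_def .
    qed
    have "\<bar>?G (t + h) - ?G t - h * ?D\<bar> \<le> expectation (\<lambda>\<omega>. \<bar>exp ((t + h) * Y \<omega>) - exp (t * Y \<omega>) - h * (Y \<omega> * exp (t * Y \<omega>))\<bar>)"
      unfolding eq by (rule integral_abs_bound)
    also have "\<dots> \<le> expectation (\<lambda>_. K * h\<^sup>2)"
    proof (rule integral_mono)
      show "integrable M (\<lambda>\<omega>. \<bar>exp ((t + h) * Y \<omega>) - exp (t * Y \<omega>) - h * (Y \<omega> * exp (t * Y \<omega>))\<bar>)"
        by (intro integrable_abs Bochner_Integration.integrable_diff integrable_exp_bounded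
            integrable_times_exp_bounded integrable_mult_right)
      fix \<omega> assume \<omega>: "\<omega> \<in> space M"
      have hY: "\<bar>h * Y \<omega>\<bar> \<le> \<bar>h\<bar> * B" unfolding abs_mult using bound[OF \<omega>] by (intro mult_left_mono) auto
      also have "\<dots> \<le> \<bar>h\<bar> * (B + 1)" by (intro mult_left_mono) auto
      finally have 1: "\<bar>h * Y \<omega>\<bar> \<le> 1" using h by linarith
      have eq: "exp ((t + h) * Y \<omega>) - exp (t * Y \<omega>) - h * (Y \<omega> * exp (t * Y \<omega>))
        = exp (t * Y \<omega>) * (exp (h * Y \<omega>) - 1 - h * Y \<omega>)"
      proof -
        have "exp ((t + h) * Y \<omega>) = exp (t * Y \<omega>) * exp (h * Y \<omega>)" unfolding distrib_right by (rule exp_add)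
        moreover have "a * b - a - h * (y * a) = a * (b - 1 - h * y)" for a b y :: real by (simp add: algebra_simps)
        ultimately show ?thesis by (simp only:)
      qed
      have "\<bar>exp ((t + h) * Y \<omega>) - exp (t * Y \<omega>) - h * (Y \<omega> * exp (t * Y \<omega>))\<bar> \<le> exp (\<bar>t\<bar> * B) * (\<bar>h\<bar> * B)\<^sup>2"
        unfolding eq abs_mult
      proof (rule mult_mono)
        show "\<bar>exp (t * Y \<omega>)\<bar> \<le> exp (\<bar>t\<bar> * B)" using exp_bounds(2)[OF \<omega>] by simp
        have "\<bar>exp (h * Y \<omega>) - 1 - h * Y \<omega>\<bar> \<le> (h * Y \<omega>)\<^sup>2" using exp_taylor_bounds[OF 1] by linarith
        also have "\<dots> = \<bar>h * Y \<omega>\<bar>\<^sup>2" by (rule power2_abs[symmetric])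
        also have "\<dots> \<le> (\<bar>h\<bar> * B)\<^sup>2" using hY by (rule power_mono) simp
        finally show "\<bar>exp (h * Y \<omega>) - 1 - h * Y \<omega>\<bar> \<le> (\<bar>h\<bar> * B)\<^sup>2" .
      qed auto
      also have "\<dots> = K * h\<^sup>2" by (simp add: K_def power_mult_distrib)
      finally show "\<bar>exp ((t + h) * Y \<omega>) - exp (t * Y \<omega>) - h * (Y \<omega> * exp (t * Y \<omega>))\<bar> \<le> K * h\<^sup>2" .
    qed simp
    also have "\<dots> = K * h\<^sup>2" by (simp add: prob_space)
    finally show ?thesis .
  qed
  have "(\<lambda>h. (?G (t + h) - ?G t) / h - ?D) \<midarrow>0\<rightarrow> 0"
  proof (rule Lim_null_comparison)
    have "0 < 1 / (B + 1)" using B by simp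
    then have "\<forall>\<^sub>F h in at (0::real). \<bar>h\<bar> < 1 / (B + 1)"
      unfolding eventually_at by (intro exI[of _ "1 / (B + 1)"]) simp
    then show "\<forall>\<^sub>F h in at 0. norm ((?G (t + h) - ?G t) / h - ?D) \<le> K * \<bar>h\<bar>"
      using eventually_neq_at_within[of 0]
    proof eventually_elim
      case (elim h)
      then have "\<bar>h\<bar> * (B + 1) \<le> 1" using B by (simp add: pos_less_divide_eq)
      from rem[OF this] have "\<bar>?G (t + h) - ?G t - h * ?D\<bar> / \<bar>h\<bar> \<le> K * h\<^sup>2 / \<bar>h\<bar>" by (rule divide_right_mono) simp
      also have "K * h\<^sup>2 / \<bar>h\<bar> = K * \<bar>h\<bar>" using elim by (simp add: power2_eq_square abs_if)
      also have "\<bar>?G (t + h) - ?G t - h * ?D\<bar> / \<bar>h\<bar> = norm ((?G (t + h) - ?G t) / h - ?D)"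
        unfolding real_norm_def abs_divide[symmetric] using elim by (simp add: diff_divide_distrib)
      finally show ?case .
    qed
    show "(\<lambda>h. K * \<bar>h\<bar>) \<midarrow>0\<rightarrow> 0" using tendsto_mult[OF tendsto_const tendsto_rabs_zero[OF tendsto_ident_at]] by simp
  qed
  then show ?thesis unfolding DERIV_def by (subst (asm) LIM_zero_iff)
qed

text \<open>The derivative is the mean of \<open>Y\<close> under the tilted measure, so it inherits
  the bound on \<open>Y\<close> for every \<open>t\<close>. This uniformity in \<open>t\<close>
  feeds the Weierstrass test later.\<close>

lemma ln_expectation_exp_derivative:
  defines "m \<equiv> \<lambda>t. expectation (\<lambda>\<omega>. Y \<omega> * exp (t * Y \<omega>)) / expectation (\<lambda>\<omega>. exp (t * Y \<omega>))"
  shows "((\<lambda>t. ln (expectation (\<lambda>\<omega>. exp (t * Y \<omega>)))) has_real_derivative m t) (at t)" "\<bar>m t\<bar> \<le> B"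
proof -
  let ?G = "expectation (\<lambda>\<omega>. exp (t * Y \<omega>))"
  show "((\<lambda>t. ln (expectation (\<lambda>\<omega>. exp (t * Y \<omega>)))) has_real_derivative m t) (at t)"
    unfolding m_def using expectation_exp_pos
    by (intro DERIV_cong[OF DERIV_chain2[OF DERIV_ln_divide expectation_exp_has_derivative]]) simp_all
  have "\<bar>expectation (\<lambda>\<omega>. Y \<omega> * exp (t * Y \<omega>))\<bar> \<le> expectation (\<lambda>\<omega>. \<bar>Y \<omega> * exp (t * Y \<omega>)\<bar>)"
    by (rule integral_abs_bound)
  also have "\<dots> \<le> expectation (\<lambda>\<omega>. B * exp (t * Y \<omega>))"
  proof (intro integral_mono integrable_abs integrable_times_exp_bounded integrable_mult_right integrable_exp_bounded)
    fix \<omega> assume "\<omega> \<in> space M"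
    show "\<bar>Y \<omega> * exp (t * Y \<omega>)\<bar> \<le> B * exp (t * Y \<omega>)"
      unfolding abs_mult using bound[OF \<open>\<omega> \<in> space M\<close>] by (intro mult_mono) auto
  qed
  also have "\<dots> = B * ?G" by simp
  finally show "\<bar>m t\<bar> \<le> B" unfolding m_def using expectation_exp_pos[of t] by (simp add: abs_divide divide_le_eq)
qed

end

end

section \<open>The pressure and the large deviation principle\<close>

context gibbs_layers
begin

text \<open>Independence from the sure event of the other layers.\<close>

lemma layer_distr:
  assumes r: "r \<in> layer_roots p"
  shows "distr \<mu>U (config_space UNIV) (layer p r) = \<mu>V"
proof (rule measure_eqI)
  show "sets (distr \<mu>U (config_space UNIV) (layer p r)) = sets \<mu>V" by (simp add: sets_V)
  fix A assume "A \<in> sets (distr \<mu>U (config_space UNIV) (layer p r))"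
  then have A: "A \<in> sets (config_space UNIV)" by simp
  have "U.prob {\<sigma> \<in> configs {1..}. layer p r \<sigma> \<in> A \<and> restrict \<sigma> (rest r) \<in> configs (rest r)}
    = V.prob A * U.prob {\<sigma> \<in> configs {1..}. restrict \<sigma> (rest r) \<in> configs (rest r)}"
    using layer_independent[OF r A sets.top] by simp
  moreover have "restrict \<sigma> (rest r) \<in> configs (rest r)" if "\<sigma> \<in> configs {1..}" for \<sigma>
    using that by (rule configs_restrict) (auto simp: rest_def)
  then have "{\<sigma> \<in> configs {1..}. layer p r \<sigma> \<in> A \<and> restrict \<sigma> (rest r) \<in> configs (rest r)} = layer p r -` A \<inter> space \<mu>U"
    "{\<sigma> \<in> configs {1..}. restrict \<sigma> (rest r) \<in> configs (rest r)} = space \<mu>U" by auto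
  ultimately have "U.prob (layer p r -` A \<inter> space \<mu>U) = V.prob A" by (simp only: U.prob_space mult_1_right)
  then show "emeasure (distr \<mu>U (config_space UNIV) (layer p r)) A = emeasure \<mu>V A"
    unfolding emeasure_distr[OF layer_measurable_U[OF roots_pos[OF r]] A]
    by (simp only: U.emeasure_eq_measure V.emeasure_eq_measure)
qed

lemma layer_integral:
  fixes g :: "(nat ^ 'd \<Rightarrow> real) \<Rightarrow> real"
  assumes r: "r \<in> layer_roots p" and g: "g \<in> borel_measurable (config_space UNIV)"
  shows "(\<integral>\<sigma>. g (layer p r \<sigma>) \<partial>\<mu>U) = (\<integral>\<tau>. g \<tau> \<partial>\<mu>V)"
  using integral_distr[OF layer_measurable_U[OF roots_pos[OF r]] g] unfolding layer_distr[OF r] by (rule sym)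

lemma layer_indep_var:
  fixes g :: "(nat ^ 'd \<Rightarrow> real) \<Rightarrow> real" and h :: "(nat \<Rightarrow> real) \<Rightarrow> real"
  assumes r: "r \<in> layer_roots p"
    and g: "g \<in> borel_measurable (config_space UNIV)" and h: "h \<in> borel_measurable (config_space (rest r))"
  shows "U.indep_var borel (\<lambda>\<sigma>. g (layer p r \<sigma>)) borel (\<lambda>\<sigma>. h (restrict \<sigma> (rest r)))"
  unfolding U.indep_var_eq
proof (intro conjI)
  let ?X = "\<lambda>\<sigma>. g (layer p r \<sigma>)" and ?Y = "\<lambda>\<sigma>. h (restrict \<sigma> (rest r))"
  show X: "?X \<in> borel_measurable \<mu>U" by (rule measurable_compose[OF layer_measurable_U[OF roots_pos[OF r]] g])
  show Y: "?Y \<in> borel_measurable \<mu>U" by (rule measurable_compose[OF rest_measurable_U h])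
  \<comment> \<open>The preimages already form a sigma-algebra, so independence need only be checked
    on them.\<close>
  have vimage: "sigma_sets (space \<mu>U) {X -` A \<inter> space \<mu>U |A. A \<in> sets borel} = {X -` A \<inter> space \<mu>U |A. A \<in> sets borel}"
    for X :: "_ \<Rightarrow> real"
    using sigma_sets_vimage_commute[of X "space \<mu>U" UNIV "sets borel"] sets.sigma_sets_eq[of "borel :: real measure"] by simp
  show "U.indep_set (sigma_sets (space \<mu>U) {?X -` A \<inter> space \<mu>U |A. A \<in> sets borel})
    (sigma_sets (space \<mu>U) {?Y -` A \<inter> space \<mu>U |A. A \<in> sets borel})"
    unfolding vimage
  proof (rule U.indep_setI)
    show "{?X -` A \<inter> space \<mu>U |A. A \<in> sets borel} \<subseteq> U.events" using measurable_sets[OF X] by auto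
    show "{?Y -` A \<inter> space \<mu>U |A. A \<in> sets borel} \<subseteq> U.events" using measurable_sets[OF Y] by auto
    fix a b assume "a \<in> {?X -` A \<inter> space \<mu>U |A. A \<in> sets borel}" and "b \<in> {?Y -` A \<inter> space \<mu>U |A. A \<in> sets borel}"
    then obtain A B where A: "A \<in> sets borel" "a = ?X -` A \<inter> space \<mu>U"
      and B: "B \<in> sets borel" "b = ?Y -` B \<inter> space \<mu>U" by auto
    define A' where "A' = g -` A \<inter> configs UNIV"
    define B' where "B' = h -` B \<inter> configs (rest r)"
    have A': "A' \<in> sets (config_space UNIV)" using measurable_sets[OF g A(1)] by (simp add: A'_def)
    have B': "B' \<in> sets (config_space (rest r))" using measurable_sets[OF h B(1)] by (simp add: B'_def)
    have restrict: "restrict \<sigma> (rest r) \<in> configs (rest r)" if "\<sigma> \<in> configs {1..}" for \<sigma>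
      using that by (rule configs_restrict) (auto simp: rest_def)
    have a: "a = layer p r -` A' \<inter> space \<mu>U"
      unfolding A(2) A'_def space_U using layer_configs[OF roots_pos[OF r]] by auto
    have "U.prob a = V.prob A'"
      using measure_distr[OF layer_measurable_U[OF roots_pos[OF r]] A'] unfolding layer_distr[OF r] a by (rule sym)
    moreover have b: "b = {\<sigma> \<in> configs {1..}. restrict \<sigma> (rest r) \<in> B'}"
      unfolding B(2) B'_def space_U using restrict by auto
    moreover have "a \<inter> b = {\<sigma> \<in> configs {1..}. layer p r \<sigma> \<in> A' \<and> restrict \<sigma> (rest r) \<in> B'}"
      unfolding a b space_U by auto
    ultimately show "U.prob (a \<inter> b) = U.prob a * U.prob b"
      using layer_independent[OF r A' B'] by (simp only:)
  qed
qed

text \<open>One layer is split off at a time. The remaining factors live on other layers, hence on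
  sites in \<open>rest r\<close>, so their product is a function of the restriction to
  \<open>rest r\<close> and independent of layer \<open>r\<close>.\<close>

lemma layers_product:
  fixes g :: "nat \<Rightarrow> (nat ^ 'd \<Rightarrow> real) \<Rightarrow> real"
  assumes "finite R" "R \<subseteq> layer_roots p"
    and g: "\<And>r. r \<in> R \<Longrightarrow> g r \<in> borel_measurable (config_space UNIV)"
    and bound: "\<And>r \<tau>. r \<in> R \<Longrightarrow> \<tau> \<in> configs UNIV \<Longrightarrow> \<bar>g r \<tau>\<bar> \<le> c r"
  shows "integrable \<mu>U (\<lambda>\<sigma>. \<Prod>r\<in>R. g r (layer p r \<sigma>)) \<and>
    (\<integral>\<sigma>. (\<Prod>r\<in>R. g r (layer p r \<sigma>)) \<partial>\<mu>U) = (\<Prod>r\<in>R. \<integral>\<tau>. g r \<tau> \<partial>\<mu>V)"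
  using assms
proof (induction R rule: finite_induct)
  case empty
  then show ?case using U.prob_space by simp
next
  case (insert r R)
  have r: "r \<in> layer_roots p" using insert.prems by simp
  define H where "H \<rho> = (\<Prod>r'\<in>R. g r' (layer p r' \<rho>))" for \<rho>
  have IH: "integrable \<mu>U H" "(\<integral>\<sigma>. H \<sigma> \<partial>\<mu>U) = (\<Prod>r\<in>R. \<integral>\<tau>. g r \<tau> \<partial>\<mu>V)"
    unfolding H_def using insert.IH insert.prems by auto
  have site: "site r' x \<in> rest r" if "r' \<in> R" for r' x
  proof -
    have r': "r' \<in> layer_roots p" "r' \<noteq> r" using that insert by auto
    have "site r' x \<noteq> site r y" for y using site_unique[OF r'(1) r] r'(2) unfolding site_def by blast
    then show ?thesis using site_ge_1[OF roots_pos[OF r'(1)]] by (auto simp: rest_def)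
  qed
  have H_restrict: "H (restrict \<sigma> (rest r)) = H \<sigma>" for \<sigma>
  proof -
    have "layer p r' (restrict \<sigma> (rest r)) = layer p r' \<sigma>" if "r' \<in> R" for r'
      using site[OF that] by (simp add: layer_apply fun_eq_iff)
    then show ?thesis by (simp add: H_def)
  qed
  have layer_rest: "layer p r' \<in> measurable (config_space (rest r)) (config_space UNIV)" if "r' \<in> R" for r'
    using site[OF that]
    by (intro measurable_into_config_space) (auto simp: layer_apply configs_def PiE_iff intro!: config_coord_measurable)
  have H_meas: "H \<in> borel_measurable (config_space (rest r))"
    unfolding H_def
  proof (rule borel_measurable_prod)
    fix r' assume "r' \<in> R"
    then have "g r' \<in> borel_measurable (config_space UNIV)" using insert.prems(2) by simp
    from measurable_compose[OF layer_rest[OF \<open>r' \<in> R\<close>] this]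
    show "(\<lambda>\<rho>. g r' (layer p r' \<rho>)) \<in> borel_measurable (config_space (rest r))" .
  qed
  have "g r \<in> borel_measurable (config_space UNIV)" using insert.prems(2) by simp
  from layer_indep_var[OF r this H_meas]
  have indep: "U.indep_var borel (\<lambda>\<sigma>. g r (layer p r \<sigma>)) borel H" by (simp only: H_restrict)
  have int: "integrable \<mu>U (\<lambda>\<sigma>. g r (layer p r \<sigma>))"
  proof (rule U.integrable_const_bound[where B = "c r"])
    show "AE \<sigma> in \<mu>U. norm (g r (layer p r \<sigma>)) \<le> c r"
      using insert.prems(3) layer_configs[OF roots_pos[OF r]] by (intro AE_I2) simp
    show "(\<lambda>\<sigma>. g r (layer p r \<sigma>)) \<in> borel_measurable \<mu>U"
      using insert.prems(2) by (intro measurable_compose[OF layer_measurable_U[OF roots_pos[OF r]]]) simp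
  qed
  have law: "(\<integral>\<sigma>. g r (layer p r \<sigma>) \<partial>\<mu>U) = (\<integral>\<tau>. g r \<tau> \<partial>\<mu>V)"
    using insert.prems(2) by (intro layer_integral[OF r]) simp
  show ?case
    unfolding prod.insert[OF insert.hyps] H_def[symmetric] U.indep_var_lebesgue_integral[OF indep int IH(1)] law IH(2)
    using U.indep_var_integrable[OF indep int IH(1)] by simp
qed

section \<open>Sums over boxes, their cumulants and the pressure\<close>

definition box_sum :: "((nat ^ 'd \<Rightarrow> real) \<Rightarrow> real) \<Rightarrow> (nat ^ 'd) set \<Rightarrow> (nat ^ 'd \<Rightarrow> real) \<Rightarrow> real" where
  "box_sum g L \<tau> = (\<Sum>x\<in>L. g (add_shift x \<tau>))"

lemma add_shift_configs: "\<tau> \<in> configs UNIV \<Longrightarrow> add_shift x \<tau> \<in> configs UNIV"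
  by (auto simp: configs_def add_shift_def)

lemma box_sum_measurable:
  assumes "g \<in> borel_measurable (config_space UNIV)"
  shows "box_sum g L \<in> borel_measurable (config_space UNIV)"
proof -
  have shift: "add_shift x \<in> measurable (config_space UNIV) (config_space UNIV)" for x :: "nat ^ 'd"
    using add_shift_configs
    by (intro measurable_into_config_space) (auto simp: add_shift_def intro!: config_coord_measurable)
  show ?thesis
    unfolding box_sum_def[abs_def] by (intro borel_measurable_sum measurable_compose[OF shift assms])
qed

lemma box_sum_bound:
  assumes "\<And>\<tau>. \<tau> \<in> configs UNIV \<Longrightarrow> \<bar>g \<tau>\<bar> \<le> C" "\<tau> \<in> configs UNIV"
  shows "\<bar>box_sum g L \<tau>\<bar> \<le> C * real (card L)"
proof -
  have "\<bar>box_sum g L \<tau>\<bar> \<le> (\<Sum>x\<in>L. \<bar>g (add_shift x \<tau>)\<bar>)" unfolding box_sum_def by (rule sum_abs)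
  also have "\<dots> \<le> (\<Sum>x\<in>L. C)" using assms add_shift_configs by (intro sum_mono) blast
  finally show ?thesis by (simp add: mult.commute)
qed

text \<open>Boxes are sublevel sets of one function, hence nested, so boxes of equal size coincide
  and the definite description is meaningful.\<close>

lemma Psi_eq:
  assumes r: "r \<in> layer_roots p" "r \<le> N"
  shows "Psi p \<nu> g (card (layer_box p r N)) = ln (\<integral>\<tau>. exp (box_sum g (layer_box p r N) \<tau>) \<partial>\<nu>)"
  unfolding Psi_def box_sum_def[symmetric]
proof (rule the_equality)
  show "\<exists>r'\<in>layer_roots p. \<exists>N'\<ge>r'. card (layer_box p r' N') = card (layer_box p r N) \<and>
      ln (\<integral>\<tau>. exp (box_sum g (layer_box p r N) \<tau>) \<partial>\<nu>) = ln (\<integral>\<tau>. exp (box_sum g (layer_box p r' N') \<tau>) \<partial>\<nu>)"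
    using r by (intro bexI[of _ r] exI[of _ N]) auto
next
  fix v assume "\<exists>r'\<in>layer_roots p. \<exists>N'\<ge>r'. card (layer_box p r' N') = card (layer_box p r N) \<and>
      v = ln (\<integral>\<tau>. exp (box_sum g (layer_box p r' N') \<tau>) \<partial>\<nu>)"
  then obtain r' N' where r': "r' \<in> layer_roots p" "r' \<le> N'" and card: "card (layer_box p r' N') = card (layer_box p r N)"
    and v: "v = ln (\<integral>\<tau>. exp (box_sum g (layer_box p r' N') \<tau>) \<partial>\<nu>)" by auto
  have eqs: "layer_box p r N = {x. real (pm x) \<le> real N / real r}"
    "layer_box p r' N' = {x. real (pm x) \<le> real N' / real r'}"
    using layer_box_eq roots_pos r r' by auto
  have "layer_box p r N \<subseteq> layer_box p r' N' \<or> layer_box p r' N' \<subseteq> layer_box p r N"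
    unfolding eqs by (cases "real N / real r \<le> real N' / real r'") auto
  then have "layer_box p r' N' = layer_box p r N"
    using card_subset_eq[OF layer_box_card(1)[OF r], of "layer_box p r' N'"]
      card_subset_eq[OF layer_box_card(1)[OF r'], of "layer_box p r N"] card by auto
  then show "v = ln (\<integral>\<tau>. exp (box_sum g (layer_box p r N) \<tau>) \<partial>\<nu>)" using v by simp
qed

lemma one_in_roots: "1 \<in> layer_roots p"
proof -
  have "\<not> p k dvd 1" for k using prime_p[of k] by (metis not_prime_unit)
  then show ?thesis by (simp add: layer_roots_def)
qed

lemma card_first_box: "card (layer_box p 1 (smooth j)) = Suc j"
proof -
  have "card {x. real (pm x) \<le> real (smooth j)} = Suc j"
    using smooth_strict_mono by (simp only: card_pm_le_eq_Suc_iff strict_mono_def) auto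
  then show ?thesis by (simp add: layer_box_eq)
qed

text \<open>The box of root 1 with \<open>N = smooth j\<close> has exactly j + 1 sites and serves as
  representative of that size.\<close>

lemma Psi_Suc: "Psi p \<nu> g (Suc j) = ln (\<integral>\<tau>. exp (box_sum g (layer_box p 1 (smooth j)) \<tau>) \<partial>\<nu>)"
proof -
  have "1 \<le> smooth j" using smooth_pos[of j] by linarith
  from Psi_eq[OF one_in_roots this] show ?thesis unfolding card_first_box .
qed

lemma mult_shift_configs: "0 < i \<Longrightarrow> \<sigma> \<in> configs {1..} \<Longrightarrow> mult_shift i \<sigma> \<in> configs {1..}"
  by (auto simp: configs_def mult_shift_def PiE_iff extensional_def)

text \<open>Each \<open>i\<close> in \<open>{1..N}\<close> is \<open>site r x\<close> for exactly
  one root \<open>r\<close> and one \<open>x\<close> in its box, and shifting by \<open>i\<close>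
  before reading the first layer is reading layer \<open>r\<close> translated by
  \<open>x\<close>.\<close>

lemma ergodic_sum_eq:
  assumes first: "first_layer_function p f fstar" and \<sigma>: "\<sigma> \<in> configs {1..}"
  shows "(\<Sum>i=1..N. f (mult_shift i \<sigma>))
    = (\<Sum>r | r \<in> layer_roots p \<and> r \<le> N. box_sum fstar (layer_box p r N) (layer p r \<sigma>))"
proof -
  let ?R = "{r. r \<in> layer_roots p \<and> r \<le> N}"
  have term_eq: "f (mult_shift (site r x) \<sigma>) = fstar (add_shift x (layer p r \<sigma>))" if "r \<in> layer_roots p" for r x
  proof -
    have "layer p 1 (mult_shift (site r x) \<sigma>) = add_shift x (layer p r \<sigma>)"
      by (simp add: layer_def mult_shift_def add_shift_def site_def pm_add mult.assoc fun_eq_iff)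
    moreover have "mult_shift (site r x) \<sigma> \<in> configs {1..}"
      using site_ge_1[OF roots_pos[OF that]] by (intro mult_shift_configs[OF _ \<sigma>]) (simp add: Suc_le_eq)
    moreover from this have "f (mult_shift (site r x) \<sigma>) = fstar (layer p 1 (mult_shift (site r x) \<sigma>))"
      using first[unfolded first_layer_function_def, THEN conjunct2, THEN conjunct2] by (rule bspec[rotated])
    ultimately show ?thesis by (simp only:)
  qed
  have bij: "bij_betw (\<lambda>(r, x). site r x) (Sigma ?R (\<lambda>r. layer_box p r N)) {1..N}"
    unfolding bij_betw_def
  proof
    show "inj_on (\<lambda>(r, x). site r x) (Sigma ?R (\<lambda>r. layer_box p r N))"
      using site_unique unfolding site_def by (auto intro!: inj_onI)
    show "(\<lambda>(r, x). site r x) ` Sigma ?R (\<lambda>r. layer_box p r N) = {1..N}"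
    proof (rule set_eqI, rule iffI)
      fix n assume "n \<in> (\<lambda>(r, x). site r x) ` Sigma ?R (\<lambda>r. layer_box p r N)"
      then obtain r x where "r \<in> layer_roots p" "x \<in> layer_box p r N" "n = site r x" by auto
      then show "n \<in> {1..N}" using site_ge_1[OF roots_pos] by (simp add: layer_box_def site_def)
    next
      fix n assume n: "n \<in> {1..N}"
      then obtain r x where rx: "r \<in> layer_roots p" "n = r * pm x" using site_exists[of n] by auto
      then have "r \<le> n" using pm_ge_1[of x] by simp
      then have "r \<le> N" using n by simp
      then have "(r, x) \<in> Sigma ?R (\<lambda>r. layer_box p r N)" using rx n by (simp add: layer_box_def)
      then show "n \<in> (\<lambda>(r, x). site r x) ` Sigma ?R (\<lambda>r. layer_box p r N)"
        using rx(2) by (intro image_eqI[of _ _ "(r, x)"]) (simp_all add: site_def)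
    qed
  qed
  have "(\<Sum>i=1..N. f (mult_shift i \<sigma>)) = (\<Sum>(r, x)\<in>Sigma ?R (\<lambda>r. layer_box p r N). f (mult_shift (site r x) \<sigma>))"
    using sum.reindex_bij_betw[OF bij, of "\<lambda>i. f (mult_shift i \<sigma>)"] by (simp add: split_beta')
  also have "\<dots> = (\<Sum>r\<in>?R. \<Sum>x\<in>layer_box p r N. f (mult_shift (site r x) \<sigma>))"
  proof (rule sum.Sigma[symmetric])
    show "finite ?R" by (rule finite_subset[of _ "{..N}"]) auto
    show "\<forall>r\<in>?R. finite (layer_box p r N)" using layer_box_card(1) by blast
  qed
  also have "\<dots> = (\<Sum>r\<in>?R. box_sum fstar (layer_box p r N) (layer p r \<sigma>))"
    unfolding box_sum_def by (rule sum.cong[OF refl], rule sum.cong[OF refl], rule term_eq) simp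
  finally show ?thesis .
qed

context
  fixes f :: "(nat \<Rightarrow> real) \<Rightarrow> real" and fstar :: "(nat ^ 'd \<Rightarrow> real) \<Rightarrow> real"
  assumes first: "first_layer_function p f fstar"
begin

lemma fstar_measurable: "fstar \<in> borel_measurable (config_space UNIV)"
  using first by (intro continuous_configs_measurable) (simp add: first_layer_function_def)

lemma fstar_bounded: "\<exists>C\<ge>0. \<forall>\<tau>\<in>configs UNIV. \<bar>fstar \<tau>\<bar> \<le> C"
proof -
  have "compact (fstar ` configs UNIV)"
    using first by (intro compact_continuous_image compact_configs) (simp add: first_layer_function_def)
  then obtain C where "\<forall>y\<in>fstar ` configs UNIV. \<bar>y\<bar> \<le> C"
    using compact_imp_bounded bounded_real by blast
  then show ?thesis by (intro exI[of _ "max 0 C"]) (auto simp: max_def intro: order_trans)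
qed

text \<open>Lets the pressure formula be applied at every multiple of \<open>f\<close>, as the rate
  function requires.\<close>

lemma scaled_first_layer: "first_layer_function p (\<lambda>\<sigma>. t * f \<sigma>) (\<lambda>\<tau>. t * fstar \<tau>)"
  using first by (auto simp: first_layer_function_def intro!: continuous_intros)

lemma box_sum_scaled: "box_sum (\<lambda>\<tau>. t * fstar \<tau>) L \<tau> = t * box_sum fstar L \<tau>"
  by (simp add: box_sum_def sum_distrib_left)

lemma box_sum_V:
  assumes "\<And>\<tau>. \<tau> \<in> configs UNIV \<Longrightarrow> \<bar>fstar \<tau>\<bar> \<le> C"
  shows "box_sum fstar L \<in> borel_measurable \<mu>V"
    and "\<And>\<tau>. \<tau> \<in> space \<mu>V \<Longrightarrow> \<bar>box_sum fstar L \<tau>\<bar> \<le> C * real (card L)"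
  using box_sum_measurable[OF fstar_measurable] box_sum_bound[OF assms]
  by (simp_all add: measurable_cong_sets[OF sets_V refl])

lemma Psi_bound:
  assumes "\<And>\<tau>. \<tau> \<in> configs UNIV \<Longrightarrow> \<bar>fstar \<tau>\<bar> \<le> C"
  shows "\<bar>Psi p \<mu>V fstar (Suc l)\<bar> \<le> C * real (Suc l)"
  using V.abs_ln_expectation_exp_le[OF box_sum_V[OF assms], of 1 "layer_box p 1 (smooth l)"]
  unfolding Psi_Suc by (simp only: card_first_box) simp

lemma log_mgf_eq: "log_mgf \<mu>U f N = (\<Sum>r | r \<in> layer_roots p \<and> r \<le> N. Psi p \<mu>V fstar (card (layer_box p r N)))"
proof -
  let ?R = "{r. r \<in> layer_roots p \<and> r \<le> N}"
  let ?g = "\<lambda>r \<tau>. exp (box_sum fstar (layer_box p r N) \<tau>)"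
  obtain C where C: "\<And>\<tau>. \<tau> \<in> configs UNIV \<Longrightarrow> \<bar>fstar \<tau>\<bar> \<le> C" using fstar_bounded by blast
  have fin: "finite ?R" by (rule finite_subset[of _ "{..N}"]) auto
  have "(\<integral>\<sigma>. exp (\<Sum>i=1..N. f (mult_shift i \<sigma>)) \<partial>\<mu>U) = (\<integral>\<sigma>. (\<Prod>r\<in>?R. ?g r (layer p r \<sigma>)) \<partial>\<mu>U)"
    by (rule Bochner_Integration.integral_cong[OF refl]) (simp only: space_U ergodic_sum_eq[OF first] exp_sum[OF fin])
  also have "\<dots> = (\<Prod>r\<in>?R. \<integral>\<tau>. ?g r \<tau> \<partial>\<mu>V)"
  proof (rule layers_product[OF fin, THEN conjunct2])
    fix r assume "r \<in> ?R"
    show "?g r \<in> borel_measurable (config_space UNIV)"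
      by (intro measurable_compose[OF box_sum_measurable[OF fstar_measurable] borel_measurable_exp])
    fix \<tau> :: "nat ^ 'd \<Rightarrow> real" assume "\<tau> \<in> configs UNIV"
    from box_sum_bound[of fstar C, OF C this, of "layer_box p r N"]
    show "\<bar>?g r \<tau>\<bar> \<le> exp (C * real (card (layer_box p r N)))" by simp
  qed auto
  finally have "log_mgf \<mu>U f N = ln (\<Prod>r\<in>?R. \<integral>\<tau>. ?g r \<tau> \<partial>\<mu>V)" unfolding log_mgf_def by (rule arg_cong)
  also have "\<dots> = (\<Sum>r\<in>?R. ln (\<integral>\<tau>. ?g r \<tau> \<partial>\<mu>V))"
  proof (rule ln_prod[OF fin])
    fix r
    show "(\<integral>\<tau>. ?g r \<tau> \<partial>\<mu>V) \<noteq> 0"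
      using V.expectation_exp_pos[OF box_sum_V[OF C], of 1 "layer_box p r N"] by simp
  qed
  also have "\<dots> = (\<Sum>r\<in>?R. Psi p \<mu>V fstar (card (layer_box p r N)))"
    by (intro sum.cong refl) (simp add: Psi_eq)
  finally show ?thesis .
qed

lemma pressure_limit:
  defines "w \<equiv> \<lambda>j. exp (- rho_minus p (Suc j)) - exp (- rho_plus p (Suc j))"
  shows "summable (\<lambda>j. w j * Psi p \<mu>V fstar (Suc j))"
    and "(\<lambda>N. 1 / real N * log_mgf \<mu>U f N) \<longlonglongrightarrow> kappa p * (\<Sum>j. w j * Psi p \<mu>V fstar (Suc j))"
    and "mult_pressure \<mu>U f = kappa p * (\<Sum>j. w j * Psi p \<mu>V fstar (Suc j))"
proof -
  obtain C where C: "\<And>\<tau>. \<tau> \<in> configs UNIV \<Longrightarrow> \<bar>fstar \<tau>\<bar> \<le> C" using fstar_bounded by blast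
  have bound: "\<bar>Psi p \<mu>V fstar (Suc l)\<bar> \<le> C * real (Suc l)" for l by (rule Psi_bound[OF C])
  show "summable (\<lambda>j. w j * Psi p \<mu>V fstar (Suc j))"
    unfolding w_def by (rule layer_average_limit(1)[OF bound])
  show lim: "(\<lambda>N. 1 / real N * log_mgf \<mu>U f N) \<longlonglongrightarrow> kappa p * (\<Sum>j. w j * Psi p \<mu>V fstar (Suc j))"
    unfolding w_def log_mgf_eq by (rule layer_average_limit(2)[OF bound])
  show "mult_pressure \<mu>U f = kappa p * (\<Sum>j. w j * Psi p \<mu>V fstar (Suc j))"
    unfolding mult_pressure_def by (rule limI[OF lim])
qed

end

section \<open>Dependence on the multiplier t: differentiability and large deviations\<close>

context
  fixes f :: "(nat \<Rightarrow> real) \<Rightarrow> real" and fstar :: "(nat ^ 'd \<Rightarrow> real) \<Rightarrow> real"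
  assumes first: "first_layer_function p f fstar"
begin

text \<open>The derivative of the j-th term is a weight of at most \<open>1 / smooth j\<close> times
  a tilted mean of at most \<open>C * (j + 1)\<close> in absolute value, uniformly in
  \<open>t\<close>. The series of derivatives thus converges uniformly on the line and may be summed
  termwise.\<close>

lemma pressure_differentiable:
  "\<exists>L'. \<forall>t. ((\<lambda>t. mult_pressure \<mu>U (\<lambda>\<sigma>. t * f \<sigma>)) has_real_derivative L' t) (at t)"
proof -
  obtain C where C: "C \<ge> 0" "\<And>\<tau>. \<tau> \<in> configs UNIV \<Longrightarrow> \<bar>fstar \<tau>\<bar> \<le> C" using fstar_bounded[OF first] by blast
  define w where "w j = exp (- rho_minus p (Suc j)) - exp (- rho_plus p (Suc j))" for j
  define S where "S j = box_sum fstar (layer_box p 1 (smooth j))" for j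
  define m where "m j t = (\<integral>\<tau>. S j \<tau> * exp (t * S j \<tau>) \<partial>\<mu>V) / (\<integral>\<tau>. exp (t * S j \<tau>) \<partial>\<mu>V)" for j t
  have S: "S j \<in> borel_measurable \<mu>V" "\<And>\<tau>. \<tau> \<in> space \<mu>V \<Longrightarrow> \<bar>S j \<tau>\<bar> \<le> C * real (Suc j)" for j
    using box_sum_V[OF first C(2), where L = "layer_box p 1 (smooth j)"] by (simp_all only: S_def card_first_box)
  have Psi: "Psi p \<mu>V (\<lambda>\<tau>. t * fstar \<tau>) (Suc j) = ln (\<integral>\<tau>. exp (t * S j \<tau>) \<partial>\<mu>V)" for t j
    unfolding Psi_Suc box_sum_scaled[OF first] S_def ..
  have pressure: "summable (\<lambda>j. w j * ln (\<integral>\<tau>. exp (t * S j \<tau>) \<partial>\<mu>V))"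
    "mult_pressure \<mu>U (\<lambda>\<sigma>. t * f \<sigma>) = kappa p * (\<Sum>j. w j * ln (\<integral>\<tau>. exp (t * S j \<tau>) \<partial>\<mu>V))" for t
    using pressure_limit(1,3)[OF scaled_first_layer[OF first], of t] by (simp_all only: w_def Psi)
  have deriv: "((\<lambda>t. w j * ln (\<integral>\<tau>. exp (t * S j \<tau>) \<partial>\<mu>V)) has_real_derivative w j * m j t) (at t)" for j t
    unfolding m_def by (intro DERIV_cmult V.ln_expectation_exp_derivative(1)[OF S])
  have "norm (w j * m j t) \<le> C * (real (Suc j) / real (smooth j))" for j t
  proof -
    have "\<bar>m j t\<bar> \<le> C * real (Suc j)" unfolding m_def by (rule V.ln_expectation_exp_derivative(2)[OF S])
    then have "\<bar>w j\<bar> * \<bar>m j t\<bar> \<le> 1 / real (smooth j) * (C * real (Suc j))"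
      using weight_bounds[of j] by (intro mult_mono) (auto simp: w_def)
    then show ?thesis by (simp add: abs_mult)
  qed
  then have "uniformly_convergent_on UNIV (\<lambda>n t. \<Sum>j<n. w j * m j t)"
    by (intro Weierstrass_m_test'[where M = "\<lambda>j. C * (real (Suc j) / real (smooth j))"] summable_mult summable_smooth)
  note unif = this
  have "((\<lambda>t. \<Sum>j. w j * ln (\<integral>\<tau>. exp (t * S j \<tau>) \<partial>\<mu>V)) has_real_derivative (\<Sum>j. w j * m j t)) (at t)" for t
  proof -
    define G M where "G = (\<lambda>j t. w j * ln (\<integral>\<tau>. exp (t * S j \<tau>) \<partial>\<mu>V))" and "M = (\<lambda>j t. w j * m j t)"
    have "(G j has_field_derivative M j x) (at x within UNIV)" for j x
      unfolding G_def M_def by (rule deriv)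
    moreover have "uniformly_convergent_on UNIV (\<lambda>n x. \<Sum>j<n. M j x)" unfolding M_def by (rule unif)
    moreover have "summable (\<lambda>j. G j 0)" unfolding G_def by (rule pressure(1))
    ultimately have "((\<lambda>x. \<Sum>j. G j x) has_field_derivative (\<Sum>j. M j t)) (at t)"
      by (intro has_field_derivative_series'(2)[of UNIV G M 0 t]) simp_all
    then show ?thesis unfolding G_def M_def .
  qed
  then have "((\<lambda>t. mult_pressure \<mu>U (\<lambda>\<sigma>. t * f \<sigma>)) has_real_derivative kappa p * (\<Sum>j. w j * m j t)) (at t)" for t
    unfolding pressure(2) by (rule DERIV_cmult)
  then show ?thesis by (intro exI[of _ "\<lambda>t. kappa p * (\<Sum>j. w j * m j t)"] allI)
qed

lemma large_deviations_ergodic_sum: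
  "large_deviation_principle \<mu>U (\<lambda>N \<sigma>. 1 / real N * (\<Sum>i=1..N. f (mult_shift i \<sigma>))) real (rate_function \<mu>U f)"
proof -
  let ?X = "\<lambda>N \<sigma>. 1 / real N * (\<Sum>i=1..N. f (mult_shift i \<sigma>))"
  let ?L = "\<lambda>t. mult_pressure \<mu>U (\<lambda>\<sigma>. t * f \<sigma>)"
  obtain C where C: "C \<ge> 0" "\<And>\<tau>. \<tau> \<in> configs UNIV \<Longrightarrow> \<bar>fstar \<tau>\<bar> \<le> C" using fstar_bounded[OF first] by blast
  obtain L' where L': "\<And>t. (?L has_real_derivative L' t) (at t)" using pressure_differentiable by blast
  have "bounded_mgf_limit \<mu>U ?X C ?L L'"
  proof unfold_locales
    fix N
    \<comment> \<open>Measurability of the average is obtained from its decomposition into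
      layers.\<close>
    have "(\<lambda>\<sigma>. \<Sum>r | r \<in> layer_roots p \<and> r \<le> N. box_sum fstar (layer_box p r N) (layer p r \<sigma>)) \<in> borel_measurable \<mu>U"
    proof (rule borel_measurable_sum)
      fix r assume "r \<in> {r. r \<in> layer_roots p \<and> r \<le> N}"
      then have "0 < r" using roots_pos by blast
      then show "(\<lambda>\<sigma>. box_sum fstar (layer_box p r N) (layer p r \<sigma>)) \<in> borel_measurable \<mu>U"
        by (rule measurable_compose[OF layer_measurable_U box_sum_measurable[OF fstar_measurable[OF first]]])
    qed
    then have "(\<lambda>\<sigma>. \<Sum>i=1..N. f (mult_shift i \<sigma>)) \<in> borel_measurable \<mu>U"
      by (rule measurable_cong[THEN iffD2, rotated]) (simp only: space_U ergodic_sum_eq[OF first])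
    then show "?X N \<in> borel_measurable \<mu>U" by (rule borel_measurable_times[OF borel_measurable_const])
  next
    fix N \<sigma> assume "\<sigma> \<in> space \<mu>U"
    then have \<sigma>: "\<sigma> \<in> configs {1..}" by (simp only: space_U)
    have "\<bar>f (mult_shift i \<sigma>)\<bar> \<le> C" if "i \<in> {1..N}" for i
    proof -
      have "mult_shift i \<sigma> \<in> configs {1..}" using that by (intro mult_shift_configs[OF _ \<sigma>]) simp
      then show ?thesis
        using first C(2)[OF layer_configs[of 1 "mult_shift i \<sigma>"]] unfolding first_layer_function_def by simp
    qed
    then have "\<bar>\<Sum>i=1..N. f (mult_shift i \<sigma>)\<bar> \<le> (\<Sum>i=1..N. C)"
      by (intro order_trans[OF sum_abs] sum_mono)
    then have "\<bar>\<Sum>i=1..N. f (mult_shift i \<sigma>)\<bar> \<le> real N * C" by simp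
    \<comment> \<open>For \<open>N = 0\<close> the average is 0, which is why \<open>C\<close> was
      taken nonnegative.\<close>
    then show "\<bar>?X N \<sigma>\<bar> \<le> C" using C(1) by (cases "N = 0") (simp_all add: abs_mult divide_le_eq mult.commute)
  next
    fix t
    have "1 / real N * ln (\<integral>\<sigma>. exp (t * real N * ?X N \<sigma>) \<partial>\<mu>U) = 1 / real N * log_mgf \<mu>U (\<lambda>\<sigma>. t * f \<sigma>) N" for N
      \<comment> \<open>The factors \<open>real N\<close> and \<open>1 / real N\<close> cancel only
        for positive \<open>N\<close>; for \<open>N = 0\<close> the outer factor makes both sides
        0.\<close>
      by (cases "N = 0") (simp_all add: log_mgf_def sum_distrib_left)
    moreover have "(\<lambda>N. 1 / real N * log_mgf \<mu>U (\<lambda>\<sigma>. t * f \<sigma>) N) \<longlonglongrightarrow> ?L t"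
      using pressure_limit(2,3)[OF scaled_first_layer[OF first], of t] by (simp only:)
    ultimately show "(\<lambda>N. 1 / real N * ln (\<integral>\<sigma>. exp (t * real N * ?X N \<sigma>) \<partial>\<mu>U)) \<longlonglongrightarrow> ?L t"
      by (simp only:)
  qed (rule L')
  from bounded_mgf_limit.large_deviations[OF this] show ?thesis
    by (simp only: rate_function_def[abs_def])
qed

end

end

theorem theorem6p2:
  fixes \<A> :: "nat set set" and J :: "nat set \<Rightarrow> real"
    and U :: "nat set \<Rightarrow> (nat \<Rightarrow> real) \<Rightarrow> real"
    and p :: "'d::{finite,linorder} \<Rightarrow> nat"
    and V :: "(nat ^ 'd::{finite,linorder}) set \<Rightarrow> (nat ^ 'd::{finite,linorder} \<Rightarrow> real) \<Rightarrow> real"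
    and \<mu>U :: "(nat \<Rightarrow> real) measure"
    and \<mu>V :: "(nat ^ 'd::{finite,linorder} \<Rightarrow> real) measure"
    and f :: "(nat \<Rightarrow> real) \<Rightarrow> real"
    and fstar :: "(nat ^ 'd::{finite,linorder} \<Rightarrow> real) \<Rightarrow> real"
  assumes "potential {1..} U"
    and "mult_invariant U"
    and "mult_form \<A> J U"
    and "strict_mono p" and "range p = primes_of \<A>"
    and "associated_potential p \<A> J V"
    and layer_unique: "\<exists>!\<mu>. gibbs_measure UNIV V \<mu>"
    and "gibbs_measure UNIV V \<mu>V"
    and "gibbs_measure {1..} U \<mu>U"
    and "first_layer_function p f fstar"
  shows "convergent (\<lambda>N. 1 / real N * log_mgf \<mu>U f N)
    \<and> summable (\<lambda>j. (exp (- rho_minus p (Suc j)) - exp (- rho_plus p (Suc j))) * Psi p \<mu>V fstar (Suc j))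
    \<and> mult_pressure \<mu>U f = kappa p *
        (\<Sum>j. (exp (- rho_minus p (Suc j)) - exp (- rho_plus p (Suc j))) * Psi p \<mu>V fstar (Suc j))
    \<and> large_deviation_principle \<mu>U (\<lambda>N \<sigma>. 1 / real N * (\<Sum>i=1..N. f (mult_shift i \<sigma>)))
        (\<lambda>N. real N) (rate_function \<mu>U f)"
proof -
  have prime: "prime (p k)" for k
  proof -
    have "p k \<in> primes_of \<A>" using assms(5) by blast
    then show ?thesis by (auto simp: primes_of_def)
  qed
  interpret gibbs_layers p \<A> J U V \<mu>U \<mu>V
  proof unfold_locales
    show "inj p" using assms(4) by (rule strict_mono_imp_inj_on)
    show "\<nu> = \<mu>V" if "gibbs_measure UNIV V \<nu>" for \<nu> using layer_unique assms(8) that by blast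
  qed (rule prime assms)+
  from pressure_limit[OF assms(10)] large_deviations_ergodic_sum[OF assms(10)]
  show ?thesis by (intro conjI convergentI)
qed

end
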